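(* Let $U\in(0,1)$, $\ell_0>0$ and $T>0$. Let $\Phi_0\in H^m(-\ell_0/2,\ell_0/2)$ be a periodic function of period $\ell_0$. Let $\Phi$ be the periodic solution (with period $\ell_0$ in $\eta$) of the Kuramoto-Sivashinsky equation $$\Phi_\tau+4\Phi_{\eta\eta\eta\eta}+\Phi_{\eta\eta}+\tfrac12(\Phi_\eta)^2=0$$ on the fixed time interval $[0,T]$, satisfying the initial condition $\Phi(0,\cdot)=\Phi_0$. If $m$ is large enough, then there exists $\varepsilon_0=\varepsilon_0(T)\in(0,1)$ such that, for $0<\varepsilon\le\varepsilon_0$, the equation $$\varphi_t=\mathscr{A}(\varphi)+\mathscr{M}((\varphi_y)^2),$$ with $\mathscr{A}$, $\mathscr{M}$ the Fourier multipliers defined in the context for $\gamma=1+\varepsilon$ and $\ell=\ell_\varepsilon=\frac{\ell_0}{\sqrt{\varepsilon}\,U}$, admits a unique classical solution $\varphi$ on $[0,\frac{T}{\varepsilon^2U^2}]$ which is periodic with period $\frac{\ell_0}{\sqrt{\varepsilon}\,U}$ with respect to $y$ and satisfies $$\varphi(0,y)=\varepsilon U^{-1}\Phi_0(y\sqrt{\varepsilon}\,U),\qquad |y|\le\frac{\ell_0}{2\sqrt{\varepsilon}\,U}.$$ Moreover, there exists a positive constant $C$ such that $$\left|\varphi(t,y)-\varepsilon U^{-1}\Phi(t\varepsilon^2U^2,\,y\sqrt{\varepsilon}\,U)\right|\le C\varepsilon^2,\qquad 0\le t\le\frac{T}{\varepsilon^2U^2},\quad |y|\le\frac{\ell_0}{2\sqrt{\varepsilon}\,U},$$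 for any $\varepsilon\in(0,\varepsilon_0]$.
   Context: For $\ell>0$, let $\{w_k\}_{k\ge0}$ be a complete orthonormal set of ($\ell$-periodic) eigenfunctions in $L^2(-\ell/2,\ell/2)$ of the operator $D_{yy}$ with periodic boundary conditions, with eigenvalues $-\lambda_k=-\lambda_k(\ell)$, where $\lambda_0=0$ and $\lambda_{2j-1}=\lambda_{2j}=4\pi^2j^2/\ell^2$ for $j\ge1$. Write $f=\sum_{k\ge0}\widehat f(k)w_k$. A Fourier multiplier (pseudo-differential operator) with symbol $(p_k)_{k\ge 0}$ maps $f$ to $\sum_k p_k\widehat f(k)w_k$. Given $U\in(0,1)$, $\gamma\in\mathbb{R}$ and $\ell>0$, set $X_k=\sqrt{U^2+4\lambda_k(\ell)}$. The operators $\mathscr{A}$ and $\mathscr{M}$ are the Fourier multipliers with symbols $$a_k=\frac{(U^2-X_k^2)(X_k^2-\gamma U^2)}{4UX_k},\qquad m_k=\frac{X_k^3-3UX_k^2-4\gamma U^2X_k+4\gamma U^3}{4UX_k},\qquad k\ge0.$$ *)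

theory Defs
  imports "HOL-Analysis.Analysis"
begin

definition periodic :: "real \<Rightarrow> (real \<Rightarrow> real) \<Rightarrow> bool" where
  "periodic l f \<longleftrightarrow> (\<forall>y. f (y + l) = f y)"

definition L2_on :: "real set \<Rightarrow> (real \<Rightarrow> real) \<Rightarrow> bool" where
  "L2_on S f \<longleftrightarrow> f \<in> borel_measurable (lebesgue_on S) \<and>
     integrable (lebesgue_on S) (\<lambda>y. (f y)\<^sup>2)"

abbreviation cell :: "real \<Rightarrow> real set" where
  "cell l \<equiv> {- l / 2 <..< l / 2}"

text \<open>Periodic Sobolev functions\<close>

definition test_function :: "real \<Rightarrow> real \<Rightarrow> (real \<Rightarrow> real) \<Rightarrow> bool" where
  "test_function a b \<psi> \<longleftrightarrow>
     (\<forall>n x. (deriv ^^ n) \<psi> field_differentiable at x) \<and>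
     (\<exists>c d. a < c \<and> d < b \<and> (\<forall>x. x \<notin> {c..d} \<longrightarrow> \<psi> x = 0))"

definition weak_derivative ::
    "nat \<Rightarrow> real \<Rightarrow> real \<Rightarrow> (real \<Rightarrow> real) \<Rightarrow> (real \<Rightarrow> real) \<Rightarrow> bool" where
  "weak_derivative n a b f g \<longleftrightarrow>
     (\<forall>\<psi>. test_function a b \<psi> \<longrightarrow>
        integral\<^sup>L (lebesgue_on {a<..<b}) (\<lambda>x. f x * (deriv ^^ n) \<psi> x) =
        (- 1) ^ n * integral\<^sup>L (lebesgue_on {a<..<b}) (\<lambda>x. g x * \<psi> x))"

definition sobolev_on :: "nat \<Rightarrow> real \<Rightarrow> real \<Rightarrow> (real \<Rightarrow> real) \<Rightarrow> bool" where
  "sobolev_on m a b f \<longleftrightarrow> L2_on {a<..<b} f \<and>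
     (\<forall>n\<le>m. \<exists>g. L2_on {a<..<b} g \<and> weak_derivative n a b f g)"

text \<open>All bounded intervals are needed, not just one cell: otherwise the derivatives could jump
  across the end points of the cell.\<close>

definition periodic_sobolev :: "nat \<Rightarrow> real \<Rightarrow> (real \<Rightarrow> real) \<Rightarrow> bool" where
  "periodic_sobolev m l f \<longleftrightarrow> periodic l f \<and> (\<forall>a b. a < b \<longrightarrow> sobolev_on m a b f)"

text \<open>Eigenfunction expansions and Fourier multipliers\<close>

text \<open>The integer division gives \<open>j\<close> both for \<open>k = 2 j - 1\<close> and for \<open>k = 2 j\<close>, and \<open>0\<close> for \<open>k = 0\<close>.\<close>

definition eigval :: "real \<Rightarrow> nat \<Rightarrow> real" where
  "eigval l k = 4 * pi\<^sup>2 * (real ((k + 1) div 2))\<^sup>2 / l\<^sup>2"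

definition fcoef :: "real \<Rightarrow> (nat \<Rightarrow> real \<Rightarrow> real) \<Rightarrow> (real \<Rightarrow> real) \<Rightarrow> nat \<Rightarrow> real" where
  "fcoef l w f k = integral\<^sup>L (lebesgue_on (cell l)) (\<lambda>y. f y * w k y)"

definition periodic_eigenbasis :: "real \<Rightarrow> (nat \<Rightarrow> real \<Rightarrow> real) \<Rightarrow> bool" where
  "periodic_eigenbasis l w \<longleftrightarrow>
     (\<forall>k. periodic l (w k) \<and>
        (\<exists>w'. \<forall>y. (w k has_real_derivative w' y) (at y) \<and>
                  (w' has_real_derivative - eigval l k * w k y) (at y))) \<and>
     (\<forall>j k. fcoef l w (w j) k = (if j = k then 1 else 0)) \<and>
     (\<forall>f. L2_on (cell l) f \<and> (\<forall>k. fcoef l w f k = 0) \<longrightarrow>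
        (AE y in lebesgue_on (cell l). f y = 0))"

text \<open>The relation says that the multiplier with symbol \<open>p\<close> maps \<open>f\<close> to \<open>g\<close>, the series being
  convergent in the \<open>L\<^sup>2\<close> norm.  It determines \<open>g\<close> up to a null set, hence everywhere on the cell
  if \<open>g\<close> is continuous.\<close>

definition maps_multiplier ::
    "real \<Rightarrow> (nat \<Rightarrow> real \<Rightarrow> real) \<Rightarrow> (nat \<Rightarrow> real) \<Rightarrow> (real \<Rightarrow> real) \<Rightarrow> (real \<Rightarrow> real) \<Rightarrow> bool" where
  "maps_multiplier l w p f g \<longleftrightarrow> L2_on (cell l) f \<and> L2_on (cell l) g \<and>
     (\<lambda>n. integral\<^sup>L (lebesgue_on (cell l))
        (\<lambda>y. (g y - (\<Sum>k<n. p k * fcoef l w f k * w k y))\<^sup>2)) \<longlonglongrightarrow> 0"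

definition Xsym :: "real \<Rightarrow> real \<Rightarrow> nat \<Rightarrow> real" where
  "Xsym U l k = sqrt (U\<^sup>2 + 4 * eigval l k)"

definition Asym :: "real \<Rightarrow> real \<Rightarrow> real \<Rightarrow> nat \<Rightarrow> real" where
  "Asym U \<gamma> l k =
     (U\<^sup>2 - (Xsym U l k)\<^sup>2) * ((Xsym U l k)\<^sup>2 - \<gamma> * U\<^sup>2) / (4 * U * Xsym U l k)"

definition Msym :: "real \<Rightarrow> real \<Rightarrow> real \<Rightarrow> nat \<Rightarrow> real" where
  "Msym U \<gamma> l k =
     ((Xsym U l k) ^ 3 - 3 * U * (Xsym U l k)\<^sup>2 - 4 * \<gamma> * U\<^sup>2 * Xsym U l k + 4 * \<gamma> * U ^ 3)
       / (4 * U * Xsym U l k)"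

text \<open>Classical solutions.  Functions are of the form \<open>f t y\<close>; only times in \<open>{0..T}\<close> matter,
  with one-sided time derivatives at the end points.\<close>

definition cont_strip :: "real \<Rightarrow> (real \<Rightarrow> real \<Rightarrow> real) \<Rightarrow> bool" where
  "cont_strip T f \<longleftrightarrow> continuous_on ({0..T} \<times> UNIV) (\<lambda>(t, y). f t y)"

text \<open>\<open>f\<close> is of class \<open>C\<^sup>1\<close> in time and \<open>C\<^sup>k\<close> in space, with time derivative \<open>ft\<close> and space
  derivatives \<open>D 0 = f\<close>, \<dots>, \<open>D k\<close>.\<close>

definition classical_derivs :: "nat \<Rightarrow> real \<Rightarrow> (real \<Rightarrow> real \<Rightarrow> real) \<Rightarrow>
    (real \<Rightarrow> real \<Rightarrow> real) \<Rightarrow> (nat \<Rightarrow> real \<Rightarrow> real \<Rightarrow> real) \<Rightarrow> bool" where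
  "classical_derivs k T f ft D \<longleftrightarrow>
     D 0 = f \<and> cont_strip T ft \<and> (\<forall>j\<le>k. cont_strip T (D j)) \<and>
     (\<forall>t\<in>{0..T}. \<forall>y.
        ((\<lambda>s. f s y) has_real_derivative ft t y) (at t within {0..T}) \<and>
        (\<forall>j<k. (D j t has_real_derivative D (Suc j) t y) (at y)))"

definition KS_solution ::
    "real \<Rightarrow> real \<Rightarrow> (real \<Rightarrow> real) \<Rightarrow> (real \<Rightarrow> real \<Rightarrow> real) \<Rightarrow> bool" where
  "KS_solution l T \<Phi>0 \<Phi> \<longleftrightarrow>
     (\<forall>\<tau>\<in>{0..T}. periodic l (\<Phi> \<tau>)) \<and>
     (\<forall>\<eta>. \<Phi> 0 \<eta> = \<Phi>0 \<eta>) \<and>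
     (\<exists>\<Phi>t D. classical_derivs 4 T \<Phi> \<Phi>t D \<and>
        (\<forall>\<tau>\<in>{0..T}. \<forall>\<eta>. \<Phi>t \<tau> \<eta> + 4 * D 4 \<tau> \<eta> + D 2 \<tau> \<eta> + 1 / 2 * (D 1 \<tau> \<eta>)\<^sup>2 = 0))"

text \<open>The symbol of \<open>\<A>\<close> grows like \<open>eigval powr (3/2)\<close>, that of \<open>\<M>\<close> like \<open>eigval\<close>, so the
  equation has order 3 in space.  All of its terms are required to be continuous.\<close>

definition front_solution :: "real \<Rightarrow> (nat \<Rightarrow> real \<Rightarrow> real) \<Rightarrow> real \<Rightarrow> real \<Rightarrow> real \<Rightarrow>
    (real \<Rightarrow> real) \<Rightarrow> (real \<Rightarrow> real \<Rightarrow> real) \<Rightarrow> bool" where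
  "front_solution l w U \<gamma> T \<phi>0 \<phi> \<longleftrightarrow>
     (\<forall>t\<in>{0..T}. periodic l (\<phi> t)) \<and>
     (\<forall>y. \<bar>y\<bar> \<le> l / 2 \<longrightarrow> \<phi> 0 y = \<phi>0 y) \<and>
     (\<exists>\<phi>t D G H. classical_derivs 3 T \<phi> \<phi>t D \<and> cont_strip T G \<and> cont_strip T H \<and>
        (\<forall>t\<in>{0..T}. periodic l (G t) \<and> periodic l (H t) \<and>
           maps_multiplier l w (Asym U \<gamma> l) (\<phi> t) (G t) \<and>
           maps_multiplier l w (Msym U \<gamma> l) (\<lambda>y. (D 1 t y)\<^sup>2) (H t) \<and>
           (\<forall>y. \<phi>t t y = G t y + H t y)))"

end

theory Submission
  imports Defs "HOL-Computational_Algebra.Polynomial"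
begin

text \<open>
  Put \<open>\<phi>(t, y) = \<epsilon> U\<^sup>-\<^sup>1 \<psi>(\<epsilon>\<^sup>2 U\<^sup>2 t, \<surd>\<epsilon> U y)\<close>.  Then \<open>\<psi>\<close> has the period of \<open>\<Phi>\<close> and its Fourier coefficients satisfy
  \<open>\<psi>\<^sub>n' = a\<^sub>n \<psi>\<^sub>n + m\<^sub>n ((\<psi>\<^sub>\<eta>)\<^sup>2)\<^sub>n\<close>, where for \<open>\<epsilon> \<rightarrow> 0\<close> the symbols \<open>a\<close> and \<open>m\<close> tend to those of the
  Kuramoto-Sivashinsky equation, \<open>a\<close> is of order three and \<open>m\<close> of order two.  The nonlinear term
  costs as many derivatives as the linear one gains.  This is harmless in the norm
  \<open>sup\<^sub>n\<^sub>,\<^sub>t (1 + |n|)\<^sup>p exp (- K t) |\<psi>\<^sub>n(t)|\<close>, in which Duhamel's formula for a single mode gives maximal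
  regularity with the constant \<open>|m\<^sub>n| (1 + |n|) / (K - a\<^sub>n)\<close>, and which is submultiplicative under
  convolution.  The constant is small uniformly in \<open>n\<close> once \<open>K\<close> is large and \<open>\<epsilon>\<close> small, so the
  remainder \<open>\<psi> - \<Phi>\<close> is found by a contraction on the whole interval \<open>[0, T]\<close>, and its size is that of
  the residual of \<open>\<Phi>\<close>, namely \<open>O(\<epsilon>)\<close>.  The residual needs eleven orders of decay of the coefficients
  of \<open>\<Phi>\<close>, which the initial datum provides and the Kuramoto-Sivashinsky equation propagates.  For an
  arbitrary classical solution the same estimate applies to its difference from \<open>\<psi>\<close> on short time
  intervals, on which it stays close to \<open>\<psi>\<close>; this gives uniqueness.
\<close>

text \<open>Each order of decay that recurs has its own source. Order 2 gives absolute summability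
  over the integers, and a product of two derivatives loses one order, so the convolution estimates
  start at order 3. That is also what three continuous space derivatives provide, hence uniqueness
  among classical solutions is proved in order 3. The solution itself is built in order 5, because
  the linear symbol takes three orders and a continuous term must keep two. The number 11 is 5 + 6:
  replacing the linear symbol by its limit gains a factor \<epsilon> at the price of six powers of
  the frequency. The given eigenfunctions are an arbitrary orthonormal family, in which products
  have no convenient form. The analysis therefore uses complex exponentials, where a product is a
  convolution. The translation works because the symbols depend on the frequency alone and the
  eigenfunctions of one frequency are real parts of multiples of one exponential.\<close>

section \<open>Polynomially weighted sequences on the integers and their convolutions\<close>

definition nu :: "int \<Rightarrow> real" where
  "nu n = 1 + \<bar>real_of_int n\<bar>"

lemma nu_ge1 [simp]: "1 \<le> nu n" and nu_pos [simp]: "0 < nu n" and nu_nz [simp]: "nu n \<noteq> 0"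
  and nu_ge0 [simp]: "0 \<le> nu n" and nu_uminus [simp]: "nu (- n) = nu n"
  by (auto simp: nu_def)

lemma abs_le_nu: "\<bar>real_of_int n\<bar> \<le> nu n"
  by (simp add: nu_def)

lemma nu_triangle: "nu n \<le> nu j + nu (n - j)"
  by (simp add: nu_def)

lemma divide_nu_power_mono:
  assumes "p \<le> q" "0 \<le> r" shows "r / nu n ^ q \<le> r / nu n ^ p"
  using assms by (intro divide_left_mono power_increasing) auto

text \<open>The integers are covered by two copies of the naturals, \<open>range int\<close> and its
  mirror image; their overlap at zero does no harm to summability.\<close>

lemma nu_summable: "(\<lambda>n. 1 / nu n ^ 2) summable_on UNIV"
proof -
  have s: "summable (\<lambda>n::nat. 1 / (1 + real n) ^ 2)"
    using summable_Suc_iff[THEN iffD2, OF inverse_power_summable[of 2, where ?'a=real]]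
    by (simp add: inverse_eq_divide add.commute)
  have A: "(\<lambda>n. 1 / nu n ^ 2) summable_on range int"
    by (subst summable_on_reindex)
      (auto simp: o_def nu_def summable_on_UNIV_nonneg_real_iff s)
  have B: "(\<lambda>n. 1 / nu n ^ 2) summable_on range (\<lambda>n. - int n)"
    by (subst summable_on_reindex)
      (auto simp: o_def nu_def summable_on_UNIV_nonneg_real_iff s inj_on_def)
  have "(UNIV::int set) = range int \<union> range (\<lambda>n. - int n)"
  proof (intro set_eqI iffI UnCI)
    fix n :: int assume "n \<notin> range (\<lambda>n. - int n)"
    then show "n \<in> range int"
      by (metis int_cases2 rangeI)
  qed auto
  then show ?thesis
    using summable_on_union[OF A B] by simp
qed

definition nusum :: real where
  "nusum = (\<Sum>\<^sub>\<infinity>n. 1 / nu n ^ 2)"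

lemma nusum_nonneg: "0 \<le> nusum"
  unfolding nusum_def by (intro infsum_nonneg) auto

lemma nusum_pos: "0 < nusum"
proof -
  have "(\<Sum>n\<in>{0}. 1 / nu n ^ 2) \<le> nusum"
    unfolding nusum_def by (rule finite_sum_le_infsum[OF nu_summable]) auto
  then show ?thesis by (simp add: nu_def)
qed

lemma bij_reflect: "bij_betw (\<lambda>j. n - j) UNIV (UNIV::int set)"
  by (rule bij_betwI[where g="\<lambda>j. n - j"]) auto

lemma nu_summable_shift: "(\<lambda>j. 1 / nu (n - j) ^ 2) summable_on UNIV"
  using nu_summable by (subst summable_on_reindex_bij_betw[OF bij_reflect, of "\<lambda>j. 1 / nu j ^ 2"])

lemma nusum_shift: "(\<Sum>\<^sub>\<infinity>j. 1 / nu (n - j) ^ 2) = nusum"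
  by (subst infsum_reindex_bij_betw[OF bij_reflect, of "\<lambda>j. 1 / nu j ^ 2"]) (simp add: nusum_def)

text \<open>One of \<open>j\<close> and \<open>n - j\<close> carries at least half of the weight of
  \<open>n\<close>. That factor is worth \<open>2 ^ q / nu n ^ q\<close>, and the other one stays
  summable because \<open>2 \<le> q\<close>.\<close>

lemma conv_kernel:
  assumes "2 \<le> q"
  shows "1 / (nu j ^ q * nu (n - j) ^ q) \<le> 2 ^ q / nu n ^ q * (1 / nu j ^ 2 + 1 / nu (n - j) ^ 2)"
proof -
  let ?x = "nu j" and ?y = "nu (n - j)"
  have "nu n ^ q \<le> (?x + ?y) ^ q"
    by (intro power_mono nu_triangle) auto
  also have "\<dots> \<le> (2 * max ?x ?y) ^ q"
    by (intro power_mono add_nonneg_nonneg) (auto simp: max_def)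
  also have "\<dots> \<le> 2 ^ q * (?x ^ q + ?y ^ q)"
    by (auto simp: power_mult_distrib max_def)
  finally have "nu n ^ q / (nu n ^ q * (?x ^ q * ?y ^ q))
      \<le> 2 ^ q * (?x ^ q + ?y ^ q) / (nu n ^ q * (?x ^ q * ?y ^ q))"
    by (intro divide_right_mono) auto
  also have "\<dots> = 2 ^ q / nu n ^ q * (1 / ?x ^ q + 1 / ?y ^ q)"
    by (simp add: field_simps)
  also have "\<dots> \<le> 2 ^ q / nu n ^ q * (1 / ?x ^ 2 + 1 / ?y ^ 2)"
    by (intro mult_left_mono add_mono divide_nu_power_mono assms) auto
  finally show ?thesis by simp
qed

text \<open>Decay of order \<open>p\<close> plays the role of a Banach algebra norm: it is stable under convolution
  as soon as \<open>2 \<le> p\<close>.\<close>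

definition dec :: "nat \<Rightarrow> real \<Rightarrow> (int \<Rightarrow> complex) \<Rightarrow> bool" where
  "dec p r f \<longleftrightarrow> (\<forall>n. norm (f n) \<le> r / nu n ^ p)"

lemma decD: "dec p r f \<Longrightarrow> norm (f n) \<le> r / nu n ^ p"
  by (simp add: dec_def)

lemma dec_nonneg: "dec p r f \<Longrightarrow> 0 \<le> r"
  using decD[of p r f 0] by (auto simp: nu_def dest: order_trans[OF norm_ge_zero])

lemma dec_mono: "dec p r f \<Longrightarrow> q \<le> p \<Longrightarrow> r \<le> s \<Longrightarrow> dec q s f"
  unfolding dec_def
  by (meson dec_def dec_nonneg divide_nu_power_mono divide_right_mono nu_ge0 order_trans zero_le_power)

lemma dec_add: "dec p r f \<Longrightarrow> dec p s g \<Longrightarrow> dec p (r + s) (\<lambda>n. f n + g n)"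
  unfolding dec_def by (simp add: add_divide_distrib) (meson add_mono norm_triangle_le order_trans)

lemma dec_diff: "dec p r f \<Longrightarrow> dec p s g \<Longrightarrow> dec p (r + s) (\<lambda>n. f n - g n)"
  unfolding dec_def by (simp add: add_divide_distrib) (meson add_mono norm_triangle_le_diff order_trans)

lemma dec_cmult: "dec p r f \<Longrightarrow> dec p (norm c * r) (\<lambda>n. c * f n)"
  unfolding dec_def by (simp add: norm_mult) (metis mult_left_mono norm_ge_zero times_divide_eq_right)

lemma dec_mult_growth:
  assumes "dec (p + q) r f" "\<And>n. norm (c n) \<le> s * nu n ^ q"
  shows "dec p (s * r) (\<lambda>n. c n * f n)"
  unfolding dec_def
proof
  fix n
  have "norm (c n * f n) \<le> (s * nu n ^ q) * (r / nu n ^ (p + q))"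
    unfolding norm_mult using assms decD[OF assms(1)]
    by (intro mult_mono) (auto intro: order_trans[OF norm_ge_zero])
  then show "norm (c n * f n) \<le> s * r / nu n ^ p"
    by (simp add: power_add)
qed

lemma dec_summable:
  assumes "dec p r f" "2 \<le> p" shows "(\<lambda>n. norm (f n)) summable_on UNIV"
proof -
  have "(\<lambda>n. r * (1 / nu n ^ 2)) summable_on UNIV"
    by (intro summable_on_cmult_right nu_summable)
  then show ?thesis
    by (rule Infinite_Sum.abs_summable_on_comparison_test')
      (use decD[OF dec_mono[OF assms(1,2) order_refl]] in auto)
qed

text \<open>If \<open>f\<close> and \<open>g\<close> are the Fourier coefficients of two functions with frequencies \<open>\<kappa> n\<close>, then
  \<open>Q \<kappa> f g\<close> are those of the product of their first derivatives.\<close>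

definition Qterm :: "real \<Rightarrow> (int \<Rightarrow> complex) \<Rightarrow> (int \<Rightarrow> complex) \<Rightarrow> int \<Rightarrow> int \<Rightarrow> complex" where
  "Qterm \<kappa> f g n j =
     of_real (- (\<kappa>\<^sup>2) * real_of_int j * real_of_int (n - j)) * f j * g (n - j)"

definition Q :: "real \<Rightarrow> (int \<Rightarrow> complex) \<Rightarrow> (int \<Rightarrow> complex) \<Rightarrow> int \<Rightarrow> complex" where
  "Q \<kappa> f g n = (\<Sum>\<^sub>\<infinity>j. Qterm \<kappa> f g n j)"

text \<open>The factor \<open>2 ^ q\<close> comes from \<open>conv_kernel\<close>; the remaining 2
  counts the two series there, each with sum \<open>nusum\<close>.\<close>

definition cconv :: "nat \<Rightarrow> real" where
  "cconv q = 2 ^ (q + 1) * nusum"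

lemma cconv_pos: "0 < cconv q"
  by (simp add: cconv_def nusum_pos)

text \<open>Each factor is differentiated once, which consumes one order of its decay. This is why
  inputs of order \<open>q + 1\<close> give an output of order \<open>q\<close> throughout.\<close>

lemma Qterm_bound:
  assumes f: "dec (q + 1) r f" and g: "dec (q + 1) s g" and q: "2 \<le> q"
  shows "norm (Qterm \<kappa> f g n j)
    \<le> \<kappa>\<^sup>2 * r * s * (2 ^ q / nu n ^ q) * (1 / nu j ^ 2 + 1 / nu (n - j) ^ 2)"
proof -
  have r: "0 \<le> r" and s: "0 \<le> s"
    using f g by (auto dest: dec_nonneg)
  have "norm (Qterm \<kappa> f g n j) = \<kappa>\<^sup>2 * (\<bar>real_of_int j\<bar> * norm (f j)) *
      (\<bar>real_of_int (n - j)\<bar> * norm (g (n - j)))"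
    by (simp add: Qterm_def norm_mult abs_mult del: of_int_diff of_real_mult of_real_minus)
  also have "\<dots> \<le> \<kappa>\<^sup>2 * (nu j * (r / nu j ^ (q + 1))) * (nu (n - j) * (s / nu (n - j) ^ (q + 1)))"
    using r s by (intro mult_mono abs_le_nu decD[OF f] decD[OF g]) auto
  also have "\<dots> = \<kappa>\<^sup>2 * r * s * (1 / (nu j ^ q * nu (n - j) ^ q))"
    by simp
  also have "\<dots> \<le> \<kappa>\<^sup>2 * r * s * (2 ^ q / nu n ^ q * (1 / nu j ^ 2 + 1 / nu (n - j) ^ 2))"
    using r s by (intro mult_left_mono conv_kernel q) auto
  finally show ?thesis by (simp add: mult.assoc)
qed

lemma kernel_summable:
  "(\<lambda>j. c * (1 / nu j ^ 2 + 1 / nu (n - j) ^ 2)) summable_on UNIV"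
  by (intro summable_on_cmult_right summable_on_add nu_summable nu_summable_shift)

lemma Qterm_summable:
  assumes "dec (q + 1) r f" "dec (q + 1) s g" "2 \<le> q"
  shows "(\<lambda>j. Qterm \<kappa> f g n j) summable_on UNIV"
  by (rule abs_summable_summable, rule Infinite_Sum.abs_summable_on_comparison_test'[OF kernel_summable])
    (rule Qterm_bound[OF assms])

lemma Q_bound:
  assumes "dec (q + 1) r f" "dec (q + 1) s g" "2 \<le> q"
  shows "dec q (\<kappa>\<^sup>2 * cconv q * r * s) (Q \<kappa> f g)"
  unfolding dec_def
proof
  fix n
  let ?c = "\<kappa>\<^sup>2 * r * s * (2 ^ q / nu n ^ q)"
  have "norm (Q \<kappa> f g n) \<le> (\<Sum>\<^sub>\<infinity>j. ?c * (1 / nu j ^ 2 + 1 / nu (n - j) ^ 2))"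
    unfolding Q_def
    by (intro norm_infsum_le[OF has_sum_infsum[OF Qterm_summable[OF assms]]
          has_sum_infsum[OF kernel_summable] Qterm_bound[OF assms]])
  also have "\<dots> = ?c * (nusum + nusum)"
    by (subst infsum_cmult_right', subst infsum_add[OF nu_summable nu_summable_shift])
      (simp add: nusum_shift flip: nusum_def)
  finally show "norm (Q \<kappa> f g n) \<le> \<kappa>\<^sup>2 * cconv q * r * s / nu n ^ q"
    by (simp add: cconv_def mult_ac)
qed

lemma Q_add_left:
  assumes "dec (q + 1) r f" "dec (q + 1) r' f'" "dec (q + 1) s g" "2 \<le> q"
  shows "Q \<kappa> (\<lambda>n. f n + f' n) g n = Q \<kappa> f g n + Q \<kappa> f' g n"
  unfolding Q_def
  by (subst infsum_add[OF Qterm_summable[OF assms(1,3,4)] Qterm_summable[OF assms(2,3,4)], symmetric],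
      rule infsum_cong) (simp add: Qterm_def algebra_simps)

lemma Q_cmult: "Q \<kappa> (\<lambda>n. c * f n) (\<lambda>n. d * g n) n = c * d * Q \<kappa> f g n"
  unfolding Q_def by (subst infsum_cmult_right'[symmetric], rule infsum_cong) (simp add: Qterm_def mult_ac)

lemma Q_scale: "Q (c * \<kappa>) f g n = of_real (c\<^sup>2) * Q \<kappa> f g n"
  unfolding Q_def by (subst infsum_cmult_right'[symmetric], rule infsum_cong) (simp add: Qterm_def power_mult_distrib mult_ac)

lemma Q_commute: "Q \<kappa> f g n = Q \<kappa> g f n"
  unfolding Q_def
  by (subst infsum_reindex_bij_betw[OF bij_reflect[of n], symmetric], rule infsum_cong)
    (simp add: Qterm_def mult_ac)

lemma Q_add_right:
  assumes "dec (q + 1) r f" "dec (q + 1) r' f'" "dec (q + 1) s g" "2 \<le> q"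
  shows "Q \<kappa> g (\<lambda>n. f n + f' n) n = Q \<kappa> g f n + Q \<kappa> g f' n"
  using Q_add_left[OF assms] by (simp add: Q_commute[of _ g])

lemma Q_diff_left:
  assumes "dec (q + 1) r f" "dec (q + 1) r' f'" "dec (q + 1) s g" "2 \<le> q"
  shows "Q \<kappa> (\<lambda>n. f n - f' n) g n = Q \<kappa> f g n - Q \<kappa> f' g n"
  using Q_add_left[OF assms(1) dec_cmult[OF assms(2), of "-1"] assms(3,4), of \<kappa> n]
    Q_cmult[of \<kappa> "-1" f' 1 g n] by simp

text \<open>Bilinearity and symmetry factor a difference of squares. The difference of two solutions
  thereby satisfies a linear equation whose coefficient is their sum.\<close>

lemma Q_square_diff:
  assumes f: "dec (q + 1) r f" and g: "dec (q + 1) s g" and q: "2 \<le> q"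
  shows "Q \<kappa> f f n - Q \<kappa> g g n = Q \<kappa> (\<lambda>n. f n + g n) (\<lambda>n. f n - g n) n"
proof -
  have "Q \<kappa> (\<lambda>n. f n + g n) (\<lambda>n. f n - g n) n = Q \<kappa> f (\<lambda>n. f n - g n) n + Q \<kappa> g (\<lambda>n. f n - g n) n"
    by (rule Q_add_left[OF f g dec_diff[OF f g] q])
  also have "\<dots> = (Q \<kappa> f f n - Q \<kappa> g f n) + (Q \<kappa> f g n - Q \<kappa> g g n)"
    using Q_diff_left[OF f g f q] Q_diff_left[OF f g g q]
    by (simp add: Q_commute[of _ _ "\<lambda>n. f n - g n"])
  finally show ?thesis by (simp add: Q_commute[of _ g f])
qed

text \<open>Conjugation combined with \<open>n \<mapsto> - n\<close> is complex conjugation seen on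
  the Fourier side. That the quadratic term commutes with it is the reason why real data lead to
  real solutions.\<close>

lemma Q_cnj: "Q \<kappa> (\<lambda>n. cnj (f (- n))) (\<lambda>n. cnj (g (- n))) n = cnj (Q \<kappa> f g (- n))"
proof -
  have b: "bij_betw uminus (UNIV::int set) UNIV"
    by (rule bij_betwI[where g=uminus]) auto
  have t: "Qterm \<kappa> (\<lambda>n. cnj (f (- n))) (\<lambda>n. cnj (g (- n))) n (- j) = cnj (Qterm \<kappa> f g (- n) j)" for j
  proof -
    have "- (n - - j) = - n - j" by simp
    then show ?thesis
      unfolding Qterm_def by (simp only:) (simp add: algebra_simps)
  qed
  have "Q \<kappa> (\<lambda>n. cnj (f (- n))) (\<lambda>n. cnj (g (- n))) n
      = (\<Sum>\<^sub>\<infinity>j. cnj (Qterm \<kappa> f g (- n) j))"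
    unfolding Q_def
    by (subst infsum_reindex_bij_betw[OF b, symmetric], rule infsum_cong) (simp add: t)
  then show ?thesis
    by (simp add: Q_def)
qed

text \<open>The majorant in \<open>Qterm_bound\<close> does not depend on time, so the convolution
  series converges uniformly in \<open>t\<close>.\<close>

lemma continuous_on_Q:
  assumes "\<And>n. continuous_on S (f n)" "\<And>n. continuous_on S (g n)"
    and "\<And>t. t \<in> S \<Longrightarrow> dec (q + 1) r (\<lambda>n. f n t)" "\<And>t. t \<in> S \<Longrightarrow> dec (q + 1) s (\<lambda>n. g n t)"
    and "2 \<le> q"
  shows "continuous_on S (\<lambda>t. Q \<kappa> (\<lambda>n. f n t) (\<lambda>n. g n t) n)"
proof -
  have "uniform_limit S (\<lambda>X t. \<Sum>j\<in>X. Qterm \<kappa> (\<lambda>n. f n t) (\<lambda>n. g n t) n j)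
      (\<lambda>t. Q \<kappa> (\<lambda>n. f n t) (\<lambda>n. g n t) n) (finite_subsets_at_top UNIV)"
    unfolding Q_def
    by (rule Weierstrass_m_test_general[OF Qterm_bound[OF assms(3,4,5)] kernel_summable])
  moreover have "continuous_on S (\<lambda>t. \<Sum>j\<in>X. Qterm \<kappa> (\<lambda>n. f n t) (\<lambda>n. g n t) n j)" for X
    unfolding Qterm_def by (intro continuous_intros assms)
  ultimately show ?thesis
    by (intro uniform_limit_theorem[OF always_eventually]) (auto simp: finite_subsets_at_top_neq_bot)
qed

section \<open>Duhamel's formula for a single mode\<close>

text \<open>With the integrating factor \<open>exp (- a * t)\<close> the forcing is at most
  \<open>b * exp ((K - a) * t)\<close>, and integrating this exponential produces
  \<open>1 / (K - a)\<close>. That quotient is the full gain of the linear part: no singular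
  semigroup kernel has to be integrated. The initial value is allowed to grow at rate
  \<open>K\<close> instead of \<open>a\<close> only to fit the common weight.\<close>

lemma ode_bound:
  fixes x :: "real \<Rightarrow> complex"
  assumes ode: "\<And>t. t \<in> {t0..t1} \<Longrightarrow>
      (x has_vector_derivative of_real a * x t + g t) (at t within {t0..t1})"
    and g: "\<And>t. t \<in> {t0..t1} \<Longrightarrow> norm (g t) \<le> b * exp (K * t)"
    and K: "a < K" and b: "0 \<le> b" and t: "t \<in> {t0..t1}"
  shows "norm (x t) \<le> exp (K * (t - t0)) * norm (x t0) + b * exp (K * t) / (K - a)"
proof -
  define y where "y = (\<lambda>t. of_real (exp (- a * t)) * x t)"
  define \<phi> where "\<phi> = (\<lambda>t. b * exp ((K - a) * t) / (K - a))"
  have y': "(y has_vector_derivative of_real (exp (- a * t)) * g t) (at t within {t0..t1})"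
    if "t \<in> {t0..t1}" for t
  proof -
    have e: "((\<lambda>t. of_real (exp (- a * t)) :: complex) has_vector_derivative
        of_real (- a * exp (- a * t))) (at t within {t0..t1})"
      by (intro has_vector_derivative_of_real) (auto intro!: derivative_eq_intros)
    show ?thesis
      unfolding y_def
      by (rule has_vector_derivative_eq_rhs[OF has_vector_derivative_mult[OF e ode[OF that]]])
        (simp add: algebra_simps)
  qed
  have \<phi>': "(\<phi> has_vector_derivative b * exp ((K - a) * t)) (at t)" for t
  proof -
    have "((\<lambda>t. b * exp (c * t) / c) has_real_derivative b * exp (c * t)) (at t)" if "c \<noteq> 0" for c
      using that by (auto intro!: derivative_eq_intros)
    from this[of "K - a"] show ?thesis
      unfolding \<phi>_def has_real_derivative_iff_has_vector_derivative[symmetric] using K by auto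
  qed
  have "norm (y t - y t0) \<le> \<phi> t - \<phi> t0"
  proof (cases "t = t0")
    case False
    then have lt: "t0 < t" using t by auto
    show ?thesis
    proof (rule differentiable_bound_general[OF lt])
      show "continuous_on {t0..t} y"
      proof (rule continuous_on_vector_derivative)
        fix x assume "x \<in> {t0..t}"
        then show "(y has_vector_derivative of_real (exp (- a * x)) * g x) (at x within {t0..t})"
          using t by (intro has_vector_derivative_within_subset[OF y']) auto
      qed
      show "continuous_on {t0..t} \<phi>"
        using \<phi>' by (intro continuous_on_vector_derivative) (auto intro: has_vector_derivative_at_within)
      fix u assume u: "t0 < u" "u < t"
      show "(y has_vector_derivative of_real (exp (- a * u)) * g u) (at u)"
      proof -
        have "at u within {t0..t1} = at u"
          by (rule at_within_Icc_at) (use u t in auto)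
        then show ?thesis using y'[of u] u t by auto
      qed
      show "(\<phi> has_vector_derivative b * exp ((K - a) * u)) (at u)" by (rule \<phi>')
      have "norm (of_real (exp (- a * u)) * g u) \<le> exp (- a * u) * (b * exp (K * u))"
        using g[of u] u t by (simp add: norm_mult)
      also have "\<dots> = b * exp ((K - a) * u)"
        by (simp add: exp_add[symmetric] algebra_simps)
      finally show "norm (complex_of_real (exp (- a * u)) * g u) \<le> b * exp ((K - a) * u)" .
    qed
  qed auto
  moreover have "0 \<le> \<phi> t0" using b K by (simp add: \<phi>_def)
  ultimately have "norm (y t) \<le> norm (y t0) + \<phi> t"
    using norm_triangle_sub[of "y t" "y t0"] by linarith
  then have "exp (a * t) * norm (y t) \<le> exp (a * t) * (norm (y t0) + \<phi> t)"
    by (intro mult_left_mono) auto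
  moreover have "exp (a * t) * norm (y t) = norm (x t)"
    by (simp add: y_def norm_mult mult.assoc[symmetric] exp_add[symmetric])
  moreover have "exp (a * t) * norm (y t0) \<le> exp (K * (t - t0)) * norm (x t0)"
  proof -
    have "exp (a * t) * norm (y t0) = exp (a * (t - t0)) * norm (x t0)"
    proof -
      have "exp (a * t) * norm (y t0) = (exp (a * t) * exp (- a * t0)) * norm (x t0)"
        by (simp add: y_def norm_mult)
      also have "exp (a * t) * exp (- a * t0) = exp (a * (t - t0))"
        by (simp add: mult_exp_exp right_diff_distrib)
      finally show ?thesis .
    qed
    also have "\<dots> \<le> exp (K * (t - t0)) * norm (x t0)"
      using K t by (intro mult_right_mono) (auto intro!: mult_right_mono)
    finally show ?thesis .
  qed
  moreover have "exp (a * t) * \<phi> t = b * exp (K * t) / (K - a)"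
  proof -
    have "exp (a * t) * exp ((K - a) * t) = exp (K * t)"
      by (simp add: mult_exp_exp algebra_simps)
    then show ?thesis by (simp add: \<phi>_def) 
  qed
  ultimately show ?thesis by (simp add: ring_distribs)
qed

text \<open>Keeping \<open>exp (a * t)\<close> outside the integral leaves an integrand independent
  of the upper limit, so the product rule suffices. This formula defines the map iterated in
  \<open>modes_exist\<close>.\<close>

lemma duhamel:
  fixes g :: "real \<Rightarrow> complex"
  assumes g: "continuous_on {0..T} g" and t: "t \<in> {0..T}"
  shows "((\<lambda>t. of_real (exp (a * t)) * integral {0..t} (\<lambda>s. of_real (exp (- a * s)) * g s))
    has_vector_derivative
      of_real a * (of_real (exp (a * t)) * integral {0..t} (\<lambda>s. of_real (exp (- a * s)) * g s)) + g t)
    (at t within {0..T})"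
proof -
  have e: "((\<lambda>t. of_real (exp (a * t)) :: complex) has_vector_derivative
      of_real (a * exp (a * t))) (at t within {0..T})"
    by (intro has_vector_derivative_of_real) (auto intro!: derivative_eq_intros)
  have i: "((\<lambda>t. integral {0..t} (\<lambda>s. of_real (exp (- a * s)) * g s)) has_vector_derivative
      of_real (exp (- a * t)) * g t) (at t within {0..T})"
    by (rule integral_has_vector_derivative[OF _ t]) (intro continuous_intros g)
  have "of_real (exp (a * t)) * (of_real (exp (- a * t)) * g t) = g t"
    by (simp add: exp_minus)
  then show ?thesis
    by (intro has_vector_derivative_eq_rhs[OF has_vector_derivative_mult[OF e i]]) simp
qed

text \<open>Two applications of \<open>(1 + x)\<^sup>2 \<le> 2 * (1 + x\<^sup>2)\<close> give the
  constant 8. The symbols control powers of \<open>n\<close>, which vanish at zero, whereas the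
  decay is measured in \<open>nu n\<close>; this inequality mediates between the two.\<close>

lemma nu_power4_le: "nu n ^ 4 \<le> 8 * (1 + real_of_int n ^ 4)"
proof -
  let ?r = "real_of_int n"
  have sq: "(1 + x)\<^sup>2 \<le> 2 * (1 + x\<^sup>2)" for x :: real
    using zero_le_power2[of "1 - x"] by (simp add: power2_eq_square algebra_simps)
  have "((1 + \<bar>?r\<bar>)\<^sup>2)\<^sup>2 \<le> (2 * (1 + \<bar>?r\<bar>\<^sup>2))\<^sup>2"
    by (intro power_mono sq) auto
  also have "\<dots> \<le> 4 * (2 * (1 + (\<bar>?r\<bar>\<^sup>2)\<^sup>2))"
    using sq[of "\<bar>?r\<bar>\<^sup>2"] by (simp only: power_mult_distrib) simp
  finally have "((1 + \<bar>?r\<bar>)\<^sup>2)\<^sup>2 \<le> 8 * (1 + (\<bar>?r\<bar>\<^sup>2)\<^sup>2)" by simp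
  moreover have "(\<bar>?r\<bar>\<^sup>2)\<^sup>2 = ?r ^ 4" "((1 + \<bar>?r\<bar>)\<^sup>2)\<^sup>2 = nu n ^ 4"
    by (simp_all add: nu_def flip: power_mult)
  ultimately show ?thesis by simp
qed

section \<open>The rescaled symbols\<close>

text \<open>In the variables \<open>\<tau> = \<epsilon>\<^sup>2 U\<^sup>2 t\<close>, \<open>\<eta> = \<surd>\<epsilon> U y\<close>, \<open>\<phi> = \<epsilon> U\<^sup>-\<^sup>1 \<psi>\<close> the operators have the following
  symbols, where \<open>lam = (\<kappa> n)\<^sup>2\<close> and \<open>scaled_X = X / U\<close>.\<close>

definition lam :: "real \<Rightarrow> int \<Rightarrow> real" where
  "lam \<kappa> n = (\<kappa> * real_of_int n)\<^sup>2"

definition scaled_X :: "real \<Rightarrow> real \<Rightarrow> int \<Rightarrow> real" where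
  "scaled_X \<kappa> \<epsilon> n = sqrt (1 + 4 * \<epsilon> * lam \<kappa> n)"

definition scaled_A :: "real \<Rightarrow> real \<Rightarrow> int \<Rightarrow> real" where
  "scaled_A \<kappa> \<epsilon> n = - (4 * (lam \<kappa> n)\<^sup>2 - lam \<kappa> n) / scaled_X \<kappa> \<epsilon> n"

definition scaled_M :: "real \<Rightarrow> real \<Rightarrow> int \<Rightarrow> real" where
  "scaled_M \<kappa> \<epsilon> n =
     (scaled_X \<kappa> \<epsilon> n)\<^sup>2 / 4 - 3 * scaled_X \<kappa> \<epsilon> n / 4 - (1 + \<epsilon>) + (1 + \<epsilon>) / scaled_X \<kappa> \<epsilon> n"

lemma lam_nonneg [simp]: "0 \<le> lam \<kappa> n"
  by (simp add: lam_def)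

lemma lam_le: "lam \<kappa> n \<le> \<kappa>\<^sup>2 * nu n ^ 2"
proof -
  have "(real_of_int n)\<^sup>2 \<le> nu n ^ 2"
    using power_mono[OF abs_le_nu, of n 2] by simp
  then show ?thesis
    by (simp add: lam_def power_mult_distrib mult_left_mono)
qed

lemma scaled_X_ge1: "0 \<le> \<epsilon> \<Longrightarrow> 1 \<le> scaled_X \<kappa> \<epsilon> n"
  by (simp add: scaled_X_def)

lemma scaled_X_sq: "0 \<le> \<epsilon> \<Longrightarrow> (scaled_X \<kappa> \<epsilon> n)\<^sup>2 = 1 + 4 * \<epsilon> * lam \<kappa> n"
  by (simp add: scaled_X_def)

lemma scaled_X_minus1_le: "0 \<le> \<epsilon> \<Longrightarrow> scaled_X \<kappa> \<epsilon> n - 1 \<le> 2 * \<epsilon> * lam \<kappa> n"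
proof -
  assume e: "0 \<le> \<epsilon>"
  have "(scaled_X \<kappa> \<epsilon> n)\<^sup>2 \<le> (1 + 2 * \<epsilon> * lam \<kappa> n)\<^sup>2"
    unfolding scaled_X_sq[OF e] by (simp add: power2_eq_square algebra_simps e)
  then have "scaled_X \<kappa> \<epsilon> n \<le> 1 + 2 * \<epsilon> * lam \<kappa> n"
    by (rule power2_le_imp_le) (use e in auto)
  then show ?thesis by simp
qed

lemma lam_quadratic: "lam \<kappa> n \<le> (lam \<kappa> n)\<^sup>2 + 1 / 4"
  using zero_le_power2[of "lam \<kappa> n - 1 / 2"] by (simp add: power2_eq_square algebra_simps)

text \<open>Multiplying by \<open>scaled_X\<close> clears the denominator, and
  \<open>lam_quadratic\<close> absorbs the destabilising second-order term into one of the four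
  squares, which leaves three. The bound by 1 holds for all \<epsilon> and \<open>n\<close>, so any
  \<open>K \<ge> 2\<close> leaves a gap of at least 1.\<close>

lemma scaled_A_gap:
  assumes "0 \<le> \<epsilon>"
  shows "0 \<le> K \<Longrightarrow> K + 3 * (lam \<kappa> n)\<^sup>2 - 1 / 4 \<le> (K - scaled_A \<kappa> \<epsilon> n) * scaled_X \<kappa> \<epsilon> n"
    and "scaled_A \<kappa> \<epsilon> n \<le> 1"
proof -
  note s = scaled_X_ge1[OF assms, of \<kappa> n]
  have "(K - scaled_A \<kappa> \<epsilon> n) * scaled_X \<kappa> \<epsilon> n = K * scaled_X \<kappa> \<epsilon> n + (4 * (lam \<kappa> n)\<^sup>2 - lam \<kappa> n)"
    using s by (simp add: scaled_A_def field_simps)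
  moreover have "K * 1 \<le> K * scaled_X \<kappa> \<epsilon> n" if "0 \<le> K"
    using s that by (intro mult_left_mono) auto
  ultimately show "K + 3 * (lam \<kappa> n)\<^sup>2 - 1 / 4 \<le> (K - scaled_A \<kappa> \<epsilon> n) * scaled_X \<kappa> \<epsilon> n" if "0 \<le> K"
    using lam_quadratic[of \<kappa> n] that by simp
  have "lam \<kappa> n - 4 * (lam \<kappa> n)\<^sup>2 \<le> scaled_X \<kappa> \<epsilon> n"
    using lam_quadratic[of \<kappa> n] s zero_le_power2[of "lam \<kappa> n"] by linarith
  then show "scaled_A \<kappa> \<epsilon> n \<le> 1"
    using s by (simp add: scaled_A_def divide_le_eq)
qed

lemma scaled_M_le_square:
  assumes "0 \<le> \<epsilon>" "\<epsilon> \<le> 1" shows "\<bar>scaled_M \<kappa> \<epsilon> n\<bar> \<le> 5 * (scaled_X \<kappa> \<epsilon> n)\<^sup>2"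
proof -
  let ?s = "scaled_X \<kappa> \<epsilon> n"
  have s: "1 \<le> ?s" using scaled_X_ge1 assms by auto
  have "?s * 1 \<le> ?s * ?s" using s by (intro mult_left_mono) auto
  moreover have "(1 + \<epsilon>) / ?s \<le> 2" using s assms by (simp add: divide_le_eq)
  moreover have "0 \<le> (1 + \<epsilon>) / ?s" using s assms by simp
  ultimately show ?thesis
    using s assms unfolding scaled_M_def power2_eq_square by (intro abs_leI) linarith+
qed

lemma scaled_M_growth:
  assumes "0 \<le> \<epsilon>" "\<epsilon> \<le> 1" shows "\<bar>scaled_M \<kappa> \<epsilon> n\<bar> \<le> 5 * (1 + 4 * \<kappa>\<^sup>2) * nu n ^ 2"
proof -
  have "\<epsilon> * lam \<kappa> n \<le> 1 * (\<kappa>\<^sup>2 * nu n ^ 2)"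
    using assms lam_le by (intro mult_mono) auto
  moreover have "1 \<le> nu n ^ 2" by simp
  moreover have "(1 + 4 * \<kappa>\<^sup>2) * nu n ^ 2 = nu n ^ 2 + 4 * (\<kappa>\<^sup>2 * nu n ^ 2)"
    by (simp add: algebra_simps)
  moreover have "(scaled_X \<kappa> \<epsilon> n)\<^sup>2 = 1 + 4 * (\<epsilon> * lam \<kappa> n)"
    using assms by (simp add: scaled_X_sq)
  ultimately have "(scaled_X \<kappa> \<epsilon> n)\<^sup>2 \<le> (1 + 4 * \<kappa>\<^sup>2) * nu n ^ 2"
    by linarith
  then show ?thesis
    using scaled_M_le_square[OF assms, of \<kappa> n] by linarith
qed

text \<open>For fixed \<epsilon> the denominator grows like
  \<open>2 * sqrt \<epsilon> * \<kappa> * \<bar>n\<bar>\<close> and lowers the order from four to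
  three. The constant blows up as \<epsilon> tends to zero; it serves only for the qualitative
  continuity of the terms of the equation.\<close>

lemma scaled_A_growth:
  assumes "0 < \<epsilon>" "0 < \<kappa>"
  shows "\<bar>scaled_A \<kappa> \<epsilon> n\<bar> \<le> (2 * \<kappa> ^ 3 / sqrt \<epsilon> + \<kappa>\<^sup>2) * nu n ^ 3"
proof -
  let ?s = "scaled_X \<kappa> \<epsilon> n" and ?r = "\<bar>real_of_int n\<bar>"
  have s: "1 \<le> ?s" using scaled_X_ge1 assms by auto
  have lr: "lam \<kappa> n = \<kappa>\<^sup>2 * ?r\<^sup>2" by (simp add: lam_def power_mult_distrib)
  have "(2 * sqrt \<epsilon> * \<kappa> * ?r)\<^sup>2 \<le> ?s\<^sup>2"
    using assms by (simp add: scaled_X_sq lr power_mult_distrib)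
  then have sr: "2 * sqrt \<epsilon> * \<kappa> * ?r \<le> ?s"
    by (rule power2_le_imp_le) (use s in auto)
  have "4 * (lam \<kappa> n)\<^sup>2 = 2 * \<kappa> ^ 3 / sqrt \<epsilon> * ?r ^ 3 * (2 * sqrt \<epsilon> * \<kappa> * ?r)"
    using assms by (simp add: lr field_simps power2_eq_square power3_eq_cube)
  also have "\<dots> \<le> 2 * \<kappa> ^ 3 / sqrt \<epsilon> * nu n ^ 3 * ?s"
    using sr assms by (intro mult_mono power_mono abs_le_nu) auto
  finally have 1: "4 * (lam \<kappa> n)\<^sup>2 / ?s \<le> 2 * \<kappa> ^ 3 / sqrt \<epsilon> * nu n ^ 3"
    using s by (simp add: divide_le_eq)
  have "lam \<kappa> n / ?s \<le> lam \<kappa> n / 1"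
    using s by (intro divide_left_mono) auto
  also have "\<dots> \<le> \<kappa>\<^sup>2 * nu n ^ 2" using lam_le by simp
  also have "\<dots> \<le> \<kappa>\<^sup>2 * nu n ^ 3" by (intro mult_left_mono power_increasing) auto
  finally have 2: "lam \<kappa> n / ?s \<le> \<kappa>\<^sup>2 * nu n ^ 3" .
  have "0 \<le> lam \<kappa> n / ?s" "0 \<le> 4 * (lam \<kappa> n)\<^sup>2 / ?s" using s by auto
  moreover have "scaled_A \<kappa> \<epsilon> n = lam \<kappa> n / ?s - 4 * (lam \<kappa> n)\<^sup>2 / ?s"
    by (simp add: scaled_A_def diff_divide_distrib)
  ultimately show ?thesis
    using 1 2 by (simp add: distrib_right abs_le_iff)
qed

text \<open>The difference is \<open>4 * lam\<^sup>2 - lam\<close> times \<open>(s - 1) / s\<close>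
  with \<open>s = scaled_X\<close>, and \<open>s - 1 \<le> 2 * \<epsilon> * lam\<close>. The factor
  \<epsilon> thus costs one more power of \<open>lam\<close>, which turns order four into
  six.\<close>

lemma scaled_A_consistent:
  assumes "0 \<le> \<epsilon>"
  shows "\<bar>scaled_A \<kappa> \<epsilon> n - scaled_A \<kappa> 0 n\<bar> \<le> \<epsilon> * (8 * \<kappa> ^ 6 + 2 * \<kappa> ^ 4) * nu n ^ 6"
proof -
  let ?s = "scaled_X \<kappa> \<epsilon> n" and ?l = "lam \<kappa> n"
  have s: "1 \<le> ?s" using scaled_X_ge1 assms by auto
  have s0: "scaled_X \<kappa> 0 n = 1" by (simp add: scaled_X_def)
  have "scaled_A \<kappa> \<epsilon> n - scaled_A \<kappa> 0 n = (4 * ?l\<^sup>2 - ?l) * ((?s - 1) / ?s)"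
    using s by (simp add: scaled_A_def s0 field_simps)
  then have "\<bar>scaled_A \<kappa> \<epsilon> n - scaled_A \<kappa> 0 n\<bar> = \<bar>4 * ?l\<^sup>2 - ?l\<bar> * \<bar>(?s - 1) / ?s\<bar>"
    by (simp only: abs_mult)
  also have "\<dots> \<le> (4 * ?l\<^sup>2 + ?l) * (2 * \<epsilon> * ?l)"
  proof (rule mult_mono)
    have "\<bar>(?s - 1) / ?s\<bar> \<le> (?s - 1) / 1"
      using s by (simp add: divide_le_eq mult_right_mono)
        (metis diff_ge_0_iff_ge mult.commute mult_le_cancel_left1 not_le)
    then show "\<bar>(?s - 1) / ?s\<bar> \<le> 2 * \<epsilon> * ?l"
      using scaled_X_minus1_le[OF assms, of \<kappa> n] by simp
    show "\<bar>4 * ?l\<^sup>2 - ?l\<bar> \<le> 4 * ?l\<^sup>2 + ?l"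
      using zero_le_power2[of ?l] lam_nonneg[of \<kappa> n] by linarith
  qed (use assms in auto)
  also have "\<dots> \<le> (4 * (\<kappa>\<^sup>2 * nu n ^ 2)\<^sup>2 + \<kappa>\<^sup>2 * nu n ^ 4) * (2 * \<epsilon> * (\<kappa>\<^sup>2 * nu n ^ 2))"
  proof -
    have "\<kappa>\<^sup>2 * nu n ^ 2 \<le> \<kappa>\<^sup>2 * nu n ^ 4" by (intro mult_left_mono power_increasing) auto
    then have "?l \<le> \<kappa>\<^sup>2 * nu n ^ 4" using lam_le[of \<kappa> n] by linarith
    then show ?thesis
      using assms by (intro mult_mono add_mono mult_left_mono power_mono lam_le) auto
  qed
  also have "\<dots> = \<epsilon> * (8 * \<kappa> ^ 6 + 2 * \<kappa> ^ 4) * nu n ^ 6"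
    by (simp add: power_mult_distrib algebra_simps flip: power_mult power_add)
  finally show ?thesis .
qed

text \<open>At \<open>scaled_X = 1\<close> the symbol equals \<open>- 1 / 2\<close> for every
  \<epsilon>, so \<open>s - 1\<close> factors out, where \<open>s = scaled_X\<close>. Bounding the
  cofactor by \<open>3 * (s + 1)\<close> rebuilds \<open>s\<^sup>2 - 1\<close>, in which the square
  root has disappeared.\<close>

lemma scaled_M_consistent:
  assumes "0 \<le> \<epsilon>" "\<epsilon> \<le> 1"
  shows "\<bar>scaled_M \<kappa> \<epsilon> n + 1 / 2\<bar> \<le> \<epsilon> * (12 * \<kappa>\<^sup>2) * nu n ^ 2"
proof -
  let ?s = "scaled_X \<kappa> \<epsilon> n"
  have s: "1 \<le> ?s" using scaled_X_ge1 assms by auto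
  have "scaled_M \<kappa> \<epsilon> n + 1 / 2 = (?s - 1) * ((?s + 1) / 4 - 3 / 4 - (1 + \<epsilon>) / ?s)"
    using s by (simp add: scaled_M_def field_simps power2_eq_square)
  then have "\<bar>scaled_M \<kappa> \<epsilon> n + 1 / 2\<bar> = (?s - 1) * \<bar>(?s + 1) / 4 - 3 / 4 - (1 + \<epsilon>) / ?s\<bar>"
    using s by (simp add: abs_mult)
  also have "\<dots> \<le> (?s - 1) * (3 * (?s + 1))"
  proof (rule mult_left_mono)
    have r: "(1 + \<epsilon>) / ?s \<le> 2" "0 \<le> (1 + \<epsilon>) / ?s" using s assms by (auto simp: divide_le_eq)
    have "\<bar>(x + 1) / 4 - 3 / 4 - r\<bar> \<le> 3 * (x + 1)" if "1 \<le> x" "r \<le> 2" "0 \<le> r" for x r :: real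
      using that by (auto simp: abs_le_iff field_simps)
    from this[OF s r] show "\<bar>(?s + 1) / 4 - 3 / 4 - (1 + \<epsilon>) / ?s\<bar> \<le> 3 * (?s + 1)" .
  qed (use s in auto)
  also have "\<dots> = 3 * (?s\<^sup>2 - 1)" by (simp add: power2_eq_square algebra_simps)
  also have "\<dots> = 12 * \<epsilon> * lam \<kappa> n" using assms by (simp add: scaled_X_sq)
  also have "\<dots> \<le> 12 * \<epsilon> * (\<kappa>\<^sup>2 * nu n ^ 2)" using assms by (intro mult_left_mono lam_le) auto
  finally show ?thesis by (simp add: mult_ac)
qed

text \<open>The ratio of the left-hand side to \<open>K - scaled_A\<close> is small at frequencies below \<open>1 / \<surd>\<epsilon>\<close> because \<open>K\<close> is large, and at the others
  because there it is of size \<open>\<epsilon> powr (3/2)\<close>.\<close>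

lemma multiplier_small:
  assumes \<kappa>: "0 < \<kappa>" and \<delta>: "0 < \<delta>"
  shows "\<exists>K \<epsilon>1. 2 \<le> K \<and> 0 < \<epsilon>1 \<and> \<epsilon>1 \<le> 1 \<and>
    (\<forall>\<epsilon> n. 0 < \<epsilon> \<and> \<epsilon> \<le> \<epsilon>1 \<longrightarrow> nu n * \<bar>scaled_M \<kappa> \<epsilon> n\<bar> \<le> \<delta> * (K - scaled_A \<kappa> \<epsilon> n))"
proof -
  \<comment> \<open>The numerator will be at most \<open>5 * nu n * s ^ 3\<close>, that is, a
    multiple of \<open>nu n\<close> plus a multiple of \<open>nu n ^ 4\<close>. Here \<mu> makes the
    first part small in front of the fourth power and \<omega>1, a bound for
    \<open>sqrt \<epsilon>\<close>, does so for the second; 160 and 1280 are 20 and 160 times the 8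
    of \<open>nu_power4_le\<close>. Each part then uses one of the three copies of
    \<open>\<delta> * \<kappa> ^ 4 * n ^ 4\<close> in the gap, and \<open>K\<close> pays for the
    bounded remainders.\<close>
  define \<mu> where "\<mu> = min 1 (\<delta> * \<kappa> ^ 4 / 160)"
  define \<omega>1 where "\<omega>1 = min 1 (\<delta> * \<kappa> / 1280)"
  define K where "K = 3 + 2 * \<kappa> ^ 4 + 20 / (\<mu> * \<delta>)"
  have \<mu>: "0 < \<mu>" "\<mu> \<le> 1" "160 * \<mu> \<le> \<delta> * \<kappa> ^ 4"
    using \<delta> \<kappa> by (auto simp: \<mu>_def)
  have \<omega>1: "0 < \<omega>1" "\<omega>1 \<le> 1" "1280 * \<omega>1 \<le> \<delta> * \<kappa>"
    using \<delta> \<kappa> by (auto simp: \<omega>1_def)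
  have K: "2 \<le> K" using \<mu> \<delta> by (simp add: K_def add_nonneg_nonneg)
  have main: "nu n * \<bar>scaled_M \<kappa> \<epsilon> n\<bar> \<le> \<delta> * (K - scaled_A \<kappa> \<epsilon> n)"
    if e: "0 < \<epsilon>" "\<epsilon> \<le> \<omega>1\<^sup>2" for \<epsilon> n
  proof -
    let ?s = "scaled_X \<kappa> \<epsilon> n" and ?\<nu> = "nu n" and ?r = "real_of_int n"
    define \<omega> where "\<omega> = sqrt \<epsilon>"
    have e1: "\<epsilon> \<le> 1" using e(2) power_le_one[of \<omega>1 2] \<omega>1 by linarith
    have \<omega>: "0 < \<omega>" "\<omega> \<le> \<omega>1" "\<omega>\<^sup>2 = \<epsilon>"
      using e \<omega>1 real_le_lsqrt[of \<omega>1 \<epsilon>] by (auto simp: \<omega>_def)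
    have s: "1 \<le> ?s" using scaled_X_ge1 e by auto
    have "?s\<^sup>2 \<le> (1 + 2 * \<omega> * \<kappa> * ?\<nu>)\<^sup>2"
    proof -
      have "?s\<^sup>2 \<le> 1 + 4 * \<epsilon> * (\<kappa>\<^sup>2 * ?\<nu> ^ 2)"
        using e lam_le[of \<kappa> n] by (simp add: scaled_X_sq)
      also have "\<dots> \<le> (1 + 2 * \<omega> * \<kappa> * ?\<nu>)\<^sup>2"
        using \<omega> \<kappa> by (simp add: power2_sum power_mult_distrib)
      finally show ?thesis .
    qed
    then have "?s \<le> 1 + 2 * \<omega> * \<kappa> * ?\<nu>"
      by (rule power2_le_imp_le) (use \<omega> \<kappa> in auto)
    then have "?s ^ 3 \<le> (1 + 2 * \<omega> * \<kappa> * ?\<nu>) ^ 3"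
      using s by (intro power_mono) auto
    also have "\<dots> \<le> 4 + 4 * (2 * \<omega> * \<kappa> * ?\<nu>) ^ 3"
    proof -
      \<comment> \<open>This product is \<open>4 + 4 * x ^ 3 - (1 + x) ^ 3\<close>.\<close>
      have "0 \<le> 3 * ((1 - x)\<^sup>2 * (1 + x))" if "0 \<le> x" for x :: real using that by simp
      from this[of "2 * \<omega> * \<kappa> * ?\<nu>"] show ?thesis
        using \<omega> \<kappa> by (simp add: power2_eq_square power3_eq_cube algebra_simps)
    qed
    finally have s3: "?s ^ 3 \<le> 4 + 32 * (\<kappa> ^ 3 * \<omega> ^ 3) * ?\<nu> ^ 3"
      by (simp add: power_mult_distrib mult_ac)
    have \<omega>3: "1280 * (\<kappa> ^ 3 * \<omega> ^ 3) \<le> \<delta> * \<kappa> ^ 4"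
    proof -
      have "\<omega> * \<omega>\<^sup>2 \<le> \<omega> * 1"
        using \<omega> e1 by (intro mult_left_mono) auto
      then have "\<omega> ^ 3 \<le> \<omega>1" using \<omega>(2) by (simp add: power3_eq_cube power2_eq_square)
      then have "\<kappa> ^ 3 * (1280 * \<omega> ^ 3) \<le> \<kappa> ^ 3 * (\<delta> * \<kappa>)"
        using \<omega>1 \<kappa> by (intro mult_left_mono) auto
      then show ?thesis by (simp add: power_Suc eval_nat_numeral mult_ac)
    qed
    have \<nu>\<mu>: "?\<nu> \<le> \<mu> * ?\<nu> ^ 4 + 1 / \<mu>"
    proof (cases "?\<nu> \<le> 1 / \<mu>")
      case True
      then show ?thesis using \<mu> by (simp add: add_increasing)
    next
      case False
      then have "1 \<le> \<mu> * ?\<nu>" using \<mu> by (simp add: field_simps)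
      then have "1 * ?\<nu> \<le> (\<mu> * ?\<nu>) * ?\<nu>" by (intro mult_right_mono) auto
      also have "\<dots> = \<mu> * ?\<nu> ^ 2" by (simp add: power2_eq_square)
      also have "\<dots> \<le> \<mu> * ?\<nu> ^ 4" using \<mu> by (intro mult_left_mono power_increasing) auto
      finally have "?\<nu> \<le> \<mu> * ?\<nu> ^ 4" by simp
      moreover have "0 \<le> 1 / \<mu>" using \<mu> by simp
      ultimately show ?thesis by linarith
    qed
    note \<nu>4 = nu_power4_le[of n]
    \<comment> \<open>Both sides are multiplied by \<open>?s\<close>, since the gap is known only in
      that form. The left side then has order four in \<open>nu n\<close>, the same as the right
      side, and only the coefficients decide.\<close>
    have "(?\<nu> * \<bar>scaled_M \<kappa> \<epsilon> n\<bar>) * ?s \<le> (?\<nu> * (5 * ?s\<^sup>2)) * ?s"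
      using s e e1 by (intro mult_right_mono mult_left_mono scaled_M_le_square) auto
    also have "\<dots> = 5 * ?\<nu> * ?s ^ 3" by (simp add: power2_eq_square power3_eq_cube)
    also have "\<dots> \<le> 5 * ?\<nu> * (4 + 32 * (\<kappa> ^ 3 * \<omega> ^ 3) * ?\<nu> ^ 3)"
      by (intro mult_left_mono s3) auto
    also have "\<dots> = 20 * ?\<nu> + 160 * (\<kappa> ^ 3 * \<omega> ^ 3) * ?\<nu> ^ 4"
      by (simp add: power_Suc eval_nat_numeral algebra_simps)
    also have "\<dots> \<le> 20 * (\<mu> * ?\<nu> ^ 4 + 1 / \<mu>) + 160 * (\<kappa> ^ 3 * \<omega> ^ 3) * ?\<nu> ^ 4"
      using \<nu>\<mu> by simp
    also have "\<dots> = (20 * \<mu> + 160 * (\<kappa> ^ 3 * \<omega> ^ 3)) * ?\<nu> ^ 4 + 20 / \<mu>"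
      by (simp add: algebra_simps)
    also have "\<dots> \<le> (20 * \<mu> + 160 * (\<kappa> ^ 3 * \<omega> ^ 3)) * (8 * (1 + ?r ^ 4)) + 20 / \<mu>"
      using \<mu> \<omega> \<kappa> by (intro add_right_mono mult_left_mono \<nu>4) auto
    also have "\<dots> = (160 * \<mu> + 1280 * (\<kappa> ^ 3 * \<omega> ^ 3)) * (1 + ?r ^ 4) + 20 / \<mu>"
      by (simp add: algebra_simps)
    also have "\<dots> \<le> (\<delta> * \<kappa> ^ 4 + \<delta> * \<kappa> ^ 4) * (1 + ?r ^ 4) + 20 / \<mu>"
      using \<mu> \<omega>3 by (intro add_right_mono mult_right_mono add_mono) auto
    also have "\<dots> \<le> \<delta> * (K + 3 * (lam \<kappa> n)\<^sup>2 - 1 / 4)"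
    proof -
      have l: "(lam \<kappa> n)\<^sup>2 = \<kappa> ^ 4 * ?r ^ 4"
        by (simp add: lam_def power_mult_distrib flip: power_mult)
      have "\<delta> * (K + 3 * (lam \<kappa> n)\<^sup>2 - 1 / 4) - ((\<delta> * \<kappa> ^ 4 + \<delta> * \<kappa> ^ 4) * (1 + ?r ^ 4) + 20 / \<mu>)
          = \<delta> * (11 / 4 + \<kappa> ^ 4 * ?r ^ 4)"
        using \<mu> \<delta> by (simp add: l K_def field_simps)
      moreover have "0 \<le> \<delta> * (11 / 4 + \<kappa> ^ 4 * ?r ^ 4)" using \<delta> \<kappa> by simp
      ultimately show ?thesis by linarith
    qed
    also have "\<dots> \<le> \<delta> * ((K - scaled_A \<kappa> \<epsilon> n) * ?s)"
      using \<delta> e K by (intro mult_left_mono scaled_A_gap) auto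
    finally show ?thesis
      using s by (simp add: mult.assoc[symmetric] mult_le_cancel_right)
  qed
  show ?thesis
    by (rule exI[of _ K], rule exI[of _ "\<omega>1\<^sup>2"])
      (use K main \<omega>1 in \<open>auto simp: power_le_one\<close>)
qed

section \<open>The equation for the Fourier coefficients\<close>

definition modes_solve ::
    "real \<Rightarrow> real \<Rightarrow> (int \<Rightarrow> real) \<Rightarrow> (int \<Rightarrow> real) \<Rightarrow> (int \<Rightarrow> real \<Rightarrow> complex) \<Rightarrow> bool" where
  "modes_solve \<kappa> T a m x \<longleftrightarrow> (\<forall>n. \<forall>t\<in>{0..T}. (x n has_vector_derivative
     of_real (a n) * x n t + of_real (m n) * Q \<kappa> (\<lambda>k. x k t) (\<lambda>k. x k t) n) (at t within {0..T}))"

text \<open>Continuity in time of each single mode says nothing uniform in \<open>n\<close>. This is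
  continuity with values in the weighted space, and it yields a step length valid for all modes at
  once.\<close>

definition equicont :: "real \<Rightarrow> (int \<Rightarrow> real \<Rightarrow> complex) \<Rightarrow> bool" where
  "equicont T x \<longleftrightarrow> (\<forall>\<eta>>0. \<exists>\<delta>>0. \<forall>s\<in>{0..T}. \<forall>t\<in>{0..T}. \<bar>s - t\<bar> \<le> \<delta> \<longrightarrow>
     dec 3 \<eta> (\<lambda>n. x n s - x n t))"

text \<open>Each iteration of the Duhamel estimate halves the bound on \<open>d\<close>.\<close>

lemma linear_modes_zero:
  assumes ode: "\<And>n t. t \<in> {ta..tb} \<Longrightarrow> (d n has_vector_derivative
      of_real (a n) * d n t + of_real (m n) * Q \<kappa> (\<lambda>k. c k t) (\<lambda>k. d k t) n) (at t within {ta..tb})"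
    and d0: "\<And>n. d n ta = 0"
    and c: "\<And>t. t \<in> {ta..tb} \<Longrightarrow> dec 3 B (\<lambda>n. c n t)"
    and d: "\<And>t. t \<in> {ta..tb} \<Longrightarrow> dec 3 S (\<lambda>n. d n t)"
    and gap: "\<And>n. a n < K"
    and small: "\<And>n. nu n * \<bar>m n\<bar> * (\<kappa>\<^sup>2 * cconv 2 * B) \<le> (K - a n) / 2"
    and K: "0 \<le> K" "0 \<le> ta" and t: "t \<in> {ta..tb}"
  shows "d n t = 0"
proof -
  have B: "0 \<le> B" and S: "0 \<le> S"
    using c[OF t] d[OF t] by (auto dest: dec_nonneg)
  have halve: "\<forall>t\<in>{ta..tb}. dec 3 (S / 2 ^ j * exp (K * t)) (\<lambda>n. d n t)" for j
  proof (induction j)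
    case 0
    show ?case
    proof
      fix t assume t: "t \<in> {ta..tb}"
      have "S * 1 \<le> S * exp (K * t)"
        using S K t by (intro mult_left_mono) auto
      then show "dec 3 (S / 2 ^ 0 * exp (K * t)) (\<lambda>n. d n t)"
        by (intro dec_mono[OF d[OF t]]) auto
    qed
  next
    case (Suc j)
    define S' where "S' = S / 2 ^ j"
    have S': "0 \<le> S'" using S by (simp add: S'_def)
    show ?case unfolding dec_def
    proof (intro ballI allI)
      fix t n assume t: "t \<in> {ta..tb}"
      let ?b = "\<bar>m n\<bar> * (\<kappa>\<^sup>2 * cconv 2 * B * S' / nu n ^ 2)"
      have "norm (d n t) \<le> exp (K * (t - ta)) * norm (d n ta) + ?b * exp (K * t) / (K - a n)"
      proof (rule ode_bound[OF ode _ gap _ t])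
        fix t assume t: "t \<in> {ta..tb}"
        have "norm (Q \<kappa> (\<lambda>k. c k t) (\<lambda>k. d k t) n) \<le> \<kappa>\<^sup>2 * cconv 2 * B * (S' * exp (K * t)) / nu n ^ 2"
          using c[OF t] Suc.IH t
          by (intro decD[OF Q_bound]) (auto simp: S'_def eval_nat_numeral)
        then have "\<bar>m n\<bar> * norm (Q \<kappa> (\<lambda>k. c k t) (\<lambda>k. d k t) n)
            \<le> \<bar>m n\<bar> * (\<kappa>\<^sup>2 * cconv 2 * B * (S' * exp (K * t)) / nu n ^ 2)"
          by (rule mult_left_mono) simp
        then show "norm (of_real (m n) * Q \<kappa> (\<lambda>k. c k t) (\<lambda>k. d k t) n) \<le> ?b * exp (K * t)"
          by (simp add: norm_mult mult_ac)
      qed (use B S' cconv_pos[of 2] in auto)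
      \<comment> \<open>The convolution returns order 2 only; the missing order is the factor
        \<open>nu n\<close> contained in the smallness hypothesis.\<close>
      also have "\<dots> = (nu n * \<bar>m n\<bar> * (\<kappa>\<^sup>2 * cconv 2 * B)) * (S' * exp (K * t) / nu n ^ 3 / (K - a n))"
        using d0 gap[of n] by (simp add: field_simps eval_nat_numeral)
      also have "\<dots> \<le> ((K - a n) / 2) * (S' * exp (K * t) / nu n ^ 3 / (K - a n))"
        using S' gap[of n] by (intro mult_right_mono small) auto
      also have "\<dots> = S / 2 ^ Suc j * exp (K * t) / nu n ^ 3"
        using gap[of n] by (simp add: S'_def field_simps)
      finally show "norm (d n t) \<le> S / 2 ^ Suc j * exp (K * t) / nu n ^ 3" .
    qed
  qed
  have "norm (d n t) \<le> (S * exp (K * t) / nu n ^ 3) * (1 / 2) ^ j" for j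
    using decD[OF halve[rule_format, OF t, of j], of n] by (simp add: field_simps power_one_over)
  moreover have "(\<lambda>j. (S * exp (K * t) / nu n ^ 3) * (1 / 2) ^ j) \<longlonglongrightarrow> (S * exp (K * t) / nu n ^ 3) * 0"
    by (intro tendsto_mult tendsto_const LIMSEQ_power_zero) auto
  ultimately have "norm (d n t) \<le> (S * exp (K * t) / nu n ^ 3) * 0"
    by (metis LIMSEQ_le_const)
  then show ?thesis by simp
qed

text \<open>The equation is stated on a subinterval because the uniqueness argument restarts at
  successive times.\<close>

lemma modes_solve_diff:
  assumes x: "modes_solve \<kappa> T a m x" and y: "modes_solve \<kappa> T a m y"
    and dx: "dec 3 B (\<lambda>n. x n t)" and dy: "dec 3 B' (\<lambda>n. y n t)"
    and t: "t \<in> {t0..t1}" "{t0..t1} \<subseteq> {0..T}"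
  shows "((\<lambda>t. x n t - y n t) has_vector_derivative of_real (a n) * (x n t - y n t) +
      of_real (m n) * Q \<kappa> (\<lambda>k. x k t + y k t) (\<lambda>k. x k t - y k t) n) (at t within {t0..t1})"
proof -
  have "((\<lambda>t. x n t - y n t) has_vector_derivative
      (of_real (a n) * x n t + of_real (m n) * Q \<kappa> (\<lambda>k. x k t) (\<lambda>k. x k t) n) -
      (of_real (a n) * y n t + of_real (m n) * Q \<kappa> (\<lambda>k. y k t) (\<lambda>k. y k t) n)) (at t within {0..T})"
    using x y t unfolding modes_solve_def by (intro has_vector_derivative_diff) auto
  then have "((\<lambda>t. x n t - y n t) has_vector_derivative of_real (a n) * (x n t - y n t) +
      of_real (m n) * (Q \<kappa> (\<lambda>k. x k t) (\<lambda>k. x k t) n - Q \<kappa> (\<lambda>k. y k t) (\<lambda>k. y k t) n))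
      (at t within {0..T})"
    by (simp add: algebra_simps)
  then have "((\<lambda>t. x n t - y n t) has_vector_derivative of_real (a n) * (x n t - y n t) +
      of_real (m n) * Q \<kappa> (\<lambda>k. x k t + y k t) (\<lambda>k. x k t - y k t) n) (at t within {0..T})"
    using Q_square_diff[of 2 B "\<lambda>k. x k t" B' "\<lambda>k. y k t" \<kappa> n] dx dy by simp
  then show ?thesis
    by (rule has_vector_derivative_within_subset) (use t in auto)
qed

text \<open>On short time intervals \<open>y\<close> stays close to \<open>x\<close>, so only the size of \<open>x\<close> enters the smallness
  condition.\<close>

lemma modes_unique:
  assumes x: "modes_solve \<kappa> T a m x" and y: "modes_solve \<kappa> T a m y"
    and init: "\<And>n. x n 0 = y n 0"
    and dx: "\<And>t. t \<in> {0..T} \<Longrightarrow> dec 3 B (\<lambda>n. x n t)"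
    and dy: "\<And>t. t \<in> {0..T} \<Longrightarrow> dec 3 B' (\<lambda>n. y n t)"
    and ex: "equicont T x" and ey: "equicont T y" and B: "0 < B"
    and gap: "\<And>n. a n < K"
    and small: "\<And>n. nu n * \<bar>m n\<bar> * (\<kappa>\<^sup>2 * cconv 2 * (3 * B)) \<le> (K - a n) / 2"
    and K: "0 \<le> K" and t: "t \<in> {0..T}"
  shows "x n t = y n t"
proof -
  obtain \<delta>1 where \<delta>1: "\<delta>1 > 0"
    "\<And>s t. s \<in> {0..T} \<Longrightarrow> t \<in> {0..T} \<Longrightarrow> \<bar>s - t\<bar> \<le> \<delta>1 \<Longrightarrow> dec 3 (B / 2) (\<lambda>n. x n s - x n t)"
    using ex B unfolding equicont_def by (meson half_gt_zero)
  obtain \<delta>2 where \<delta>2: "\<delta>2 > 0"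
    "\<And>s t. s \<in> {0..T} \<Longrightarrow> t \<in> {0..T} \<Longrightarrow> \<bar>s - t\<bar> \<le> \<delta>2 \<Longrightarrow> dec 3 (B / 2) (\<lambda>n. y n s - y n t)"
    using ey B unfolding equicont_def by (meson half_gt_zero)
  define \<delta> where "\<delta> = min \<delta>1 \<delta>2"
  have \<delta>: "\<delta> > 0" using \<delta>1 \<delta>2 by (simp add: \<delta>_def)
  have step: "\<forall>t\<in>{0..T}. t \<le> real j * \<delta> \<longrightarrow> (\<forall>n. x n t = y n t)" for j
  proof (induction j)
    case 0 then show ?case using init by auto
  next
    case (Suc j)
    show ?case
    proof (intro ballI impI allI)
      fix t n assume t: "t \<in> {0..T}" "t \<le> real (Suc j) * \<delta>"
      show "x n t = y n t"
      proof (cases "t \<le> real j * \<delta>")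
        case True then show ?thesis using Suc t by auto
      next
        case False
        let ?t0 = "real j * \<delta>"
        have sub: "{?t0..t} \<subseteq> {0..T}" and t0: "?t0 \<in> {0..T}" using t \<delta> False by auto
        have eq0: "x k ?t0 = y k ?t0" for k using Suc t0 by auto
        have "x n t - y n t = 0"
        proof (rule linear_modes_zero[where ta="?t0" and tb=t and c="\<lambda>k t. x k t + y k t"
              and B="3 * B" and S="B + B'" and a=a and K=K and m=m and \<kappa>=\<kappa>
              and d="\<lambda>k t. x k t - y k t"])
          fix s assume s: "s \<in> {?t0..t}"
          then have sT: "s \<in> {0..T}" using sub by auto
          have near: "\<bar>s - ?t0\<bar> \<le> \<delta>1" "\<bar>s - ?t0\<bar> \<le> \<delta>2"
            using s t by (auto simp: \<delta>_def algebra_simps)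
          show "((\<lambda>t. x k t - y k t) has_vector_derivative of_real (a k) * (x k s - y k s) +
            of_real (m k) * Q \<kappa> (\<lambda>k. x k s + y k s) (\<lambda>k. x k s - y k s) k) (at s within {?t0..t})" for k
            by (rule modes_solve_diff[OF x y dx[OF sT] dy[OF sT] s sub])
          \<comment> \<open>This bound is only the start of the halving iteration, so the size of
            \<open>B'\<close> does not matter.\<close>
          show "dec 3 (B + B') (\<lambda>n. x n s - y n s)"
            by (rule dec_diff[OF dx[OF sT] dy[OF sT]])
          \<comment> \<open>Both solutions agree at the left end point, where \<open>x\<close>
            bounds them by \<open>B\<close>, and each drifts by at most \<open>B / 2\<close> during
            the step. The total is \<open>3 * B\<close> whatever the size of
            \<open>y\<close>.\<close>
          have "dec 3 ((B + B / 2) + (B + B / 2)) (\<lambda>n. (x n ?t0 + (x n s - x n ?t0)) + (x n ?t0 + (y n s - y n ?t0)))"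
            by (intro dec_add dx \<delta>1 \<delta>2 t0 sT near)
          then show "dec 3 (3 * B) (\<lambda>n. x n s + y n s)"
            unfolding eq0 by (simp add: add.commute)
        qed (use eq0 gap small K \<delta> False in auto)
        then show ?thesis by simp
      qed
    qed
  qed
  obtain j where "t / \<delta> \<le> real j"
    using real_arch_simple by blast
  then have "t \<le> real j * \<delta>" using \<delta> by (simp add: field_simps)
  then show ?thesis using step[of j] t by auto
qed

section \<open>Construction of the remainder by contraction\<close>

text \<open>The first coordinate is discrete and hence locally constant. A whole family of modes can
  therefore be treated as one bounded continuous function, and such functions form a complete
  space.\<close>

lemma continuous_on_int_prod:
  fixes f :: "int \<Rightarrow> real \<Rightarrow> 'a::topological_space"
  assumes "\<And>n. continuous_on UNIV (f n)"
  shows "continuous_on UNIV (\<lambda>p. f (fst p) (snd p))"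
proof (rule continuous_at_imp_continuous_on, rule ballI)
  fix p :: "int \<times> real"
  have "isCont (\<lambda>q. f (fst p) (snd q)) p"
    using assms[of "fst p"]
    by (intro isCont_o2[OF isCont_snd[OF continuous_ident]]) (simp add: continuous_on_eq_continuous_at)
  moreover have "eventually (\<lambda>q. f (fst q) (snd q) = f (fst p) (snd q)) (nhds p)"
  proof -
    have "open ({fst p} \<times> (UNIV::real set))"
      by (intro open_Times open_discrete open_UNIV)
    then have "eventually (\<lambda>q. q \<in> {fst p} \<times> UNIV) (nhds p)"
      by (rule eventually_nhds_in_open) (cases p, auto)
    then show ?thesis by eventually_elim auto
  qed
  ultimately show "isCont (\<lambda>p. f (fst p) (snd p)) p"
    by (subst isCont_cong) auto
qed

text \<open>The instance \<^class>\<open>complete_space\<close> in the library assumes a metric on the domain, and there is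
  none on \<^typ>\<open>int\<close>.\<close>

lemma complete_UNIV_bcontfun:
  "complete (UNIV :: ('a::topological_space \<Rightarrow>\<^sub>C 'b::complete_space) set)"
proof (rule completeI)
  fix f :: "nat \<Rightarrow> 'a \<Rightarrow>\<^sub>C 'b" assume f: "Cauchy f"
  have "\<exists>l. \<forall>e>0. \<exists>N. \<forall>n x. N \<le> n \<and> True \<longrightarrow> dist (apply_bcontfun (f n) x) (l x) < e"
    unfolding uniformly_convergent_eq_cauchy
    using f unfolding Cauchy_def by (meson dist_fun_lt_imp_dist_val_lt)
  then obtain g where "uniform_limit UNIV (\<lambda>n. apply_bcontfun (f n)) g sequentially"
    unfolding uniform_limit_sequentially_iff by metis
  from uniform_limit_bcontfunE[OF this sequentially_bot]
  obtain l where "f \<longlonglongrightarrow> l" by metis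
  then show "\<exists>l\<in>UNIV. f \<longlonglongrightarrow> l" by blast
qed

text \<open>Here \<open>P\<close> is the approximate solution, \<open>E\<close> its residual and
  \<open>R\<close> the correction. The two smallness conditions treat the cross term with
  \<open>P\<close> and the quadratic term, a quarter each, so the map contracts by one half. It
  sends zero to something of size \<eta>; hence a ball of radius \<rho> is mapped into itself once
  \<open>\<rho> / 2 + \<eta> \<le> \<rho>\<close>, and \<open>4 * \<eta>\<close> satisfies
  this.\<close>

lemma modes_exist:
  fixes P E :: "int \<Rightarrow> real \<Rightarrow> complex"
  assumes T: "0 < T" and K: "0 \<le> K"
    and cP: "\<And>n. continuous_on {0..T} (P n)" and cE: "\<And>n. continuous_on {0..T} (E n)"
    and dP: "\<And>t. t \<in> {0..T} \<Longrightarrow> dec 5 B (\<lambda>n. P n t)"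
    and dE: "\<And>t. t \<in> {0..T} \<Longrightarrow> dec 5 \<eta> (\<lambda>n. E n t)"
    and gap: "\<And>n. 1 \<le> K - a n"
    and small: "\<And>n. nu n * \<bar>m n\<bar> \<le> \<delta> * (K - a n)"
    and \<delta>1: "\<delta> * (\<kappa>\<^sup>2 * cconv 4 * (2 * B)) \<le> 1 / 4"
    and \<delta>2: "\<delta> * (\<kappa>\<^sup>2 * cconv 4 * (2 * (4 * \<eta> * exp (K * T)))) \<le> 1 / 4"
  shows "\<exists>R. (\<forall>n. R n 0 = 0) \<and>
    (\<forall>n. \<forall>t\<in>{0..T}. (R n has_vector_derivative of_real (a n) * R n t +
       (of_real (m n) * (2 * Q \<kappa> (\<lambda>k. P k t) (\<lambda>k. R k t) n + Q \<kappa> (\<lambda>k. R k t) (\<lambda>k. R k t) n) + E n t))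
       (at t within {0..T})) \<and>
    (\<forall>t\<in>{0..T}. dec 5 (4 * \<eta> * exp (K * t)) (\<lambda>n. R n t))"
proof -
  define \<rho> where "\<rho> = 4 * \<eta>"
  \<comment> \<open>Elements of the function space live on the whole line. Clamping time to the
    interval makes the map total and continuous there.\<close>
  define cl where "cl t = max 0 (min T t)" for t :: real
  \<comment> \<open>The weight is divided out: the plain supremum norm of \<open>u\<close> is the
    weighted norm of \<open>Rf u\<close>. The map \<open>G\<close> below restores the weight to the
    Duhamel solution \<open>V\<close>.\<close>
  define Rf :: "((int \<times> real) \<Rightarrow>\<^sub>C complex) \<Rightarrow> int \<Rightarrow> real \<Rightarrow> complex"
    where "Rf u n t = of_real (exp (K * t) / nu n ^ 5) * apply_bcontfun u (n, t)" for u n t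
  define N where "N u n t = of_real (m n) * (2 * Q \<kappa> (\<lambda>k. P k t) (\<lambda>k. Rf u k t) n
      + Q \<kappa> (\<lambda>k. Rf u k t) (\<lambda>k. Rf u k t) n) + E n t" for u n t
  define V where "V u n t = of_real (exp (a n * t)) *
      integral {0..t} (\<lambda>s. of_real (exp (- a n * s)) * N u n s)" for u n t
  define G where "G u p = of_real (nu (fst p) ^ 5 * exp (- K * cl (snd p))) * V u (fst p) (cl (snd p))"
    for u p
  define S where "S = cball (0 :: (int \<times> real) \<Rightarrow>\<^sub>C complex) \<rho>"
  have \<eta>: "0 \<le> \<eta>" using dE[of 0] T by (auto dest: dec_nonneg)
  have \<rho>: "0 \<le> \<rho>" using \<eta> by (simp add: \<rho>_def)
  have B: "0 \<le> B" using dP[of 0] T by (auto dest: dec_nonneg)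
  have cl: "cl t \<in> {0..T}" for t using T by (auto simp: cl_def)
  have cl_id: "t \<in> {0..T} \<Longrightarrow> cl t = t" for t by (auto simp: cl_def)
  have S_iff: "u \<in> S \<longleftrightarrow> (\<forall>p. norm (apply_bcontfun u p) \<le> \<rho>)" for u
    unfolding S_def mem_cball
    by (metis dist_0_norm norm_bound norm_bounded order_trans)
  have cont_u: "continuous_on X (\<lambda>t. apply_bcontfun u (n, t))" for u :: "(int \<times> real) \<Rightarrow>\<^sub>C complex" and n X
    by (rule continuous_on_compose2[OF continuous_on_apply_bcontfun[of UNIV u]])
      (auto intro!: continuous_intros)
  have cont_R: "continuous_on X (Rf u n)" for X u n
    unfolding Rf_def by (intro continuous_intros cont_u) auto
  have dR: "dec 5 (r * exp (K * t)) (\<lambda>n. Rf u n t)"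
    if "\<And>p. norm (apply_bcontfun u p) \<le> r" for u r t
    unfolding dec_def
  proof
    fix n
    have "exp (K * t) / nu n ^ 5 * norm (apply_bcontfun u (n, t)) \<le> exp (K * t) / nu n ^ 5 * r"
      using that by (intro mult_left_mono) auto
    then show "norm (Rf u n t) \<le> r * exp (K * t) / nu n ^ 5"
      by (simp add: Rf_def norm_mult norm_divide norm_power mult_ac)
  qed
  have expT: "exp (K * t) \<le> exp (K * T)" if "t \<in> {0..T}" for t
    using that K by (simp add: mult_left_mono)
  have dR': "dec 5 (\<rho> * exp (K * T)) (\<lambda>n. Rf u n t)" if "u \<in> S" "t \<in> {0..T}" for u t
    using that \<rho> expT[OF that(2)]
    by (intro dec_mono[OF dR]) (auto simp: S_iff intro: mult_left_mono)
  have cont_N: "continuous_on {0..T} (N u n)" if "u \<in> S" for u n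
    unfolding N_def using dP dR'[OF that]
    by (intro continuous_intros continuous_on_Q[where q=4] cP cE cont_R) auto
  have V_ode: "(V u n has_vector_derivative of_real (a n) * V u n t + N u n t) (at t within {0..T})"
    if "u \<in> S" "t \<in> {0..T}" for u n t
    unfolding V_def by (rule duhamel[OF cont_N[OF that(1)] that(2)])
  have V0: "V u n 0 = 0" for u n by (simp add: V_def)
  have N_diff: "norm (N u n t - N v n t) \<le>
      \<bar>m n\<bar> * (\<kappa>\<^sup>2 * cconv 4 * (2 * B + 2 * (\<rho> * exp (K * T))) * D / nu n ^ 4) * exp (K * t)"
    if u: "u \<in> S" and v: "v \<in> S" and t: "t \<in> {0..T}"
      and D: "\<And>p. norm (apply_bcontfun u p - apply_bcontfun v p) \<le> D" for u v n t D
  proof -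
    have dd: "dec 5 (D * exp (K * t)) (\<lambda>n. Rf u n t - Rf v n t)"
      using dR[of "u - v" D t] D by (simp add: Rf_def algebra_simps diff_divide_distrib)
    have "dec 5 (2 * B) (\<lambda>k. 2 * P k t)"
      using dec_cmult[OF dP[OF t], of 2] by simp
    then have dc: "dec 5 (2 * B + 2 * (\<rho> * exp (K * T))) (\<lambda>k. 2 * P k t + (Rf u k t + Rf v k t))"
      using dec_add[OF _ dec_add[OF dR'[OF u t] dR'[OF v t]]] by simp
    have Q2: "2 * Q \<kappa> (\<lambda>k. P k t) g n = Q \<kappa> (\<lambda>k. 2 * P k t) g n" for g
      using Q_cmult[of \<kappa> 2 _ 1 g n] by simp
    have "N u n t - N v n t = of_real (m n) *
        ((Q \<kappa> (\<lambda>k. 2 * P k t) (\<lambda>k. Rf u k t) n - Q \<kappa> (\<lambda>k. 2 * P k t) (\<lambda>k. Rf v k t) n) +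
         (Q \<kappa> (\<lambda>k. Rf u k t) (\<lambda>k. Rf u k t) n - Q \<kappa> (\<lambda>k. Rf v k t) (\<lambda>k. Rf v k t) n))"
      by (simp add: N_def Q2 algebra_simps)
    also have "Q \<kappa> (\<lambda>k. Rf u k t) (\<lambda>k. Rf u k t) n - Q \<kappa> (\<lambda>k. Rf v k t) (\<lambda>k. Rf v k t) n =
        Q \<kappa> (\<lambda>k. Rf u k t + Rf v k t) (\<lambda>k. Rf u k t - Rf v k t) n"
      using dR'[OF u t] dR'[OF v t] by (intro Q_square_diff[where q=4]) auto
    also have "Q \<kappa> (\<lambda>k. 2 * P k t) (\<lambda>k. Rf u k t) n - Q \<kappa> (\<lambda>k. 2 * P k t) (\<lambda>k. Rf v k t) n =
        Q \<kappa> (\<lambda>k. 2 * P k t) (\<lambda>k. Rf u k t - Rf v k t) n"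
      using Q_diff_left[of 4 _ "\<lambda>k. Rf u k t" _ "\<lambda>k. Rf v k t" _ "\<lambda>k. 2 * P k t" \<kappa> n]
        dR'[OF u t] dR'[OF v t] \<open>dec 5 (2 * B) _\<close>
      by (simp add: Q_commute[of _ "\<lambda>k. 2 * P k t"])
    also have "Q \<kappa> (\<lambda>k. 2 * P k t) (\<lambda>k. Rf u k t - Rf v k t) n +
        Q \<kappa> (\<lambda>k. Rf u k t + Rf v k t) (\<lambda>k. Rf u k t - Rf v k t) n =
        Q \<kappa> (\<lambda>k. 2 * P k t + (Rf u k t + Rf v k t)) (\<lambda>k. Rf u k t - Rf v k t) n"
      using \<open>dec 5 (2 * B) _\<close> dec_add[OF dR'[OF u t] dR'[OF v t]] dd
      by (intro Q_add_left[where q=4, symmetric]) auto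
    finally have "norm (N u n t - N v n t) = \<bar>m n\<bar> *
        norm (Q \<kappa> (\<lambda>k. 2 * P k t + (Rf u k t + Rf v k t)) (\<lambda>k. Rf u k t - Rf v k t) n)"
      by (simp add: norm_mult)
    also have "\<dots> \<le> \<bar>m n\<bar> * (\<kappa>\<^sup>2 * cconv 4 * (2 * B + 2 * (\<rho> * exp (K * T))) * (D * exp (K * t)) / nu n ^ 4)"
      using dc dd by (intro mult_left_mono decD[OF Q_bound]) auto
    finally show ?thesis by (simp add: mult_ac)
  qed
  have V_diff: "norm (V u n t - V v n t) \<le> D / 2 * exp (K * t) / nu n ^ 5"
    if u: "u \<in> S" and v: "v \<in> S" and t: "t \<in> {0..T}"
      and D: "\<And>p. norm (apply_bcontfun u p - apply_bcontfun v p) \<le> D" for u v n t D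
  proof -
    have D0: "0 \<le> D" using D order_trans[OF norm_ge_zero] by blast
    let ?c = "\<kappa>\<^sup>2 * cconv 4 * (2 * B + 2 * (\<rho> * exp (K * T)))"
    let ?b = "\<bar>m n\<bar> * (?c * D / nu n ^ 4)"
    have c: "0 \<le> ?c" using B \<rho> cconv_pos[of 4] by simp
    have "norm (V u n t - V v n t) \<le> exp (K * (t - 0)) * norm (V u n 0 - V v n 0) + ?b * exp (K * t) / (K - a n)"
    proof (rule ode_bound[where g="\<lambda>t. N u n t - N v n t", OF _ _ _ _ t])
      fix s assume s: "s \<in> {0..T}"
      show "((\<lambda>t. V u n t - V v n t) has_vector_derivative
          of_real (a n) * (V u n s - V v n s) + (N u n s - N v n s)) (at s within {0..T})"
        using has_vector_derivative_diff[OF V_ode[OF u s, of n] V_ode[OF v s, of n]]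
        by (simp add: algebra_simps)
    qed (use N_diff[OF u v _ D] gap[of n] c D0 in auto)
    also have "\<dots> = (nu n * \<bar>m n\<bar>) * (?c * D * exp (K * t) / nu n ^ 5 / (K - a n))"
      using gap[of n] by (simp add: V0 field_simps eval_nat_numeral)
    also have "\<dots> \<le> (\<delta> * (K - a n)) * (?c * D * exp (K * t) / nu n ^ 5 / (K - a n))"
      using gap[of n] c D0 by (intro mult_right_mono small) auto
    also have "\<dots> = (\<delta> * ?c) * (D * exp (K * t) / nu n ^ 5)"
      using gap[of n] by simp
    \<comment> \<open>The contraction factor is the sum of the two hypotheses, a quarter from
      each.\<close>
    also have "\<dots> \<le> (1 / 2) * (D * exp (K * t) / nu n ^ 5)"
    proof (rule mult_right_mono)
      have "\<delta> * ?c = \<delta> * (\<kappa>\<^sup>2 * cconv 4 * (2 * B)) + \<delta> * (\<kappa>\<^sup>2 * cconv 4 * (2 * (4 * \<eta> * exp (K * T))))"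
        by (simp add: \<rho>_def algebra_simps)
      then show "\<delta> * ?c \<le> 1 / 2" using \<delta>1 \<delta>2 by linarith
    qed (use D0 in auto)
    finally show ?thesis by simp
  qed
  have zS: "0 \<in> S" using \<rho> by (simp add: S_def)
  have V_zero: "norm (V 0 n t) \<le> \<eta> * exp (K * t) / nu n ^ 5" if t: "t \<in> {0..T}" for n t
  proof -
    have "norm (V 0 n t) \<le> exp (K * (t - 0)) * norm (V 0 n 0) + (\<eta> / nu n ^ 5) * exp (K * t) / (K - a n)"
    proof (rule ode_bound[OF V_ode[OF zS] _ _ _ t])
      fix s assume s: "s \<in> {0..T}"
      have "N 0 n s = E n s" by (simp add: N_def Rf_def Q_def Qterm_def)
      then have "norm (N 0 n s) \<le> (\<eta> / nu n ^ 5) * 1" using decD[OF dE[OF s]] by simp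
      also have "\<dots> \<le> (\<eta> / nu n ^ 5) * exp (K * s)"
        using \<eta> K s by (intro mult_left_mono) auto
      finally show "norm (N 0 n s) \<le> (\<eta> / nu n ^ 5) * exp (K * s)" .
    qed (use gap[of n] \<eta> in auto)
    also have "\<dots> = (\<eta> * exp (K * t) / nu n ^ 5) / (K - a n)"
      by (simp add: V0)
    also have "\<dots> \<le> (\<eta> * exp (K * t) / nu n ^ 5) / 1"
      using gap[of n] \<eta> by (intro divide_left_mono) auto
    finally show ?thesis by simp
  qed
  have V_bound: "norm (V u n t) \<le> \<rho> * exp (K * t) / nu n ^ 5" if u: "u \<in> S" and t: "t \<in> {0..T}" for u n t
  proof -
    have "norm (V u n t - V 0 n t) \<le> \<rho> / 2 * exp (K * t) / nu n ^ 5"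
      using u by (intro V_diff[OF u zS t]) (auto simp: S_iff)
    then have "norm (V u n t) \<le> \<rho> / 2 * exp (K * t) / nu n ^ 5 + \<eta> * exp (K * t) / nu n ^ 5"
      using V_zero[OF t, of n] norm_triangle_sub[of "V u n t" "V 0 n t"] by linarith
    also have "\<dots> = (\<rho> / 2 + \<eta>) * exp (K * t) / nu n ^ 5"
      by (simp add: add_divide_distrib distrib_right)
    also have "\<dots> \<le> \<rho> * exp (K * t) / nu n ^ 5"
      using \<eta> by (intro divide_right_mono mult_right_mono) (auto simp: \<rho>_def)
    finally show ?thesis .
  qed
  have G_bound: "norm (G u p - G v p) \<le> C" 
    if "\<And>t. t \<in> {0..T} \<Longrightarrow> norm (V u (fst p) t - V v (fst p) t) \<le> C * exp (K * t) / nu (fst p) ^ 5" for u v p C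
  proof -
    let ?t = "cl (snd p)" and ?n = "fst p"
    have "norm (G u p - G v p) = nu ?n ^ 5 * exp (- K * ?t) * norm (V u ?n ?t - V v ?n ?t)"
      unfolding G_def right_diff_distrib[symmetric] by (simp add: norm_mult norm_power)
    also have "\<dots> \<le> nu ?n ^ 5 * exp (- K * ?t) * (C * exp (K * ?t) / nu ?n ^ 5)"
      using that[OF cl] by (intro mult_left_mono) auto
    also have "\<dots> = C" by (simp add: exp_minus)
    finally show ?thesis .
  qed
  have G_norm: "norm (G u p) \<le> \<rho>" if "u \<in> S" for u p
  proof -
    let ?t = "cl (snd p)" and ?n = "fst p"
    have "norm (G u p) = nu ?n ^ 5 * exp (- K * ?t) * norm (V u ?n ?t)"
      unfolding G_def by (simp add: norm_mult norm_power)
    also have "\<dots> \<le> nu ?n ^ 5 * exp (- K * ?t) * (\<rho> * exp (K * ?t) / nu ?n ^ 5)"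
      using V_bound[OF that cl] by (intro mult_left_mono) auto
    also have "\<dots> = \<rho>" by (simp add: exp_minus)
    finally show ?thesis .
  qed
  have G_cont: "continuous_on UNIV (G u)" if "u \<in> S" for u
  proof -
    have "continuous_on {0..T} (V u n)" for n
      using V_ode[OF that] by (rule continuous_on_vector_derivative)
    moreover have c: "continuous_on UNIV cl" unfolding cl_def by (intro continuous_intros)
    ultimately have "continuous_on UNIV (\<lambda>t. V u n (cl t))" for n
      using cl by (intro continuous_on_compose2[of "{0..T}" "V u n" UNIV cl]) auto
    then have "continuous_on UNIV (\<lambda>t. of_real (nu n ^ 5 * exp (- K * cl t)) * V u n (cl t))" for n
      by (intro continuous_intros c)
    then show ?thesis unfolding G_def by (rule continuous_on_int_prod)
  qed
  have G_in: "G u \<in> bcontfun" if "u \<in> S" for u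
    unfolding bcontfun_def bounded_iff using G_cont[OF that] G_norm[OF that] by auto
  have G_apply: "apply_bcontfun (Bcontfun (G u)) = G u" if "u \<in> S" for u
    by (rule Bcontfun_inverse[OF G_in[OF that]])
  have "\<exists>!u\<in>S. Bcontfun (G u) = u"
  proof (rule Banach_fix[of S "1 / 2"])
    show "complete S" unfolding S_def
      by (rule complete_closed_subset[OF closed_cball subset_UNIV complete_UNIV_bcontfun])
    show "S \<noteq> {}" using zS by auto
    show "(\<lambda>u. Bcontfun (G u)) ` S \<subseteq> S"
    proof safe
      fix u assume "u \<in> S"
      then show "Bcontfun (G u) \<in> S" by (subst S_iff) (simp add: G_apply G_norm)
    qed
    fix u v assume u: "u \<in> S" and v: "v \<in> S"
    show "dist (Bcontfun (G u)) (Bcontfun (G v)) \<le> 1 / 2 * dist u v"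
    proof (rule dist_bound)
      fix p
      have D: "norm (apply_bcontfun u q - apply_bcontfun v q) \<le> dist u v" for q
        using dist_bounded[of u q v] by (simp add: dist_norm)
      have "norm (G u p - G v p) \<le> dist u v / 2"
        by (rule G_bound) (use V_diff[OF u v _ D] in auto)
      then show "dist (apply_bcontfun (Bcontfun (G u)) p) (apply_bcontfun (Bcontfun (G v)) p) \<le> 1 / 2 * dist u v"
        by (simp add: G_apply u v dist_norm)
    qed
  qed auto
  then obtain u where u: "u \<in> S" "Bcontfun (G u) = u" by blast
  \<comment> \<open>At the fixed point the modes frozen in the nonlinearity are those of the Duhamel
    solution itself, so its linear equation becomes the nonlinear one.\<close>
  have Rf_V: "Rf u n t = V u n t" if t: "t \<in> {0..T}" for n t
  proof -
    have "apply_bcontfun u (n, t) = G u (n, t)" using G_apply[OF u(1)] u(2) by simp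
    then show ?thesis
      using cl_id[OF t] by (simp add: Rf_def G_def exp_minus field_simps)
  qed
  show ?thesis
  proof (intro exI[of _ "V u"] conjI allI ballI)
    fix n show "V u n 0 = 0" by (rule V0)
  next
    fix n t assume t: "t \<in> {0..T}"
    show "(V u n has_vector_derivative of_real (a n) * V u n t +
       (of_real (m n) * (2 * Q \<kappa> (\<lambda>k. P k t) (\<lambda>k. V u k t) n + Q \<kappa> (\<lambda>k. V u k t) (\<lambda>k. V u k t) n) + E n t))
       (at t within {0..T})"
      using V_ode[OF u(1) t, of n] by (simp add: N_def Rf_V[OF t])
  next
    fix t assume t: "t \<in> {0..T}"
    show "dec 5 (4 * \<eta> * exp (K * t)) (\<lambda>n. V u n t)"
      unfolding dec_def using V_bound[OF u(1) t] by (simp add: \<rho>_def)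
  qed
qed

section \<open>Complex Fourier coefficients\<close>

lemma integrable_open_interval:
  fixes f :: "real \<Rightarrow> real"
  assumes "continuous_on {a..b} f" shows "integrable (lebesgue_on {a<..<b}) f"
proof -
  have "set_integrable lebesgue {a..b} f"
    using continuous_imp_integrable_real[OF assms]
    by (simp add: integrable_restrict_space set_integrable_def)
  then have "set_integrable lebesgue {a<..<b} f"
    by (rule set_integrable_subset) auto
  then show ?thesis
    by (simp add: integrable_restrict_space set_integrable_def)
qed

text \<open>Coefficients and norms of the statement are Lebesgue integrals over the open cell,
  whereas the calculus below uses gauge integrals over the closed one.\<close>

lemma lebesgue_open_interval_integral:
  fixes f :: "real \<Rightarrow> real"
  assumes "continuous_on {a..b} f"
  shows "integral\<^sup>L (lebesgue_on {a<..<b}) f = integral {a..b} f"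
  by (simp add: lebesgue_integral_eq_integral integrable_open_interval[OF assms]
      integral_open_interval_real[symmetric])

lemma cell_integral:
  fixes f :: "real \<Rightarrow> real"
  shows "continuous_on UNIV f \<Longrightarrow> integral\<^sup>L (lebesgue_on (cell l)) f = integral {- l / 2..l / 2} f"
  by (rule lebesgue_open_interval_integral) (erule continuous_on_subset, simp)

lemma fcoef_integral:
  "continuous_on UNIV f \<Longrightarrow> continuous_on UNIV (w k) \<Longrightarrow>
    fcoef l w f k = integral {- l / 2..l / 2} (\<lambda>y. f y * w k y)"
  unfolding fcoef_def by (intro cell_integral continuous_intros)

lemma L2_on_continuous:
  assumes "continuous_on UNIV f" shows "L2_on (cell l) f"
  unfolding L2_on_def
  using assms
  by (auto intro!: integrable_open_interval borel_measurable_integrable continuous_intros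
      intro: continuous_on_subset)

definition fe :: "real \<Rightarrow> int \<Rightarrow> real \<Rightarrow> complex" where
  "fe l n y = cis (2 * pi / l * real_of_int n * y)"

lemma norm_fe [simp]: "norm (fe l n y) = 1"
  by (simp add: fe_def)

lemma fe_0 [simp]: "fe l 0 y = 1"
  by (simp add: fe_def)

lemma fe_mult: "fe l n y * fe l m y = fe l (n + m) y"
  by (simp add: fe_def cis_mult algebra_simps add_divide_distrib)

lemma abs_Re_fe: "\<bar>Re (z * fe l n y)\<bar> \<le> norm z"
  using abs_Re_le_cmod[of "z * fe l n y"] by (simp add: norm_mult del: times_complex.sel)

lemma cnj_fe: "cnj (fe l n y) = fe l (- n) y"
  by (simp add: fe_def cis_cnj)

lemma fe_periodic: "0 < l \<Longrightarrow> fe l n (y + l) = fe l n y"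
proof -
  assume "0 < l"
  then have "2 * pi / l * real_of_int n * (y + l) = 2 * pi / l * real_of_int n * y + 2 * pi * real_of_int n"
    by (simp add: distrib_left)
  then have "fe l n (y + l) = fe l n y * cis (2 * pi * real_of_int n)"
    by (simp only: fe_def cis_mult)
  then show ?thesis by simp
qed

lemma has_vector_derivative_fe:
  "(fe l n has_vector_derivative \<i> * of_real (2 * pi / l * real_of_int n) * fe l n y) (at y within S)"
proof -
  have "((\<lambda>z. exp (\<i> * (of_real c * z))) has_field_derivative
      \<i> * of_real c * exp (\<i> * (of_real c * of_real y))) (at (of_real y))" for c :: real
    by (auto intro!: derivative_eq_intros)
  from has_vector_derivative_real_field[OF this[of "2 * pi / l * real_of_int n"]] show ?thesis
    by (simp add: fe_def[abs_def] cis_conv_exp)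
qed

lemma continuous_on_fe [continuous_intros]:
  "continuous_on S f \<Longrightarrow> continuous_on S (\<lambda>x. fe l n (f x))"
  unfolding fe_def by (intro continuous_intros)

lemma integral_fe:
  assumes l: "0 < l"
  shows "(fe l n has_integral (if n = 0 then of_real l else 0)) {- l / 2..l / 2}"
proof (cases "n = 0")
  case True
  have "((\<lambda>y::real. 1::complex) has_integral of_real l) {- l / 2..l / 2}"
    using has_integral_const_real[of "1::complex" "- l / 2" "l / 2"] l
    by (simp add: scaleR_conv_of_real)
  then show ?thesis using True by (simp add: fe_def[abs_def])
next
  case False
  let ?c = "\<i> * of_real (2 * pi / l * real_of_int n) :: complex"
  have c: "?c \<noteq> 0" using False l by simp
  have "((\<lambda>y. fe l n y / ?c) has_vector_derivative fe l n y) (at y within S)" for y S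
    using has_vector_derivative_mult_left[OF has_vector_derivative_fe[of l n y S], of "1 / ?c"] c
    by (simp add: field_simps)
  then have "(fe l n has_integral fe l n (l / 2) / ?c - fe l n (- l / 2) / ?c) {- l / 2..l / 2}"
    using l by (intro fundamental_theorem_of_calculus) auto
  moreover have "fe l n (l / 2) = fe l n (- l / 2)"
    using fe_periodic[OF l, of n "- l / 2"] by simp
  ultimately show ?thesis using False by simp
qed

text \<open>Dividing by \<open>l\<close> makes \<open>fser\<close> an inverse without further
  constants and turns products into plain convolutions.\<close>

definition fc :: "real \<Rightarrow> (real \<Rightarrow> real) \<Rightarrow> int \<Rightarrow> complex" where
  "fc l f n = integral {- l / 2..l / 2} (\<lambda>y. of_real (f y) * fe l (- n) y) / of_real l"

lemma fc_cong:
  assumes "\<And>y. \<bar>y\<bar> \<le> l / 2 \<Longrightarrow> f y = g y" shows "fc l f n = fc l g n"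
  unfolding fc_def by (intro arg_cong2[where f="(/)"] integral_cong refl) (use assms in auto)

lemma fc_integrable:
  "continuous_on UNIV f \<Longrightarrow> (\<lambda>y. of_real (f y) * fe l n y) integrable_on {a..b}"
  by (intro integrable_continuous_real continuous_intros) (erule continuous_on_subset, simp)

lemma fc_cnj: "fc l f (- n) = cnj (fc l f n)"
  unfolding fc_def by (simp add: Henstock_Kurzweil_Integration.integral_cnj cnj_fe)

lemma fc_diff:
  "continuous_on UNIV f \<Longrightarrow> continuous_on UNIV g \<Longrightarrow>
    fc l (\<lambda>y. f y - g y) n = fc l f n - fc l g n"
  unfolding fc_def
  by (simp add: left_diff_distrib Henstock_Kurzweil_Integration.integral_diff fc_integrable diff_divide_distrib
      del: mult_minus_left)

lemma fc_add:
  "continuous_on UNIV f \<Longrightarrow> continuous_on UNIV g \<Longrightarrow>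
    fc l (\<lambda>y. f y + g y) n = fc l f n + fc l g n"
  unfolding fc_def
  by (simp add: distrib_right Henstock_Kurzweil_Integration.integral_add fc_integrable add_divide_distrib)

lemma fc_cmult: "fc l (\<lambda>y. c * f y) n = of_real c * fc l f n"
  unfolding fc_def by (simp add: mult.assoc)

lemma fc_bound:
  assumes l: "0 < l" and f: "continuous_on UNIV f" and b: "\<And>y. y \<in> {- l / 2..l / 2} \<Longrightarrow> \<bar>f y\<bar> \<le> M"
  shows "norm (fc l f n) \<le> M"
proof -
  have "norm (integral {- l / 2..l / 2} (\<lambda>y. of_real (f y) * fe l (- n) y)) \<le> M * (l / 2 - (- l / 2))"
  proof (rule integral_bound)
    show "continuous_on {- l / 2..l / 2} (\<lambda>y. complex_of_real (f y) * fe l (- n) y)"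
      by (intro continuous_intros continuous_on_subset[OF f]) auto
  qed (use l b in \<open>auto simp: norm_mult\<close>)
  then show ?thesis using l by (simp add: fc_def norm_divide field_simps)
qed

text \<open>Integration by parts; the boundary terms cancel by periodicity.\<close>

lemma fc_deriv:
  assumes l: "0 < l" and p: "periodic l f"
    and d: "\<And>y. (f has_real_derivative f' y) (at y)" and c: "continuous_on UNIV f'"
  shows "fc l f' n = \<i> * of_real (2 * pi / l * real_of_int n) * fc l f n"
proof -
  let ?k = "\<i> * of_real (2 * pi / l * real_of_int n) :: complex"
  let ?g = "\<lambda>y. complex_of_real (f y) * fe l (- n) y"
  have cf: "continuous_on UNIV f"
    using d by (auto intro: continuous_at_imp_continuous_on DERIV_isCont)
  have "(?g has_vector_derivative (of_real (f' y) * fe l (- n) y - ?k * ?g y)) (at y within S)" for y S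
  proof -
    have "((\<lambda>y. complex_of_real (f y)) has_vector_derivative of_real (f' y)) (at y within S)"
      by (rule has_vector_derivative_of_real, rule has_field_derivative_at_within, rule d)
    from has_vector_derivative_mult[OF this has_vector_derivative_fe[of l "- n" y S]]
    show ?thesis by (rule has_vector_derivative_eq_rhs) (simp add: algebra_simps)
  qed
  then have "((\<lambda>y. of_real (f' y) * fe l (- n) y - ?k * ?g y) has_integral ?g (l / 2) - ?g (- l / 2))
      {- l / 2..l / 2}"
    using l by (intro fundamental_theorem_of_calculus) auto
  moreover have "?g (l / 2) = ?g (- l / 2)"
    using fe_periodic[OF l, of "- n" "- l / 2"] p[unfolded periodic_def, rule_format, of "- l / 2"] by simp
  ultimately have "integral {- l / 2..l / 2} (\<lambda>y. of_real (f' y) * fe l (- n) y - ?k * ?g y) = 0"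
    by (simp add: integral_unique)
  moreover have "integral {- l / 2..l / 2} (\<lambda>y. of_real (f' y) * fe l (- n) y - ?k * ?g y) =
      integral {- l / 2..l / 2} (\<lambda>y. of_real (f' y) * fe l (- n) y) - ?k * integral {- l / 2..l / 2} ?g"
    by (subst Henstock_Kurzweil_Integration.integral_diff[OF fc_integrable[OF c]
          integrable_on_mult_right[OF fc_integrable[OF cf]]])
      (simp only: Henstock_Kurzweil_Integration.integral_mult_right)
  ultimately show ?thesis by (simp add: fc_def)
qed

section \<open>Real functions given by absolutely convergent Fourier series\<close>

definition csym :: "(int \<Rightarrow> complex) \<Rightarrow> bool" where
  "csym c \<longleftrightarrow> (\<forall>n. c (- n) = cnj (c n))"

text \<open>The real-valued function with Fourier coefficients \<open>c\<close>, when \<open>csym c\<close>.\<close>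

definition fser :: "real \<Rightarrow> (int \<Rightarrow> complex) \<Rightarrow> real \<Rightarrow> real" where
  "fser l c y = (\<Sum>\<^sub>\<infinity>n. Re (c n * fe l n y))"

lemma fser_summable:
  assumes "dec 2 r c" shows "(\<lambda>n. c n * fe l n y) summable_on UNIV"
  by (rule abs_summable_summable, rule Infinite_Sum.abs_summable_on_comparison_test'[OF dec_summable[OF assms]])
    (auto simp: norm_mult)

text \<open>Under \<open>csym\<close> the substitution \<open>n \<mapsto> - n\<close> shows that the
  complex sum equals its own conjugate, so taking real parts loses nothing.\<close>

lemma fser_has_sum:
  assumes "dec 2 r c" "csym c" shows "((\<lambda>n. c n * fe l n y) has_sum of_real (fser l c y)) UNIV"
proof -
  note s = fser_summable[OF assms(1), of l y]
  have "cnj (\<Sum>\<^sub>\<infinity>n. c n * fe l n y) = (\<Sum>\<^sub>\<infinity>n. cnj (c n * fe l n y))"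
    by (rule infsum_cnj[symmetric])
  also have "\<dots> = (\<Sum>\<^sub>\<infinity>n. c (- n) * fe l (- n) y)"
    using assms(2) by (simp add: csym_def cnj_fe)
  also have "\<dots> = (\<Sum>\<^sub>\<infinity>n. c n * fe l n y)"
    using infsum_reindex_bij_betw[of uminus UNIV UNIV "\<lambda>n::int. c n * fe l n y"]
    by (simp add: bij_uminus)
  finally have "of_real (Re (\<Sum>\<^sub>\<infinity>n. c n * fe l n y)) = (\<Sum>\<^sub>\<infinity>n. c n * fe l n y)"
    by (simp add: complex_eq_iff)
  then show ?thesis
    using has_sum_infsum[OF s] infsum_Re[OF s] by (simp add: fser_def)
qed

lemma fser_uniform:
  assumes "dec 2 r c" "csym c"
  shows "uniform_limit X (\<lambda>F y. \<Sum>n\<in>F. c n * fe l n y) (\<lambda>y. of_real (fser l c y))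
    (finite_subsets_at_top UNIV)"
  by (rule Weierstrass_m_test_general'[OF _ fser_has_sum[OF assms] dec_summable[OF assms(1)]])
    (auto simp: norm_mult)

lemma fser_bound:
  assumes "dec 2 r c" shows "\<bar>fser l c y\<bar> \<le> r * nusum"
proof -
  have "norm (\<Sum>\<^sub>\<infinity>n. c n * fe l n y) \<le> (\<Sum>\<^sub>\<infinity>n. r * (1 / nu n ^ 2))"
    by (rule norm_infsum_le[OF has_sum_infsum[OF fser_summable[OF assms]]
          has_sum_infsum[OF summable_on_cmult_right[OF nu_summable]]])
      (use decD[OF assms] in \<open>simp add: norm_mult\<close>)
  also have "\<dots> = r * nusum" unfolding nusum_def by (rule infsum_cmult_right')
  finally have "norm (\<Sum>\<^sub>\<infinity>n. c n * fe l n y) \<le> r * nusum" .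
  moreover have "fser l c y = Re (\<Sum>\<^sub>\<infinity>n. c n * fe l n y)"
    unfolding fser_def by (rule infsum_Re[OF fser_summable[OF assms]])
  ultimately show ?thesis
    using abs_Re_le_cmod[of "\<Sum>\<^sub>\<infinity>n. c n * fe l n y"] by linarith
qed

lemma fser_add:
  assumes "dec 2 r c" "dec 2 s d"
  shows "fser l (\<lambda>n. c n + d n) y = fser l c y + fser l d y"
proof -
  have "(\<Sum>\<^sub>\<infinity>n. (c n + d n) * fe l n y) = (\<Sum>\<^sub>\<infinity>n. c n * fe l n y) + (\<Sum>\<^sub>\<infinity>n. d n * fe l n y)"
    by (subst infsum_add[OF fser_summable[OF assms(1)] fser_summable[OF assms(2)], symmetric])
      (simp add: distrib_right)
  then show ?thesis
    unfolding fser_def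
    using infsum_Re[OF fser_summable[OF assms(1)], of l y] infsum_Re[OF fser_summable[OF assms(2)], of l y]
      infsum_Re[OF fser_summable[OF dec_add[OF assms]], of l y] by simp
qed

lemma fser_cmult: "fser l (\<lambda>n. of_real a * c n) y = a * fser l c y"
proof -
  have "fser l (\<lambda>n. of_real a * c n) y = (\<Sum>\<^sub>\<infinity>n. a * Re (c n * fe l n y))"
    unfolding fser_def by (intro infsum_cong) (simp add: mult.assoc)
  then show ?thesis by (simp add: infsum_cmult_right' fser_def)
qed

lemma fser_diff:
  assumes "dec 2 r c" "dec 2 s d"
  shows "fser l (\<lambda>n. c n - d n) y = fser l c y - fser l d y"
  using fser_add[OF assms(1) dec_cmult[OF assms(2), of "-1"], of l y] fser_cmult[of l "-1" d y] by simp

lemma fser_periodic: "0 < l \<Longrightarrow> periodic l (fser l c)"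
  by (simp add: periodic_def fser_def fe_periodic)

lemma cont_strip_fser:
  assumes "\<And>n. continuous_on {0..T} (c n)" "\<And>t. t \<in> {0..T} \<Longrightarrow> dec 2 r (\<lambda>n. c n t)"
  shows "cont_strip T (\<lambda>t. fser l (\<lambda>n. c n t))"
proof -
  have "uniform_limit ({0..T} \<times> UNIV) (\<lambda>X p. \<Sum>n\<in>X. Re (c n (fst p) * fe l n (snd p)))
      (\<lambda>p. \<Sum>\<^sub>\<infinity>n. Re (c n (fst p) * fe l n (snd p))) (finite_subsets_at_top UNIV)"
  proof (rule Weierstrass_m_test_general)
    show "(\<lambda>n. r * (1 / nu n ^ 2)) summable_on UNIV"
      by (intro summable_on_cmult_right nu_summable)
    fix n p assume "p \<in> {0..T} \<times> (UNIV::real set)"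
    then have "norm (c n (fst p)) \<le> r / nu n ^ 2"
      by (intro decD[OF assms(2)]) auto
    then show "norm (Re (c n (fst p) * fe l n (snd p))) \<le> r * (1 / nu n ^ 2)"
      using abs_Re_fe[of "c n (fst p)" l n "snd p"] by simp
  qed
  moreover have "continuous_on ({0..T} \<times> UNIV) (\<lambda>p. \<Sum>n\<in>X. Re (c n (fst p) * fe l n (snd p)))" for X
    by (intro continuous_intros continuous_on_compose2[OF assms(1)]) auto
  ultimately have "continuous_on ({0..T} \<times> UNIV) (\<lambda>p. \<Sum>\<^sub>\<infinity>n. Re (c n (fst p) * fe l n (snd p)))"
    by (intro uniform_limit_theorem[OF always_eventually]) (auto simp: finite_subsets_at_top_neq_bot)
  then show ?thesis by (simp add: cont_strip_def fser_def case_prod_beta)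
qed

lemma continuous_fser:
  assumes "dec 2 r c" shows "continuous_on S (fser l c)"
proof -
  \<comment> \<open>A strip of zero duration reduces continuity in space to the joint
    statement.\<close>
  have "cont_strip 0 (\<lambda>t. fser l (\<lambda>n. c n))"
    using assms by (intro cont_strip_fser[where c="\<lambda>n t. c n" and r=r]) auto
  then have "continuous_on ({0..0} \<times> UNIV) (\<lambda>p::real \<times> real. fser l c (snd p))"
    by (simp add: cont_strip_def case_prod_beta)
  then have "continuous_on S (\<lambda>y. (\<lambda>p::real \<times> real. fser l c (snd p)) (0, y))"
    by (rule continuous_on_compose2) (auto intro!: continuous_intros)
  then show ?thesis by simp
qed

text \<open>The series are summed in the order of an enumeration of the integers, because termwise
  differentiation is available for sequences.\<close>

lemma infsum_int_series:
  fixes f :: "int \<Rightarrow> real"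
  assumes "\<And>n. \<bar>f n\<bar> \<le> r / nu n ^ 2"
  shows "(\<lambda>k. f (int_decode k)) sums (\<Sum>\<^sub>\<infinity>n. f n)"
proof -
  have "f summable_on UNIV"
    by (rule abs_summable_summable, rule Infinite_Sum.abs_summable_on_comparison_test'
        [OF summable_on_cmult_right[OF nu_summable, of r]]) (use assms in auto)
  then have "(f has_sum (\<Sum>\<^sub>\<infinity>n. f n)) UNIV" by (rule has_sum_infsum)
  then have "((\<lambda>k. f (int_decode k)) has_sum (\<Sum>\<^sub>\<infinity>n. f n)) UNIV"
    by (subst has_sum_reindex_bij_betw[OF bij_int_decode])
  then show ?thesis by (rule has_sum_imp_sums)
qed

lemma DERIV_infsum_int:
  fixes f :: "int \<Rightarrow> real \<Rightarrow> real"
  assumes S: "convex S" "x \<in> S"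
    and d: "\<And>n x. x \<in> S \<Longrightarrow> (f n has_real_derivative f' n x) (at x within S)"
    and b: "\<And>n x. x \<in> S \<Longrightarrow> \<bar>f n x\<bar> \<le> r / nu n ^ 2" "\<And>n x. x \<in> S \<Longrightarrow> \<bar>f' n x\<bar> \<le> r / nu n ^ 2"
  shows "((\<lambda>x. \<Sum>\<^sub>\<infinity>n. f n x) has_real_derivative (\<Sum>\<^sub>\<infinity>n. f' n x)) (at x within S)"
proof -
  have "r / nu n ^ 2 \<ge> 0" for n
    using b(1)[OF S(2), of n] by linarith
  then have "\<bar>r / nu n ^ 2\<bar> \<le> r / nu n ^ 2" for n by (metis abs_of_nonneg order_refl)
  then have sm: "summable (\<lambda>k. r / nu (int_decode k) ^ 2)"
    using infsum_int_series[of "\<lambda>n. r / nu n ^ 2" r] by (auto simp: sums_iff)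
  have "uniform_limit S (\<lambda>N x. \<Sum>k<N. f' (int_decode k) x) (\<lambda>x. \<Sum>k. f' (int_decode k) x) sequentially"
    by (rule Weierstrass_m_test[OF _ sm]) (use b in auto)
  from has_field_derivative_series[OF S(1) d this S(2)]
  obtain g where g: "\<And>x. x \<in> S \<Longrightarrow> (\<lambda>k. f (int_decode k) x) sums g x"
    "\<And>x. x \<in> S \<Longrightarrow> (g has_real_derivative (\<Sum>k. f' (int_decode k) x)) (at x within S)"
    using infsum_int_series[OF b(1)[OF S(2)]] by (auto simp: sums_iff)
  have "g y = (\<Sum>\<^sub>\<infinity>n. f n y)" if "y \<in> S" for y
    using g(1)[OF that] infsum_int_series[OF b(1)[OF that]] by (metis sums_unique2)
  moreover have "(\<Sum>k. f' (int_decode k) x) = (\<Sum>\<^sub>\<infinity>n. f' n x)"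
    using infsum_int_series[OF b(2)[OF S(2)]] by (simp add: sums_iff)
  ultimately show ?thesis
    using g(2)[OF S(2)] S(2) by (auto intro: has_field_derivative_transform_within[OF _ zero_less_one])
qed

lemma fser_deriv_space:
  assumes c: "dec 3 r c"
  shows "(fser l c has_real_derivative
    fser l (\<lambda>n. \<i> * of_real (2 * pi / l * real_of_int n) * c n) y) (at y)"
proof -
  let ?c = "\<lambda>n. \<i> * of_real (2 * pi / l * real_of_int n) * c n"
  \<comment> \<open>A common constant for the series and for its derivative, as termwise
    differentiation takes one majorant for both.\<close>
  let ?r = "(\<bar>2 * pi / l\<bar> + 1) * r"
  have "norm (\<i> * of_real (2 * pi / l * real_of_int n) :: complex) \<le> \<bar>2 * pi / l\<bar> * nu n ^ 1" for n
  proof -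
    have "norm (\<i> * of_real (2 * pi / l * real_of_int n) :: complex) = \<bar>2 * pi / l\<bar> * \<bar>real_of_int n\<bar>"
      by (simp only: norm_mult norm_ii norm_of_real abs_mult mult_1)
    then show ?thesis using mult_left_mono[OF abs_le_nu[of n], of "\<bar>2 * pi / l\<bar>"] by simp
  qed
  from dec_mult_growth[OF _ this, of 2 r c] have "dec 2 (\<bar>2 * pi / l\<bar> * r) ?c"
    using c by simp
  then have c': "dec 2 ?r ?c"
    by (rule dec_mono) (use dec_nonneg[OF c] in \<open>auto simp: algebra_simps\<close>)
  have c2: "dec 2 ?r c"
    by (rule dec_mono[OF c]) (use dec_nonneg[OF c] in \<open>auto simp: algebra_simps\<close>)
  have "((\<lambda>y. \<Sum>\<^sub>\<infinity>n. Re (c n * fe l n y)) has_real_derivative (\<Sum>\<^sub>\<infinity>n. Re (?c n * fe l n y))) (at y within UNIV)"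
  proof (rule DERIV_infsum_int)
    fix n y
    have "((\<lambda>y. c n * fe l n y) has_vector_derivative c n * (\<i> * of_real (2 * pi / l * real_of_int n) * fe l n y)) (at y within UNIV)"
      by (rule has_vector_derivative_mult_right[OF has_vector_derivative_fe])
    then have "((\<lambda>y. Re (c n * fe l n y)) has_vector_derivative Re (c n * (\<i> * of_real (2 * pi / l * real_of_int n) * fe l n y))) (at y within UNIV)"
      by (rule bounded_linear.has_vector_derivative[OF bounded_linear_Re])
    then show "((\<lambda>y. Re (c n * fe l n y)) has_real_derivative Re (?c n * fe l n y)) (at y within UNIV)"
      unfolding has_real_derivative_iff_has_vector_derivative by (simp only: mult_ac)
    show "\<bar>Re (c n * fe l n y)\<bar> \<le> ?r / nu n ^ 2"
      by (rule order_trans[OF abs_Re_fe decD[OF c2]])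
    show "\<bar>Re (?c n * fe l n y)\<bar> \<le> ?r / nu n ^ 2"
      by (rule order_trans[OF abs_Re_fe decD[OF c']])
  qed auto
  then show ?thesis unfolding fser_def[abs_def] .
qed

lemma fser_deriv_time:
  assumes t: "t \<in> {0..T}"
    and d: "\<And>n t. t \<in> {0..T} \<Longrightarrow> (c n has_vector_derivative c' n t) (at t within {0..T})"
    and c: "\<And>t. t \<in> {0..T} \<Longrightarrow> dec 2 r (\<lambda>n. c n t)" and c': "\<And>t. t \<in> {0..T} \<Longrightarrow> dec 2 s (\<lambda>n. c' n t)"
  shows "((\<lambda>t. fser l (\<lambda>n. c n t) y) has_real_derivative fser l (\<lambda>n. c' n t) y) (at t within {0..T})"
  unfolding fser_def
proof (rule DERIV_infsum_int[OF _ t])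
  have rs: "0 \<le> r" "0 \<le> s" using c[OF t] c'[OF t] by (auto dest: dec_nonneg)
  fix n t assume t: "t \<in> {0..T}"
  have "((\<lambda>t. Re (c n t * fe l n y)) has_vector_derivative Re (c' n t * fe l n y)) (at t within {0..T})"
    by (intro bounded_linear.has_vector_derivative[OF bounded_linear_Re] has_vector_derivative_mult_left d t)
  then show "((\<lambda>t. Re (c n t * fe l n y)) has_real_derivative Re (c' n t * fe l n y)) (at t within {0..T})"
    by (simp add: has_real_derivative_iff_has_vector_derivative)
  show "\<bar>Re (c n t * fe l n y)\<bar> \<le> (r + s) / nu n ^ 2"
    using decD[OF dec_mono[OF c[OF t] order_refl, of "r + s"], of n] rs abs_Re_fe[of "c n t" l n y]
    by linarith
  show "\<bar>Re (c' n t * fe l n y)\<bar> \<le> (r + s) / nu n ^ 2"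
    using decD[OF dec_mono[OF c'[OF t] order_refl, of "r + s"], of n] rs abs_Re_fe[of "c' n t" l n y]
    by linarith
qed auto

text \<open>The series of the first factor converges uniformly and may be integrated termwise
  against the second, of which only continuity is asked. With \<open>g = 1\<close> this recovers
  single coefficients, and with two derivatives it yields the quadratic term.\<close>

lemma fc_product_has_sum:
  assumes l: "0 < l" and c: "dec 2 r c" "csym c" and g: "continuous_on UNIV g"
  shows "((\<lambda>j. c j * fc l g (n - j)) has_sum fc l (\<lambda>y. fser l c y * g y) n) UNIV"
proof -
  have bg: "bounded (g ` {- l / 2..l / 2})"
    by (intro compact_imp_bounded compact_continuous_image continuous_on_subset[OF g]) auto
  let ?h = "\<lambda>y. complex_of_real (g y) * fe l (- n) y"
  have ch: "continuous_on S ?h" for S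
    by (intro continuous_intros continuous_on_subset[OF g]) auto
  have "uniform_limit {- l / 2..l / 2} (\<lambda>F y. (\<Sum>j\<in>F. c j * fe l j y) * ?h y)
      (\<lambda>y. of_real (fser l c y) * ?h y) (finite_subsets_at_top UNIV)"
  proof (rule uniform_lim_mult[OF fser_uniform[OF c] uniform_limit_const])
    have "\<bar>fser l c y\<bar> \<le> r * nusum" for y by (rule fser_bound[OF c(1)])
    then show "bounded ((\<lambda>y. complex_of_real (fser l c y)) ` {- l / 2..l / 2})"
      by (auto simp: bounded_iff)
    show "bounded (?h ` {- l / 2..l / 2})"
      by (intro compact_imp_bounded compact_continuous_image ch) auto
  qed
  then have u: "uniform_limit (cbox (- l / 2) (l / 2)) (\<lambda>F y. (\<Sum>j\<in>F. c j * fe l j y) * ?h y)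
      (\<lambda>y. of_real (fser l c y) * ?h y) (finite_subsets_at_top UNIV)"
    by simp
  have "continuous_on (cbox (- l / 2) (l / 2)) (\<lambda>y. (\<Sum>j\<in>F. c j * fe l j y) * ?h y)" for F
    by (intro continuous_intros ch)
  from uniform_limit_integral_cbox[OF u this] obtain I J where IJ:
    "\<And>F. ((\<lambda>y. (\<Sum>j\<in>F. c j * fe l j y) * ?h y) has_integral I F) (cbox (- l / 2) (l / 2))"
    "((\<lambda>y. of_real (fser l c y) * ?h y) has_integral J) (cbox (- l / 2) (l / 2))"
    "(I \<longlongrightarrow> J) (finite_subsets_at_top UNIV)"
    using finite_subsets_at_top_neq_bot by blast
  have J: "J / of_real l = fc l (\<lambda>y. fser l c y * g y) n"
    using IJ(2) by (simp add: fc_def integral_unique mult_ac)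
  have I: "I F / of_real l = (\<Sum>j\<in>F. c j * fc l g (n - j))" for F
  proof -
    have "I F = integral {- l / 2..l / 2} (\<lambda>y. \<Sum>j\<in>F. c j * (of_real (g y) * fe l (- (n - j)) y))"
    proof (rule integral_unique[symmetric], rule has_integral_eq)
      show "((\<lambda>y. (\<Sum>j\<in>F. c j * fe l j y) * ?h y) has_integral I F) {- l / 2..l / 2}"
        using IJ(1) by simp
      fix y
      have "c j * fe l j y * ?h y = c j * (of_real (g y) * fe l (- (n - j)) y)" for j
        using fe_mult[of l j y "- n"] by (simp add: mult_ac)
      then show "(\<Sum>j\<in>F. c j * fe l j y) * ?h y = (\<Sum>j\<in>F. c j * (of_real (g y) * fe l (- (n - j)) y))"
        by (simp only: sum_distrib_right)
    qed
    also have "\<dots> = (\<Sum>j\<in>F. c j * integral {- l / 2..l / 2} (\<lambda>y. of_real (g y) * fe l (- (n - j)) y))"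
    proof (cases "finite F")
      case True
      then show ?thesis
        by (subst Henstock_Kurzweil_Integration.integral_sum) (auto intro!: integrable_on_mult_right fc_integrable[OF g])
    qed auto
    finally show ?thesis by (simp add: fc_def sum_divide_distrib)
  qed
  have "((\<lambda>F. I F / of_real l) \<longlongrightarrow> J / of_real l) (finite_subsets_at_top UNIV)"
    by (intro tendsto_divide IJ(3) tendsto_const) (use l in auto)
  then show ?thesis by (simp add: I J has_sum_def)
qed

lemma fc_fser:
  assumes l: "0 < l" and c: "dec 2 r c" "csym c"
  shows "fc l (fser l c) n = c n"
proof -
  have one: "fc l (\<lambda>y. 1) k = (if k = 0 then 1 else 0)" for k
    using integral_unique[OF integral_fe[OF l, of "- k"]] l by (auto simp: fc_def)
  have "((\<lambda>j. c j * fc l (\<lambda>y. 1) (n - j)) has_sum fc l (fser l c) n) UNIV"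
    using fc_product_has_sum[OF l c, of "\<lambda>y. 1" n] by simp
  moreover have "((\<lambda>j. c j * fc l (\<lambda>y. 1) (n - j)) has_sum c n) UNIV"
    by (rule has_sum_finite_neutralI[of "{n}"]) (auto simp: one)
  ultimately show ?thesis by (rule has_sum_unique)
qed

section \<open>The given eigenbasis\<close>

text \<open>Subtracting the candidate leaves a solution whose energy
  \<open>q\<^sup>2 + \<mu>\<^sup>2 * p\<^sup>2\<close> is conserved and vanishes at zero.\<close>

lemma harmonic_ode:
  assumes \<mu>: "\<mu> \<noteq> (0::real)"
    and u: "\<And>y. (u has_real_derivative u' y) (at y)"
    and u': "\<And>y. (u' has_real_derivative - \<mu>\<^sup>2 * u y) (at y)"
  shows "u y = u 0 * cos (\<mu> * y) + u' 0 / \<mu> * sin (\<mu> * y)"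
proof -
  define p where "p y = u y - (u 0 * cos (\<mu> * y) + u' 0 / \<mu> * sin (\<mu> * y))" for y
  define q where "q y = u' y - (u' 0 * cos (\<mu> * y) - \<mu> * u 0 * sin (\<mu> * y))" for y
  have p: "(p has_real_derivative q y) (at y)" for y
    unfolding p_def q_def using \<mu> by (auto intro!: derivative_eq_intros u)
  have q: "(q has_real_derivative - \<mu>\<^sup>2 * p y) (at y)" for y
    unfolding p_def q_def using \<mu>
    by (auto intro!: derivative_eq_intros u' simp: power2_eq_square algebra_simps)
  have "((\<lambda>y. (q y)\<^sup>2 + \<mu>\<^sup>2 * (p y)\<^sup>2) has_real_derivative 0) (at y)" for y
    by (auto intro!: derivative_eq_intros p q simp: power2_eq_square algebra_simps)
  then have "(q y)\<^sup>2 + \<mu>\<^sup>2 * (p y)\<^sup>2 = (q 0)\<^sup>2 + \<mu>\<^sup>2 * (p 0)\<^sup>2"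
    by (intro DERIV_isconst_all[of "\<lambda>y. (q y)\<^sup>2 + \<mu>\<^sup>2 * (p y)\<^sup>2"]) auto
  also have "\<dots> = 0" by (simp add: p_def q_def)
  finally have "(q y)\<^sup>2 + \<mu>\<^sup>2 * (p y)\<^sup>2 = 0" .
  moreover have "0 \<le> (q y)\<^sup>2" "0 \<le> \<mu>\<^sup>2 * (p y)\<^sup>2" by simp_all
  ultimately have "\<mu>\<^sup>2 * (p y)\<^sup>2 = 0" by linarith
  then show ?thesis using \<mu> by (simp add: p_def)
qed

definition freq :: "nat \<Rightarrow> int" where
  "freq k = int ((k + 1) div 2)"

lemma freq_simps [simp]: "freq (2 * j) = int j" "0 < j \<Longrightarrow> freq (2 * j - Suc 0) = int j" "freq 0 = 0"
  by (auto simp: freq_def)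

lemma freq_nonneg [simp]: "0 \<le> freq k"
  by (simp add: freq_def)

lemma freq_zero_iff: "freq k = 0 \<longleftrightarrow> k = 0"
  by (auto simp: freq_def)

lemma eigval_freq: "eigval l k = (2 * pi / l * real_of_int (freq k))\<^sup>2"
  by (simp add: eigval_def freq_def power_mult_distrib power_divide)

text \<open>The eigenvalue equation leaves two real constants, stored in one complex amplitude. At
  \<open>k = 0\<close> it gives an affine function, whose slope periodicity kills, and the amplitude
  is normalised to be real. With the factor 2, the coefficients at a positive frequency and its
  negative are the amplitude and its conjugate.\<close>

lemma eigenfunction_form:
  assumes l: "0 < l" and b: "periodic_eigenbasis l w"
  shows "\<exists>a. (\<forall>y. w k y = 2 * Re (a * fe l (freq k) y)) \<and> (k = 0 \<longrightarrow> Im a = 0)"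
proof -
  from b obtain u' where p: "periodic l (w k)"
    and u: "\<And>y. (w k has_real_derivative u' y) (at y)"
    and u': "\<And>y. (u' has_real_derivative - eigval l k * w k y) (at y)"
    unfolding periodic_eigenbasis_def by blast
  define \<mu> where "\<mu> = 2 * pi / l * real_of_int (freq k)"
  show ?thesis
  proof (cases "k = 0")
    case True
    then have "\<And>y. (u' has_real_derivative 0) (at y)" using u' by (simp add: eigval_freq)
    then have "u' y = u' 0" for y by (intro DERIV_isconst_all) auto
    then have "((\<lambda>y. w k y - u' 0 * y) has_real_derivative 0) (at y)" for y
      using u by (auto intro!: derivative_eq_intros)
    then have lin: "w k y - u' 0 * y = w k 0 - u' 0 * 0" for y
      by (intro DERIV_isconst_all[of "\<lambda>y. w k y - u' 0 * y"]) auto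
    moreover have "w k l = w k 0"
      using p[unfolded periodic_def, rule_format, of 0] by simp
    ultimately have "u' 0 = 0" using l lin[of l] by simp
    then have "\<forall>y. w k y = 2 * Re (of_real (w k 0 / 2) * fe l (freq k) y)"
      using lin True by simp
    moreover have "k = 0 \<longrightarrow> Im (of_real (w k 0 / 2)) = 0" by simp
    ultimately show ?thesis by blast
  next
    case False
    then have \<mu>: "\<mu> \<noteq> 0" using l by (simp add: \<mu>_def freq_zero_iff)
    have w: "w k y = w k 0 * cos (\<mu> * y) + u' 0 / \<mu> * sin (\<mu> * y)" for y
      by (rule harmonic_ode[OF \<mu> u]) (use u' in \<open>simp add: eigval_freq \<mu>_def\<close>)
    have "w k y = 2 * Re (Complex (w k 0 / 2) (- u' 0 / (2 * \<mu>)) * fe l (freq k) y)" for y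
    proof -
      have fe: "fe l (freq k) y = cis (\<mu> * y)" by (simp add: fe_def \<mu>_def)
      have "2 * Re (Complex a b * cis x) = 2 * a * cos x - 2 * b * sin x" for a b x by simp
      then show ?thesis
        unfolding fe using w[of y] by simp
    qed
    then show ?thesis using False by blast
  qed
qed

text \<open>The amplitudes \<alpha> record the freedom that the abstract basis still has, namely the
  choice of an orthonormal pair in each two-dimensional eigenspace.\<close>

locale eigenbasis =
  fixes l :: real and w :: "nat \<Rightarrow> real \<Rightarrow> real" and \<alpha> :: "nat \<Rightarrow> complex"
  assumes l: "0 < l" and basis: "periodic_eigenbasis l w"
    and form: "w k y = 2 * Re (\<alpha> k * fe l (freq k) y)" and real0: "Im (\<alpha> 0) = 0"
begin

lemma continuous_w: "continuous_on S (w k)"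
proof -
  have "continuous_on S (\<lambda>y. 2 * Re (\<alpha> k * fe l (freq k) y))"
    by (intro continuous_intros)
  then show ?thesis by (simp add: form[abs_def])
qed

lemma fcoef_fc:
  assumes f: "continuous_on UNIV f"
  shows "fcoef l w f k = 2 * l * Re (cnj (\<alpha> k) * fc l f (freq k))"
proof -
  let ?g = "\<lambda>y. complex_of_real (f y) * fe l (freq k) y"
  have i: "?g integrable_on {- l / 2..l / 2}" by (rule fc_integrable[OF f])
  have lin: "bounded_linear (\<lambda>z. 2 * Re (\<alpha> k * z))"
    by (intro bounded_linear_intros bounded_linear_Re
        bounded_linear_compose[OF bounded_linear_mult_right[of "2::real"]]
        bounded_linear_compose[OF bounded_linear_Re] bounded_linear_mult_right)
  have "fcoef l w f k = integral {- l / 2..l / 2} ((\<lambda>z. 2 * Re (\<alpha> k * z)) \<circ> ?g)"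
    unfolding fcoef_integral[of f w k l, OF f continuous_w] by (rule integral_cong) (simp add: form o_def algebra_simps)
  also have "\<dots> = 2 * Re (\<alpha> k * integral {- l / 2..l / 2} ?g)"
    by (rule integral_linear[OF i lin])
  also have "integral {- l / 2..l / 2} ?g = of_real l * fc l f (- freq k)"
    using l by (simp add: fc_def)
  also have "\<dots> = cnj (of_real l * fc l f (freq k))"
    by (simp add: fc_cnj)
  finally show ?thesis by (simp add: algebra_simps)
qed

lemma orth: "fcoef l w (w j) k = (if j = k then 1 else 0)"
  using basis unfolding periodic_eigenbasis_def by auto

lemma fc_w: "fc l (w k) n =
    (if freq k = n then \<alpha> k else 0) + (if freq k = - n then cnj (\<alpha> k) else 0)"
proof -
  let ?j = "freq k"
  have e: "complex_of_real (w k y) * fe l (- n) y =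
      \<alpha> k * fe l (?j - n) y + cnj (\<alpha> k) * fe l (- ?j - n) y" for y
  proof -
    have "complex_of_real (w k y) = \<alpha> k * fe l ?j y + cnj (\<alpha> k) * fe l (- ?j) y"
      unfolding form using complex_add_cnj[of "\<alpha> k * fe l ?j y"] by (simp add: cnj_fe)
    then show ?thesis
      using fe_mult[of l ?j y "- n"] fe_mult[of l "- ?j" y "- n"] by (simp add: distrib_right mult.assoc)
  qed
  have "((\<lambda>y. \<alpha> k * fe l (?j - n) y + cnj (\<alpha> k) * fe l (- ?j - n) y) has_integral
      \<alpha> k * (if ?j - n = 0 then of_real l else 0) + cnj (\<alpha> k) * (if - ?j - n = 0 then of_real l else 0))
      {- l / 2..l / 2}"
    by (intro has_integral_add has_integral_mult_right integral_fe l)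
  from integral_unique[OF this] show ?thesis
    unfolding fc_def e using l by (auto simp: field_simps)
qed

text \<open>Seen as vectors in the plane, the two amplitudes of a positive frequency are orthogonal
  and of equal length, so they span it.\<close>

lemma alpha_orth:
  "0 < k \<Longrightarrow> freq j = freq k \<Longrightarrow> 2 * l * Re (cnj (\<alpha> k) * \<alpha> j) = (if j = k then 1 else 0)"
  using orth[of j k] freq_zero_iff[of k] freq_nonneg[of k]
  by (simp add: fcoef_fc[OF continuous_w] fc_w)

lemma alpha0: "4 * l * (Re (\<alpha> 0))\<^sup>2 = 1"
  using orth[of 0 0] real0 by (simp add: fcoef_fc[OF continuous_w] fc_w power2_eq_square)

lemma alpha_bound: "2 * l * (norm (\<alpha> k))\<^sup>2 \<le> 1"
proof (cases "k = 0")
  case True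
  then show ?thesis using alpha0 real0 by (simp add: cmod_def)
next
  case False
  have "Re (cnj (\<alpha> k) * \<alpha> k) = (norm (\<alpha> k))\<^sup>2"
    unfolding cmod_power2 by (simp add: power2_eq_square)
  then show ?thesis using alpha_orth[of k k] False by simp
qed

text \<open>Let \<open>z\<close> be the defect at a frequency. The hypothesis makes it orthogonal,
  as a plane vector, to all amplitudes of that frequency. At a positive frequency these span the
  plane; at zero there is only one, but there \<open>z\<close> is real. Conjugation and evenness of
  the symbol cover the negative frequencies.\<close>

lemma fc_eq_multiplier:
  assumes f: "continuous_on UNIV f" and g: "continuous_on UNIV g"
    and p: "\<And>k. p k = P (freq k)" "\<And>n. P (- n) = P n"
    and eq: "\<And>k. fcoef l w g k = p k * fcoef l w f k"
  shows "fc l g n = of_real (P n) * fc l f n"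
proof -
  have nat: "fc l g (int j) = of_real (P (int j)) * fc l f (int j)" for j
  proof -
    define z where "z = fc l g (int j) - of_real (P (int j)) * fc l f (int j)"
    have orth: "Re (cnj (\<alpha> k) * z) = 0" if "freq k = int j" for k
    proof -
      have "2 * l * Re (cnj (\<alpha> k) * z) = 0"
        using eq[of k] that p(1)[of k] by (simp add: fcoef_fc f g z_def algebra_simps)
      then show ?thesis using l by simp
    qed
    have "z = 0"
    proof (cases "j = 0")
      case True
      have "Im (fc l h 0) = 0" for h
        using fc_cnj[of l h 0] by (simp add: complex_eq_iff)
      then have "Im z = 0" using True by (simp add: z_def)
      moreover have "Re (\<alpha> 0) \<noteq> 0" using alpha0 by auto
      then have "Re z = 0" using orth[of 0] True real0 by simp
      ultimately show ?thesis by (simp add: complex_eq_iff)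
    next
      case False
      define a b where "a = \<alpha> (2 * j - 1)" and "b = \<alpha> (2 * j)"
      have "freq (2 * j - 1) = int j" using False by simp
      note o = orth[OF this] orth[of "2 * j"]
      have "2 * j \<noteq> 2 * j - 1" using False by simp
      then have "Re (cnj a * a) \<noteq> 0" "Re (cnj b * b) \<noteq> 0" "Re (cnj a * b) = 0"
        using alpha_orth[of "2 * j - 1" "2 * j - 1"] alpha_orth[of "2 * j" "2 * j"]
          alpha_orth[of "2 * j - 1" "2 * j"] False l by (auto simp: a_def b_def)
      then have n: "(Re a)\<^sup>2 + (Im a)\<^sup>2 \<noteq> 0" "(Re b)\<^sup>2 + (Im b)\<^sup>2 \<noteq> 0" "Re a * Re b + Im a * Im b = 0"
        by (auto simp: power2_eq_square)
      have z: "Re a * Re z + Im a * Im z = 0" "Re b * Re z + Im b * Im z = 0"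
        using o by (auto simp: a_def b_def)
      define D where "D = Re a * Im b - Im a * Re b"
      \<comment> \<open>Lagrange's identity: orthogonal nonzero vectors have a nonzero determinant,
        and Cramer's rule gives \<open>z = 0\<close>.\<close>
      have "D\<^sup>2 = ((Re a)\<^sup>2 + (Im a)\<^sup>2) * ((Re b)\<^sup>2 + (Im b)\<^sup>2) - (Re a * Re b + Im a * Im b)\<^sup>2"
        by (simp add: D_def power2_eq_square algebra_simps)
      then have D: "D \<noteq> 0" using n by auto
      have "D * Re z = Im b * (Re a * Re z + Im a * Im z) - Im a * (Re b * Re z + Im b * Im z)"
        "D * Im z = Re a * (Re b * Re z + Im b * Im z) - Re b * (Re a * Re z + Im a * Im z)"
        by (simp_all add: D_def algebra_simps)
      then have "D * Re z = 0" "D * Im z = 0" by (simp_all only: z)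
      then show ?thesis using D by (simp add: complex_eq_iff)
    qed
    then show ?thesis by (simp add: z_def)
  qed
  show ?thesis
  proof (cases "0 \<le> n")
    case True
    then show ?thesis using nat[of "nat n"] by simp
  next
    case False
    then have "n = - int (nat (- n))" by simp
    then obtain j where "n = - int j" by blast
    then show ?thesis using nat[of j] by (simp add: fc_cnj p)
  qed
qed

lemma fcoef_eq_multiplier:
  assumes "continuous_on UNIV f" "continuous_on UNIV g"
    and "\<And>k. p k = P (freq k)" and "\<And>n. fc l g n = of_real (P n) * fc l f n"
  shows "fcoef l w g k = p k * fcoef l w f k"
  using assms by (simp add: fcoef_fc algebra_simps)

lemma periodic_eqI:
  assumes p: "periodic l f" "periodic l g" and e: "\<And>y. \<bar>y\<bar> \<le> l / 2 \<Longrightarrow> f y = g y"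
  shows "f y = g y"
proof -
  have shift: "h (y + real n * l) = h y" if "periodic l h" for h y n
  proof (induction n)
    case (Suc n)
    have "h (y + real (Suc n) * l) = h ((y + real n * l) + l)" by (simp add: algebra_simps)
    then show ?case using Suc that by (simp add: periodic_def)
  qed auto
  have up: "h (y + of_int n * l) = h y" if h: "periodic l h" for h y n
  proof (cases "0 \<le> n")
    case True then show ?thesis using shift[OF h, of y "nat n"] by simp
  next
    case False
    then show ?thesis using shift[OF h, of "y + of_int n * l" "nat (- n)"] by (simp add: algebra_simps)
  qed
  \<comment> \<open>The multiple of the period nearest to \<open>y\<close>.\<close>
  define n where "n = \<lfloor>y / l + 1 / 2\<rfloor>"
  have "of_int n \<le> y / l + 1 / 2" "y / l + 1 / 2 < of_int n + 1"
    unfolding n_def by linarith+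
  then have "of_int n * l \<le> y + l / 2" "y + l / 2 < of_int n * l + l"
    using l by (auto simp: field_simps)
  then have "\<bar>y - of_int n * l\<bar> \<le> l / 2" by (intro abs_leI) linarith+
  then have "\<bar>y + of_int (- n) * l\<bar> \<le> l / 2" by simp
  from e[OF this] show ?thesis using up[OF p(1), of y "- n"] up[OF p(2), of y "- n"] by simp
qed

text \<open>Completeness of the basis gives zero almost everywhere; continuity turns this into zero
  on the closed cell, through the integral of the square, and periodicity extends it to the
  line.\<close>

lemma fcoef_complete:
  assumes h: "continuous_on UNIV h" "periodic l h" and z: "\<And>k. fcoef l w h k = 0"
  shows "h y = 0"
proof -
  have "AE y in lebesgue_on (cell l). h y = 0"
    using basis z L2_on_continuous[OF h(1)] unfolding periodic_eigenbasis_def by blast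
  then have "integral\<^sup>L (lebesgue_on (cell l)) (\<lambda>y. (h y)\<^sup>2) = 0"
    by (intro integral_eq_zero_AE) auto
  moreover have c: "continuous_on UNIV (\<lambda>y. (h y)\<^sup>2)" by (intro continuous_intros h)
  ultimately have "integral {- l / 2..l / 2} (\<lambda>y. (h y)\<^sup>2) = 0"
    using cell_integral[OF c, of l] by simp
  then have z: "\<forall>y\<in>{- l / 2..l / 2}. (h y)\<^sup>2 = 0"
    using integral_eq_0_iff[OF continuous_on_subset[OF c subset_UNIV], of "- l / 2" "l / 2"] l by simp
  have z': "h y = 0" if "\<bar>y\<bar> \<le> l / 2" for y
  proof -
    have "y \<in> {- l / 2..l / 2}" using that by (auto simp: abs_le_iff)
    then show ?thesis using z by auto
  qed
  show ?thesis
    by (rule periodic_eqI[OF h(2), of "\<lambda>y. 0"]) (auto simp: periodic_def z')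
qed

lemma fc_complete:
  assumes "continuous_on UNIV f" "periodic l f" "continuous_on UNIV g" "periodic l g"
    and "\<And>n. fc l f n = fc l g n"
  shows "f y = g y"
proof -
  have c: "continuous_on UNIV (\<lambda>y. f y - g y)" by (intro continuous_intros assms)
  have "f y - g y = 0"
    by (rule fcoef_complete[OF c])
      (use assms in \<open>auto simp: periodic_def fcoef_fc[OF c] fc_diff\<close>)
  then show ?thesis by simp
qed

lemma fser_fc:
  assumes "continuous_on UNIV f" "periodic l f" "dec 2 r (fc l f)"
  shows "fser l (fc l f) y = f y"
  using assms l
  by (intro fc_complete continuous_fser fser_periodic fc_fser) (auto simp: csym_def fc_cnj)

text \<open>Bessel's inequality for the single function \<open>w k\<close>: the square of the defect
  is at most the squared distance from \<open>g\<close> to the partial sums with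
  \<open>n > k\<close>, and that distance tends to zero.\<close>

lemma fcoef_of_multiplier:
  assumes f: "continuous_on UNIV f" and g: "continuous_on UNIV g"
    and m: "maps_multiplier l w p f g"
  shows "fcoef l w g k = p k * fcoef l w f k"
proof -
  define S where "S n y = (\<Sum>k<n. p k * fcoef l w f k * w k y)" for n y
  define t where "t = fcoef l w g k - p k * fcoef l w f k"
  let ?I = "integral {- l / 2..l / 2}"
  note ci = continuous_intros continuous_on_subset[OF g, OF subset_UNIV] continuous_w
  have cS: "continuous_on X (S n)" for X n unfolding S_def by (intro ci)
  have "t\<^sup>2 \<le> integral\<^sup>L (lebesgue_on (cell l)) (\<lambda>y. (g y - S n y)\<^sup>2)" if "n > k" for n
  proof -
    let ?h = "\<lambda>y. g y - S n y"
    have int: "(\<lambda>y. ?h y * w k y) integrable_on {- l / 2..l / 2}" "(\<lambda>y. (?h y)\<^sup>2) integrable_on {- l / 2..l / 2}"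
      "(\<lambda>y. w k y * w k y) integrable_on {- l / 2..l / 2}"
      by (intro integrable_continuous_real ci cS)+
    have hw: "?I (\<lambda>y. ?h y * w k y) = t"
    proof -
      have "?I (\<lambda>y. ?h y * w k y) = ?I (\<lambda>y. g y * w k y - (\<Sum>j<n. p j * fcoef l w f j * (w j y * w k y)))"
        by (rule integral_cong) (simp add: S_def left_diff_distrib sum_distrib_right mult.assoc)
      also have "\<dots> = ?I (\<lambda>y. g y * w k y) - ?I (\<lambda>y. \<Sum>j<n. p j * fcoef l w f j * (w j y * w k y))"
        by (intro Henstock_Kurzweil_Integration.integral_diff integrable_continuous_real ci)
      also have "?I (\<lambda>y. \<Sum>j<n. p j * fcoef l w f j * (w j y * w k y)) =
          (\<Sum>j<n. ?I (\<lambda>y. p j * fcoef l w f j * (w j y * w k y)))"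
        by (intro Henstock_Kurzweil_Integration.integral_sum integrable_continuous_real ci) auto
      also have "\<dots> = (\<Sum>j<n. p j * fcoef l w f j * fcoef l w (w j) k)"
        by (simp add: fcoef_integral[OF continuous_w continuous_w])
      also have "\<dots> = p k * fcoef l w f k"
        using that by (simp add: orth if_distrib sum.delta cong: if_cong)
      finally show ?thesis by (simp add: t_def fcoef_integral[OF g continuous_w])
    qed
    have ww: "?I (\<lambda>y. w k y * w k y) = 1"
      using orth[of k k] by (simp add: fcoef_integral[OF continuous_w continuous_w])
    \<comment> \<open>The error minus its projection onto \<open>w k\<close>; expanding the square
      leaves the error minus \<open>t\<^sup>2\<close>.\<close>
    have "0 \<le> ?I (\<lambda>y. (?h y - t * w k y)\<^sup>2)"
      by (intro Henstock_Kurzweil_Integration.integral_nonneg integrable_continuous_real ci cS) auto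
    also have "\<dots> = ?I (\<lambda>y. (?h y)\<^sup>2 - 2 * t * (?h y * w k y) + t\<^sup>2 * (w k y * w k y))"
      by (rule integral_cong) (simp add: power2_eq_square algebra_simps)
    also have "\<dots> = ?I (\<lambda>y. (?h y)\<^sup>2) - 2 * t * ?I (\<lambda>y. ?h y * w k y) + t\<^sup>2 * ?I (\<lambda>y. w k y * w k y)"
      by (subst Henstock_Kurzweil_Integration.integral_add
          Henstock_Kurzweil_Integration.integral_diff; (intro integrable_continuous_real ci cS)?)+ simp
    also have "\<dots> = ?I (\<lambda>y. (?h y)\<^sup>2) - t\<^sup>2"
      unfolding hw ww by (simp add: power2_eq_square)
    finally show ?thesis
      by (subst cell_integral) (intro ci cS, simp)
  qed
  moreover have "(\<lambda>n. integral\<^sup>L (lebesgue_on (cell l)) (\<lambda>y. (g y - S n y)\<^sup>2)) \<longlonglongrightarrow> 0"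
    using m unfolding maps_multiplier_def S_def by blast
  ultimately have "t\<^sup>2 \<le> 0"
    by (intro LIMSEQ_le_const[of _ 0 "t\<^sup>2"]) (auto intro!: exI[of _ "Suc k"])
  then show ?thesis by (simp add: t_def)
qed

text \<open>Decay of order two makes the eigenfunction series converge uniformly. Its sum has the
  coefficients of \<open>g\<close>, hence equals \<open>g\<close> by completeness, and uniform
  convergence on the cell implies convergence in mean square.\<close>

lemma multiplier_of_fcoef:
  assumes f: "continuous_on UNIV f" and g: "continuous_on UNIV g" "periodic l g"
    and d: "dec 2 r (fc l g)" and e: "\<And>k. fcoef l w g k = p k * fcoef l w f k"
  shows "maps_multiplier l w p f g"
proof -
  define S where "S n y = (\<Sum>k<n. fcoef l w g k * w k y)" for n y
  have r: "0 \<le> r" by (rule dec_nonneg[OF d])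
  have term_bound: "norm (fcoef l w g k * w k y) \<le> 8 * r * (1 / (1 + real k) ^ 2)" for k y
  proof -
    have "\<bar>fcoef l w g k\<bar> \<le> 2 * l * (norm (\<alpha> k) * norm (fc l g (freq k)))"
      using abs_Re_le_cmod[of "cnj (\<alpha> k) * fc l g (freq k)"] l
      by (simp add: fcoef_fc[OF g(1)] abs_mult norm_mult del: times_complex.sel)
    moreover have "\<bar>w k y\<bar> \<le> 2 * norm (\<alpha> k)"
      unfolding form using abs_Re_fe[of "\<alpha> k" l "freq k" y] by (simp add: abs_mult)
    ultimately have "\<bar>fcoef l w g k * w k y\<bar> \<le>
        (2 * l * (norm (\<alpha> k) * norm (fc l g (freq k)))) * (2 * norm (\<alpha> k))"
      unfolding abs_mult using l by (intro mult_mono) auto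
    also have "\<dots> = 2 * (2 * l * (norm (\<alpha> k))\<^sup>2) * norm (fc l g (freq k))"
      by (simp add: power2_eq_square)
    also have "\<dots> \<le> 2 * 1 * (r / nu (freq k) ^ 2)"
      using alpha_bound[of k] decD[OF d, of "freq k"] l by (intro mult_mono) auto
    \<comment> \<open>Two indices share a frequency, so the frequency is at least half the
      index.\<close>
    also have "\<dots> \<le> 2 * (r / ((1 + real k) / 2) ^ 2)"
    proof -
      have "real k \<le> 2 * real ((k + 1) div 2)" by linarith
      then have "(1 + real k) / 2 \<le> nu (freq k)" by (simp add: nu_def freq_def)
      then have "((1 + real k) / 2) ^ 2 \<le> nu (freq k) ^ 2" by (intro power_mono) auto
      then show ?thesis using r by (simp add: divide_left_mono)
    qed
    also have "\<dots> = 8 * r * (1 / (1 + real k) ^ 2)" by (simp add: power_divide)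
    finally show ?thesis by simp
  qed
  have "summable (\<lambda>k::nat. 1 / (1 + real k) ^ 2)"
    using summable_Suc_iff[THEN iffD2, OF inverse_power_summable[of 2, where ?'a=real]]
    by (simp add: inverse_eq_divide add.commute)
  then have sm: "summable (\<lambda>k. 8 * r * (1 / (1 + real k) ^ 2))" by (rule summable_mult)
  define G where "G y = (\<Sum>k. fcoef l w g k * w k y)" for y
  have uG: "uniform_limit X S G sequentially" for X
    unfolding S_def[abs_def] G_def[abs_def] by (rule Weierstrass_m_test[OF term_bound sm])
  have cS: "continuous_on X (S n)" for X n
    unfolding S_def by (intro continuous_intros continuous_w)
  have cG: "continuous_on UNIV G"
    by (rule uniform_limit_theorem[OF _ uG]) (auto simp: cS)
  have pG: "periodic l G"
    using basis unfolding periodic_eigenbasis_def periodic_def G_def by simp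
  have coef_G: "fcoef l w G k = fcoef l w g k" for k
  proof -
    have "bounded (w k ` {- l / 2..l / 2})"
      by (intro compact_imp_bounded compact_continuous_image continuous_w) auto
    moreover have "bounded (G ` {- l / 2..l / 2})"
      by (intro compact_imp_bounded compact_continuous_image continuous_on_subset[OF cG]) auto
    ultimately have u: "uniform_limit (cbox (- l / 2) (l / 2)) (\<lambda>n y. S n y * w k y) (\<lambda>y. G y * w k y) sequentially"
      by (intro uniform_lim_mult uG uniform_limit_const) auto
    have c: "continuous_on (cbox (- l / 2) (l / 2)) (\<lambda>y. S n y * w k y)" for n
      by (intro continuous_intros cS continuous_w)
    obtain I J where IJ: "\<And>n. ((\<lambda>y. S n y * w k y) has_integral I n) (cbox (- l / 2) (l / 2))"
      "((\<lambda>y. G y * w k y) has_integral J) (cbox (- l / 2) (l / 2))" "I \<longlonglongrightarrow> J"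
      using uniform_limit_integral_cbox[OF u c sequentially_bot] by blast
    have "I n = fcoef l w g k" if "n > k" for n
    proof -
      have "I n = integral {- l / 2..l / 2} (\<lambda>y. \<Sum>j<n. fcoef l w g j * (w j y * w k y))"
        using IJ(1)[of n] by (intro integral_unique[symmetric]) (simp add: S_def sum_distrib_right mult.assoc)
      also have "\<dots> = (\<Sum>j<n. fcoef l w g j * fcoef l w (w j) k)"
        by (subst Henstock_Kurzweil_Integration.integral_sum)
          (auto intro!: integrable_continuous_real continuous_intros continuous_w
            simp: fcoef_integral[OF continuous_w continuous_w])
      also have "\<dots> = fcoef l w g k"
        using that by (simp add: orth if_distrib sum.delta cong: if_cong)
      finally show ?thesis .
    qed
    then have "I \<longlonglongrightarrow> fcoef l w g k"
      by (intro tendsto_eventually eventually_sequentiallyI[of "Suc k"]) auto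
    then have "J = fcoef l w g k" using IJ(3) LIMSEQ_unique by blast
    then show ?thesis
      using IJ(2) by (simp add: fcoef_integral[OF cG continuous_w] integral_unique)
  qed
  have "G y - g y = 0" for y
  proof (rule fcoef_complete[where h="\<lambda>y. G y - g y"])
    show c: "continuous_on UNIV (\<lambda>y. G y - g y)" by (intro continuous_intros cG g)
    show "periodic l (\<lambda>y. G y - g y)" using pG g by (simp add: periodic_def)
    show "fcoef l w (\<lambda>y. G y - g y) k = 0" for k
      using coef_G[of k] by (simp add: fcoef_fc[OF c] fcoef_fc[OF cG] fcoef_fc[OF g(1)] fc_diff[OF cG g(1)]
          algebra_simps)
  qed
  then have Gg: "G = g" by (simp add: fun_eq_iff)
  have u: "uniform_limit (cbox (- l / 2) (l / 2)) (\<lambda>n y. (g y - S n y) * (g y - S n y)) (\<lambda>y. (g y - g y) * (g y - g y)) sequentially"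
  proof -
    have "uniform_limit (cbox (- l / 2) (l / 2)) (\<lambda>n y. g y - S n y) (\<lambda>y. g y - g y) sequentially"
      using uG[of "cbox (- l / 2) (l / 2)"] unfolding Gg uniform_limit_iff
      by (simp add: dist_real_def abs_minus_commute)
    from uniform_lim_mult[OF this this] show ?thesis by (simp add: image_constant_conv)
  qed
  have c: "continuous_on (cbox (- l / 2) (l / 2)) (\<lambda>y. (g y - S n y) * (g y - S n y))" for n
    by (intro continuous_intros cS continuous_on_subset[OF g(1)]) auto
  obtain I J where IJ: "\<And>n. ((\<lambda>y. (g y - S n y) * (g y - S n y)) has_integral I n) (cbox (- l / 2) (l / 2))"
    "((\<lambda>y. (g y - g y) * (g y - g y)) has_integral J) (cbox (- l / 2) (l / 2))" "I \<longlonglongrightarrow> J"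
    using uniform_limit_integral_cbox[OF u c sequentially_bot] by blast
  have "J = 0" using IJ(2) has_integral_unique[OF _ has_integral_0] by fastforce
  moreover have "integral\<^sup>L (lebesgue_on (cell l)) (\<lambda>y. (g y - (\<Sum>k<n. p k * fcoef l w f k * w k y))\<^sup>2) = I n" for n
  proof -
    have "continuous_on UNIV (\<lambda>y. (g y - S n y)\<^sup>2)" by (intro continuous_intros g cS)
    then have "integral\<^sup>L (lebesgue_on (cell l)) (\<lambda>y. (g y - S n y)\<^sup>2) = I n"
      using integral_unique[OF IJ(1)[of n]] cell_integral[of "\<lambda>y. (g y - S n y)\<^sup>2" l]
      by (simp add: power2_eq_square)
    then show ?thesis by (simp add: S_def e)
  qed
  ultimately show ?thesis
    using IJ(3) L2_on_continuous[OF f] L2_on_continuous[OF g(1)] by (simp add: maps_multiplier_def)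
qed

end

lemma eigenbasis_exists:
  assumes "0 < l" "periodic_eigenbasis l w" shows "\<exists>\<alpha>. eigenbasis l w \<alpha>"
proof -
  have "\<forall>k. \<exists>a. (\<forall>y. w k y = 2 * Re (a * fe l (freq k) y)) \<and> (k = 0 \<longrightarrow> Im a = 0)"
    using eigenfunction_form[OF assms] by blast
  then obtain \<alpha> where "\<And>k. (\<forall>y. w k y = 2 * Re (\<alpha> k * fe l (freq k) y)) \<and> (k = 0 \<longrightarrow> Im (\<alpha> k) = 0)"
    by metis
  then have "eigenbasis l w \<alpha>" using assms by unfold_locales auto
  then show ?thesis by blast
qed

section \<open>Classical solutions and their Fourier coefficients\<close>

lemma cont_strip_space: "cont_strip T g \<Longrightarrow> t \<in> {0..T} \<Longrightarrow> continuous_on UNIV (g t)"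
  unfolding cont_strip_def
  by (drule continuous_on_compose2[where f="\<lambda>y. (t, y)" and s=UNIV])
    (auto intro!: continuous_intros)

lemma cont_strip_compact:
  "cont_strip T g \<Longrightarrow> continuous_on ({0..T} \<times> {a..b}) (\<lambda>p. g (fst p) (snd p))"
  unfolding cont_strip_def by (simp add: case_prod_beta) (erule continuous_on_subset, auto)

lemma strip_bounded:
  assumes "cont_strip T g"
  obtains M where "\<And>t y. t \<in> {0..T} \<Longrightarrow> y \<in> {a..b} \<Longrightarrow> \<bar>g t y\<bar> \<le> M"
proof -
  have "bounded ((\<lambda>p. g (fst p) (snd p)) ` ({0..T} \<times> {a..b}))"
    by (intro compact_imp_bounded compact_continuous_image cont_strip_compact[OF assms] compact_Times) auto
  then obtain M where "\<And>p. p \<in> {0..T} \<times> {a..b} \<Longrightarrow> norm (g (fst p) (snd p)) \<le> M"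
    unfolding bounded_iff by blast
  from this[of "(_, _)"] show thesis by (intro that) auto
qed

lemma strip_equicont:
  assumes "cont_strip T g" "0 < \<eta>"
  shows "\<exists>\<delta>>0. \<forall>s\<in>{0..T}. \<forall>t\<in>{0..T}. \<bar>s - t\<bar> \<le> \<delta> \<longrightarrow> (\<forall>y\<in>{a..b}. \<bar>g s y - g t y\<bar> \<le> \<eta>)"
proof -
  have "uniformly_continuous_on ({0..T} \<times> {a..b}) (\<lambda>p. g (fst p) (snd p))"
    by (intro compact_uniformly_continuous cont_strip_compact[OF assms(1)] compact_Times) auto
  then obtain d where d: "d > 0" "\<And>p q. p \<in> {0..T} \<times> {a..b} \<Longrightarrow> q \<in> {0..T} \<times> {a..b} \<Longrightarrow>
      dist q p < d \<Longrightarrow> dist (g (fst q) (snd q)) (g (fst p) (snd p)) < \<eta>"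
    unfolding uniformly_continuous_on_def using assms(2) by metis
  show ?thesis
  proof (intro exI[of _ "d / 2"] conjI ballI impI)
    fix s t y assume "s \<in> {0..T}" "t \<in> {0..T}" "\<bar>s - t\<bar> \<le> d / 2" "y \<in> {a..b}"
    then show "\<bar>g s y - g t y\<bar> \<le> \<eta>"
      using d(2)[of "(t, y)" "(s, y)"] d(1) by (simp add: dist_Pair_Pair dist_real_def)
  qed (use d in auto)
qed

lemma classical_derivsD:
  assumes "classical_derivs k T f ft D"
  shows "D 0 = f" "cont_strip T ft" "j \<le> k \<Longrightarrow> cont_strip T (D j)" "cont_strip T f"
    and "t \<in> {0..T} \<Longrightarrow> ((\<lambda>s. f s y) has_real_derivative ft t y) (at t within {0..T})"
    and "t \<in> {0..T} \<Longrightarrow> j < k \<Longrightarrow> (D j t has_real_derivative D (Suc j) t y) (at y)"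
  using assms unfolding classical_derivs_def by blast+

lemma periodic_deriv:
  assumes "periodic l f" "\<And>y. (f has_real_derivative f' y) (at y)"
  shows "periodic l f'"
  unfolding periodic_def
proof
  fix y
  have "((\<lambda>x. f (x + l)) has_real_derivative f' (y + l)) (at y)"
    using assms(2)[of "y + l"] by (simp add: DERIV_shift)
  then have "(f has_real_derivative f' (y + l)) (at y)"
    using assms(1) by (simp add: periodic_def)
  then show "f' (y + l) = f' y" using assms(2) by (rule DERIV_unique)
qed

lemma has_vector_derivative_fc:
  assumes ft: "cont_strip T ft" and t: "t \<in> {0..T}"
    and d: "\<And>t y. t \<in> {0..T} \<Longrightarrow> ((\<lambda>s. f s y) has_real_derivative ft t y) (at t within {0..T})"
    and c: "\<And>t. t \<in> {0..T} \<Longrightarrow> continuous_on UNIV (f t)"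
  shows "((\<lambda>t. fc l (f t) n) has_vector_derivative fc l (ft t) n) (at t within {0..T})"
proof -
  have "((\<lambda>t. integral (cbox (- l / 2) (l / 2)) (\<lambda>y. of_real (f t y) * fe l (- n) y)) has_vector_derivative
      integral (cbox (- l / 2) (l / 2)) (\<lambda>y. of_real (ft t y) * fe l (- n) y)) (at t within {0..T})"
  proof (rule leibniz_rule_vector_derivative[OF _ _ _ t])
    fix t y assume "t \<in> {0..T}"
    then show "((\<lambda>t. complex_of_real (f t y) * fe l (- n) y) has_vector_derivative
        of_real (ft t y) * fe l (- n) y) (at t within {0..T})"
      by (intro has_vector_derivative_mult_left has_vector_derivative_of_real d)
  next
    fix t assume "t \<in> {0..T}"
    from fc_integrable[OF c[OF this]]
    show "(\<lambda>y. complex_of_real (f t y) * fe l (- n) y) integrable_on cbox (- l / 2) (l / 2)" by simp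
  next
    have "continuous_on ({0..T} \<times> {- l / 2..l / 2})
        (\<lambda>p. complex_of_real (ft (fst p) (snd p)) * fe l (- n) (snd p))"
      by (intro continuous_intros cont_strip_compact[OF ft])
    then show "continuous_on ({0..T} \<times> cbox (- l / 2) (l / 2))
        (\<lambda>(t, y). complex_of_real (ft t y) * fe l (- n) y)"
      by (simp add: case_prod_beta)
  qed auto
  from has_vector_derivative_divide[OF this, of "of_real l"] show ?thesis
    by (simp add: fc_def)
qed

text \<open>A derivative does not see the zero frequency; there the bound \<open>M0\<close> on the
  coefficient itself steps in.\<close>

lemma dec_of_derivative:
  assumes \<kappa>: "0 < \<kappa>" and c: "norm c \<le> M0" "norm ((\<i> * of_real (\<kappa> * real_of_int n)) ^ k * c) \<le> M"
  shows "norm c \<le> 2 ^ k * (M0 + M / \<kappa> ^ k) / nu n ^ k"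
proof -
  have "nu n ^ k \<le> (2 * max 1 \<bar>real_of_int n\<bar>) ^ k"
    by (intro power_mono) (auto simp: nu_def)
  also have "\<dots> \<le> 2 ^ k * (1 + \<bar>real_of_int n\<bar> ^ k)"
    by (auto simp: power_mult_distrib max_def)
  finally have "nu n ^ k * norm c \<le> 2 ^ k * (1 + \<bar>real_of_int n\<bar> ^ k) * norm c"
    by (intro mult_right_mono) auto
  also have "\<dots> = 2 ^ k * (norm c + \<bar>real_of_int n\<bar> ^ k * norm c)"
    by (simp add: algebra_simps)
  also have "\<bar>real_of_int n\<bar> ^ k * norm c \<le> M / \<kappa> ^ k"
    using c(2) \<kappa> by (simp add: norm_mult norm_power abs_mult power_mult_distrib field_simps)
  finally have "nu n ^ k * norm c \<le> 2 ^ k * (M0 + M / \<kappa> ^ k)"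
    using c(1) by (auto intro: order_trans mult_left_mono)
  then show ?thesis by (simp add: field_simps)
qed

text \<open>The even indices \<open>2 j\<close> of the given basis represent all frequencies.\<close>

definition at_freq :: "(nat \<Rightarrow> real) \<Rightarrow> int \<Rightarrow> real" where
  "at_freq p n = p (2 * nat \<bar>n\<bar>)"

lemma at_freq_eigval: "eigval l (2 * nat \<bar>n\<bar>) = (2 * pi / l * real_of_int n)\<^sup>2"
  unfolding eigval_freq by (simp add: power_mult_distrib power_divide)

lemma eigval_at_freq: "eigval l k = eigval l (2 * nat \<bar>freq k\<bar>)"
  unfolding at_freq_eigval by (simp add: eigval_freq)

lemma Asym_freq: "Asym U \<gamma> l k = at_freq (Asym U \<gamma> l) (freq k)"
  by (simp only: at_freq_def Asym_def Xsym_def eigval_at_freq[of l k])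

lemma Msym_freq: "Msym U \<gamma> l k = at_freq (Msym U \<gamma> l) (freq k)"
  by (simp only: at_freq_def Msym_def Xsym_def eigval_at_freq[of l k])

lemma at_freq_uminus: "at_freq p (- n) = at_freq p n"
  by (simp add: at_freq_def)

context eigenbasis
begin

definition kap :: real where "kap = 2 * pi / l"

lemma kap_pos: "0 < kap"
  using l by (simp add: kap_def)

lemma classical_periodic:
  assumes c: "classical_derivs k T f ft D" and p: "\<And>t. t \<in> {0..T} \<Longrightarrow> periodic l (f t)"
    and t: "t \<in> {0..T}"
  shows "j \<le> k \<Longrightarrow> periodic l (D j t)"
proof (induction j)
  case 0 then show ?case using p[OF t] by (simp add: classical_derivsD(1)[OF c])
next
  case (Suc j)
  show ?case
  proof (rule periodic_deriv)
    show "periodic l (D j t)" using Suc by simp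
    show "(D j t has_real_derivative D (Suc j) t y) (at y)" for y
      using Suc.prems by (intro classical_derivsD(6)[OF c t]) simp
  qed
qed

lemma classical_fc:
  assumes c: "classical_derivs k T f ft D" and p: "\<And>t. t \<in> {0..T} \<Longrightarrow> periodic l (f t)"
    and t: "t \<in> {0..T}"
  shows "j \<le> k \<Longrightarrow> fc l (D j t) n = (\<i> * of_real (kap * real_of_int n)) ^ j * fc l (f t) n"
proof (induction j)
  case 0 then show ?case by (simp add: classical_derivsD(1)[OF c])
next
  case (Suc j)
  have "fc l (D (Suc j) t) n = \<i> * of_real (2 * pi / l * real_of_int n) * fc l (D j t) n"
  proof (rule fc_deriv[OF l classical_periodic[OF c p t]])
    show "continuous_on UNIV (D (Suc j) t)"
      by (rule cont_strip_space[OF classical_derivsD(3)[OF c Suc.prems] t])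
    show "(D j t has_real_derivative D (Suc j) t y) (at y)" for y
      using Suc.prems by (intro classical_derivsD(6)[OF c t]) simp
  qed (use Suc.prems in auto)
  then show ?case using Suc by (simp add: kap_def)
qed

lemma classical_ode:
  assumes c: "classical_derivs k T f ft D" and t: "t \<in> {0..T}"
  shows "((\<lambda>t. fc l (f t) n) has_vector_derivative fc l (ft t) n) (at t within {0..T})"
  by (rule has_vector_derivative_fc[OF classical_derivsD(2)[OF c] t classical_derivsD(5)[OF c]
        cont_strip_space[OF classical_derivsD(4)[OF c]]])

lemma classical_dec:
  assumes c: "classical_derivs k T f ft D" and p: "\<And>t. t \<in> {0..T} \<Longrightarrow> periodic l (f t)"
  shows "\<exists>r. \<forall>t\<in>{0..T}. dec k r (fc l (f t))"
proof -
  have strip: "cont_strip T (D 0)" "cont_strip T (D k)" by (rule classical_derivsD(3)[OF c], simp)+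
  obtain M0 where M0: "\<And>t y. t \<in> {0..T} \<Longrightarrow> y \<in> {- l / 2..l / 2} \<Longrightarrow> \<bar>D 0 t y\<bar> \<le> M0"
    using strip_bounded[OF strip(1)] by blast
  obtain M where M: "\<And>t y. t \<in> {0..T} \<Longrightarrow> y \<in> {- l / 2..l / 2} \<Longrightarrow> \<bar>D k t y\<bar> \<le> M"
    using strip_bounded[OF strip(2)] by blast
  have f: "f = D 0" by (rule classical_derivsD(1)[OF c, symmetric])
  show ?thesis
  proof (intro exI ballI)
    fix t assume t: "t \<in> {0..T}"
    show "dec k (2 ^ k * (M0 + M / kap ^ k)) (fc l (f t))"
      unfolding dec_def
    proof (intro allI dec_of_derivative kap_pos)
      fix n
      show "norm (fc l (f t) n) \<le> M0"
        unfolding f by (rule fc_bound[OF l cont_strip_space[OF strip(1) t]]) (rule M0[OF t])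
      have "norm (fc l (D k t) n) \<le> M"
        by (rule fc_bound[OF l cont_strip_space[OF strip(2) t]]) (rule M[OF t])
      then show "norm ((\<i> * of_real (kap * real_of_int n)) ^ k * fc l (f t) n) \<le> M"
        using classical_fc[OF c p t order_refl, of n] by simp
    qed
  qed
qed

text \<open>The function and its third space derivative are uniformly continuous on the compact
  product of time interval and cell; \<open>dec_of_derivative\<close> converts both into weighted
  smallness of the coefficients.\<close>

lemma classical_equicont:
  assumes c: "classical_derivs 3 T f ft D" and p: "\<And>t. t \<in> {0..T} \<Longrightarrow> periodic l (f t)"
  shows "equicont T (\<lambda>n t. fc l (f t) n)"
  unfolding equicont_def
proof (intro allI impI)
  fix \<eta> :: real assume \<eta>: "0 < \<eta>"
  have strip: "cont_strip T (D 0)" "cont_strip T (D 3)" by (rule classical_derivsD(3)[OF c], simp)+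
  have f: "f = D 0" by (rule classical_derivsD(1)[OF c, symmetric])
  \<comment> \<open>Chosen so that the constant of \<open>dec_of_derivative\<close>, with \<eta>' in
    place of both bounds, returns \<eta>.\<close>
  define \<eta>' where "\<eta>' = \<eta> / (2 ^ 3 * (1 + 1 / kap ^ 3))"
  have pos: "0 < 2 ^ 3 * (1 + 1 / kap ^ 3)" using kap_pos by (simp add: add_pos_pos)
  then have \<eta>': "0 < \<eta>'" using \<eta> by (simp add: \<eta>'_def)
  obtain \<delta>1 where \<delta>1: "\<delta>1 > 0" "\<And>s t y. s \<in> {0..T} \<Longrightarrow> t \<in> {0..T} \<Longrightarrow> \<bar>s - t\<bar> \<le> \<delta>1 \<Longrightarrow>
      y \<in> {- l / 2..l / 2} \<Longrightarrow> \<bar>D 0 s y - D 0 t y\<bar> \<le> \<eta>'"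
    using strip_equicont[OF strip(1) \<eta>'] by blast
  obtain \<delta>2 where \<delta>2: "\<delta>2 > 0" "\<And>s t y. s \<in> {0..T} \<Longrightarrow> t \<in> {0..T} \<Longrightarrow> \<bar>s - t\<bar> \<le> \<delta>2 \<Longrightarrow>
      y \<in> {- l / 2..l / 2} \<Longrightarrow> \<bar>D 3 s y - D 3 t y\<bar> \<le> \<eta>'"
    using strip_equicont[OF strip(2) \<eta>'] by blast
  show "\<exists>\<delta>>0. \<forall>s\<in>{0..T}. \<forall>t\<in>{0..T}. \<bar>s - t\<bar> \<le> \<delta> \<longrightarrow> dec 3 \<eta> (\<lambda>n. fc l (f s) n - fc l (f t) n)"
  proof (intro exI[of _ "min \<delta>1 \<delta>2"] conjI ballI impI)
    fix s t assume s: "s \<in> {0..T}" and t: "t \<in> {0..T}" and st: "\<bar>s - t\<bar> \<le> min \<delta>1 \<delta>2"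
    note cs = cont_strip_space[OF strip(1) s] cont_strip_space[OF strip(1) t]
      cont_strip_space[OF strip(2) s] cont_strip_space[OF strip(2) t]
    have "dec 3 (2 ^ 3 * (\<eta>' + \<eta>' / kap ^ 3)) (\<lambda>n. fc l (f s) n - fc l (f t) n)"
      unfolding dec_def
    proof (intro allI dec_of_derivative kap_pos)
      fix n
      have "norm (fc l (\<lambda>y. D 0 s y - D 0 t y) n) \<le> \<eta>'"
        proof (rule fc_bound[OF l])
          show "\<bar>D 0 s y - D 0 t y\<bar> \<le> \<eta>'" if "y \<in> {- l / 2..l / 2}" for y
            using st by (intro \<delta>1(2)[OF s t _ that]) simp
        qed (intro continuous_intros cs)
      then show "norm (fc l (f s) n - fc l (f t) n) \<le> \<eta>'"
        by (simp add: fc_diff cs f)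
      have "norm (fc l (\<lambda>y. D 3 s y - D 3 t y) n) \<le> \<eta>'"
        proof (rule fc_bound[OF l])
          show "\<bar>D 3 s y - D 3 t y\<bar> \<le> \<eta>'" if "y \<in> {- l / 2..l / 2}" for y
            using st by (intro \<delta>2(2)[OF s t _ that]) simp
        qed (intro continuous_intros cs)
      then show "norm ((\<i> * of_real (kap * real_of_int n)) ^ 3 * (fc l (f s) n - fc l (f t) n)) \<le> \<eta>'"
        using classical_fc[OF c p s order_refl, of n] classical_fc[OF c p t order_refl, of n]
        by (simp add: fc_diff cs right_diff_distrib)
    qed
    moreover have "2 ^ 3 * (\<eta>' + \<eta>' / kap ^ 3) = \<eta>' * (2 ^ 3 * (1 + 1 / kap ^ 3))"
      by (simp add: algebra_simps)
    moreover have "\<dots> = \<eta>" using pos by (simp add: \<eta>'_def)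
    ultimately show "dec 3 \<eta> (\<lambda>n. fc l (f s) n - fc l (f t) n)" by simp
  qed (use \<delta>1 \<delta>2 in auto)
qed

text \<open>Order three leaves order two for the derivative, just enough to expand one factor in its
  series and apply the product formula.\<close>

lemma fc_square_deriv:
  assumes p: "periodic l f" and d: "\<And>y. (f has_real_derivative f' y) (at y)"
    and c: "continuous_on UNIV f'" and dec: "dec 3 r (fc l f)"
  shows "fc l (\<lambda>y. (f' y)\<^sup>2) n = Q kap (fc l f) (fc l f) n"
proof -
  have f': "fc l f' n = \<i> * of_real (kap * real_of_int n) * fc l f n" for n
    unfolding kap_def by (rule fc_deriv[OF l p d c])
  have d1: "dec 3 r (fc l f)" by (rule dec)
  have "norm (\<i> * of_real (kap * real_of_int n) :: complex) \<le> kap * nu n ^ 1" for n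
    using abs_le_nu[of n] kap_pos by (simp add: norm_mult abs_mult)
  from dec_mult_growth[OF _ this, of 2 r "fc l f"] dec
  have d2: "dec 2 (kap * r) (fc l f')" by (simp add: f'[abs_def])
  have pf': "periodic l f'" by (rule periodic_deriv[OF p d])
  have "((\<lambda>j. fc l f' j * fc l f' (n - j)) has_sum fc l (\<lambda>y. fser l (fc l f') y * f' y) n) UNIV"
    by (rule fc_product_has_sum[OF l d2 _ c]) (simp add: csym_def fc_cnj)
  moreover have "fc l f' j * fc l f' (n - j) = Qterm kap (fc l f) (fc l f) n j" for j
    by (simp add: f' Qterm_def power2_eq_square algebra_simps)
  ultimately show ?thesis
    by (simp add: Q_def fser_fc[OF c pf' d2] infsumI power2_eq_square)
qed

text \<open>The Kuramoto-Sivashinsky equation is the member \<epsilon> = 0 of the scaled family: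
  there \<open>scaled_X\<close> is 1 and the second symbol is \<open>- 1 / 2\<close>. Four
  continuous space derivatives provide order four as the start of the bootstrap.\<close>

lemma KS_modes:
  assumes KS: "KS_solution l T \<Phi>0 \<Phi>"
  shows "modes_solve kap T (scaled_A kap 0) (\<lambda>n. - 1 / 2) (\<lambda>n t. fc l (\<Phi> t) n)"
    and "\<exists>r. \<forall>t\<in>{0..T}. dec 4 r (fc l (\<Phi> t))"
    and "\<And>t. t \<in> {0..T} \<Longrightarrow> continuous_on UNIV (\<Phi> t)"
    and "\<And>t. t \<in> {0..T} \<Longrightarrow> periodic l (\<Phi> t)"
proof -
  from KS obtain \<Phi>t D where p: "\<And>t. t \<in> {0..T} \<Longrightarrow> periodic l (\<Phi> t)"
    and c: "classical_derivs 4 T \<Phi> \<Phi>t D"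
    and eq: "\<And>t y. t \<in> {0..T} \<Longrightarrow> \<Phi>t t y + 4 * D 4 t y + D 2 t y + 1 / 2 * (D 1 t y)\<^sup>2 = 0"
    unfolding KS_solution_def by blast
  show dec: "\<exists>r. \<forall>t\<in>{0..T}. dec 4 r (fc l (\<Phi> t))" by (rule classical_dec[OF c p])
  then obtain r where r: "\<And>t. t \<in> {0..T} \<Longrightarrow> dec 4 r (fc l (\<Phi> t))" by blast
  have cD: "continuous_on UNIV (D j t)" if "j \<le> 4" "t \<in> {0..T}" for j t
    by (rule cont_strip_space[OF classical_derivsD(3)[OF c that(1)] that(2)])
  have D0: "D 0 = \<Phi>" by (rule classical_derivsD(1)[OF c])
  show "continuous_on UNIV (\<Phi> t)" if "t \<in> {0..T}" for t using cD[of 0, OF _ that] D0 by simp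
  show "periodic l (\<Phi> t)" if "t \<in> {0..T}" for t by (rule p[OF that])
  show "modes_solve kap T (scaled_A kap 0) (\<lambda>n. - 1 / 2) (\<lambda>n t. fc l (\<Phi> t) n)"
    unfolding modes_solve_def
  proof (intro allI ballI)
    fix n t assume t: "t \<in> {0..T}"
    have e1: "fc l (\<lambda>y. (D 1 t y)\<^sup>2) n = Q kap (fc l (\<Phi> t)) (fc l (\<Phi> t)) n"
      using classical_derivsD(6)[OF c t, of 0] D0
      by (intro fc_square_deriv[OF p[OF t] _ cD dec_mono[OF r[OF t]]]) (use t in auto)
    have "fc l (\<Phi>t t) n = fc l (\<lambda>y. (- 4) * D 4 t y + ((- 1) * D 2 t y + (- 1 / 2) * (D 1 t y)\<^sup>2)) n"
    proof (rule fc_cong)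
      fix y
      show "\<Phi>t t y = (- 4) * D 4 t y + ((- 1) * D 2 t y + (- 1 / 2) * (D 1 t y)\<^sup>2)"
        using eq[OF t, of y] by linarith
    qed
    also have "\<dots> = - 4 * fc l (D 4 t) n + (- fc l (D 2 t) n + of_real (- 1 / 2) * fc l (\<lambda>y. (D 1 t y)\<^sup>2) n)"
    proof -
      have c4: "continuous_on UNIV (\<lambda>y. (- 4) * D 4 t y)" and c2: "continuous_on UNIV (\<lambda>y. (- 1) * D 2 t y)"
        and c1: "continuous_on UNIV (\<lambda>y. (- 1 / 2) * (D 1 t y)\<^sup>2)"
        by (intro continuous_intros cD t; simp)+
      show ?thesis
        unfolding fc_add[OF c4 continuous_on_add[OF c2 c1]] fc_add[OF c2 c1] fc_cmult by simp
    qed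
    finally have e2: "fc l (\<Phi>t t) n = - 4 * fc l (D 4 t) n + (- fc l (D 2 t) n + of_real (- 1 / 2) * Q kap (fc l (\<Phi> t)) (fc l (\<Phi> t)) n)"
      unfolding e1 .
    have k: "(\<i> * of_real (kap * real_of_int n)) ^ 4 = complex_of_real ((kap * real_of_int n) ^ 4)"
      "(\<i> * of_real (kap * real_of_int n)) ^ 2 = - complex_of_real ((kap * real_of_int n) ^ 2)"
      by (simp_all add: power_mult_distrib)
    have "scaled_A kap 0 n = - 4 * (kap * real_of_int n) ^ 4 + (kap * real_of_int n)\<^sup>2"
      by (simp add: scaled_A_def scaled_X_def lam_def flip: power_mult)
    then have a: "complex_of_real (scaled_A kap 0 n) =
        - 4 * complex_of_real ((kap * real_of_int n) ^ 4) + complex_of_real ((kap * real_of_int n)\<^sup>2)"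
      by simp
    have d4: "fc l (D 4 t) n = of_real ((kap * real_of_int n) ^ 4) * fc l (\<Phi> t) n"
      unfolding k(1)[symmetric] by (rule classical_fc[OF c p t order_refl])
    have "fc l (D 2 t) n = (\<i> * of_real (kap * real_of_int n)) ^ 2 * fc l (\<Phi> t) n"
      using classical_fc[OF c p t, of 2 n] by simp
    then have d2: "fc l (D 2 t) n = - of_real ((kap * real_of_int n) ^ 2) * fc l (\<Phi> t) n"
      unfolding k(2) .
    have "fc l (\<Phi>t t) n = of_real (scaled_A kap 0 n) * fc l (\<Phi> t) n +
        of_real (- 1 / 2) * Q kap (fc l (\<Phi> t)) (fc l (\<Phi> t)) n"
      unfolding e2 d4 d2 a by (simp add: algebra_simps)
    then show "((\<lambda>t. fc l (\<Phi> t) n) has_vector_derivative of_real (scaled_A kap 0 n) * fc l (\<Phi> t) n +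
        of_real (- 1 / 2) * Q kap (\<lambda>k. fc l (\<Phi> t) k) (\<lambda>k. fc l (\<Phi> t) k) n) (at t within {0..T})"
      using classical_ode[OF c t, of n] by simp
  qed
qed

text \<open>An arbitrary classical solution has only three space derivatives, so order three and
  continuity in time in that weight are all that a competitor offers to the uniqueness
  proof.\<close>

lemma front_modes:
  assumes F: "front_solution l w U \<gamma> T \<phi>0 \<phi>"
  shows "modes_solve kap T (at_freq (Asym U \<gamma> l)) (at_freq (Msym U \<gamma> l)) (\<lambda>n t. fc l (\<phi> t) n)"
    and "equicont T (\<lambda>n t. fc l (\<phi> t) n)"
    and "\<exists>r. \<forall>t\<in>{0..T}. dec 3 r (fc l (\<phi> t))"
    and "fc l (\<phi> 0) n = fc l \<phi>0 n"
    and "\<And>t. t \<in> {0..T} \<Longrightarrow> continuous_on UNIV (\<phi> t)"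
    and "\<And>t. t \<in> {0..T} \<Longrightarrow> periodic l (\<phi> t)"
proof -
  from F obtain \<phi>t D G H where p: "\<And>t. t \<in> {0..T} \<Longrightarrow> periodic l (\<phi> t)"
    and init: "\<And>y. \<bar>y\<bar> \<le> l / 2 \<Longrightarrow> \<phi> 0 y = \<phi>0 y"
    and c: "classical_derivs 3 T \<phi> \<phi>t D" and GH: "cont_strip T G" "cont_strip T H"
    and eq: "\<And>t. t \<in> {0..T} \<Longrightarrow> maps_multiplier l w (Asym U \<gamma> l) (\<phi> t) (G t)"
      "\<And>t. t \<in> {0..T} \<Longrightarrow> maps_multiplier l w (Msym U \<gamma> l) (\<lambda>y. (D 1 t y)\<^sup>2) (H t)"
      "\<And>t y. t \<in> {0..T} \<Longrightarrow> \<phi>t t y = G t y + H t y"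
    unfolding front_solution_def by blast
  show "equicont T (\<lambda>n t. fc l (\<phi> t) n)" by (rule classical_equicont[OF c p])
  show dec: "\<exists>r. \<forall>t\<in>{0..T}. dec 3 r (fc l (\<phi> t))" by (rule classical_dec[OF c p])
  then obtain r where r: "\<And>t. t \<in> {0..T} \<Longrightarrow> dec 3 r (fc l (\<phi> t))" by blast
  show "fc l (\<phi> 0) n = fc l \<phi>0 n" by (rule fc_cong) (rule init)
  have cD: "continuous_on UNIV (D j t)" if "j \<le> 3" "t \<in> {0..T}" for j t
    by (rule cont_strip_space[OF classical_derivsD(3)[OF c that(1)] that(2)])
  have D0: "D 0 = \<phi>" by (rule classical_derivsD(1)[OF c])
  show c\<phi>: "continuous_on UNIV (\<phi> t)" if "t \<in> {0..T}" for t using cD[of 0, OF _ that] D0 by simp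
  show "periodic l (\<phi> t)" if "t \<in> {0..T}" for t by (rule p[OF that])
  show "modes_solve kap T (at_freq (Asym U \<gamma> l)) (at_freq (Msym U \<gamma> l)) (\<lambda>n t. fc l (\<phi> t) n)"
    unfolding modes_solve_def
  proof (intro allI ballI)
    fix n t assume t: "t \<in> {0..T}"
    note cG = cont_strip_space[OF GH(1) t] and cH = cont_strip_space[OF GH(2) t]
    have cD1: "continuous_on UNIV (\<lambda>y. (D 1 t y)\<^sup>2)" by (intro continuous_intros cD t) simp
    have "fc l (\<lambda>y. (D 1 t y)\<^sup>2) n = Q kap (fc l (\<phi> t)) (fc l (\<phi> t)) n"
      using classical_derivsD(6)[OF c t, of 0] D0
      by (intro fc_square_deriv[OF p[OF t] _ cD r[OF t]]) (use t in auto)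
    moreover have "fc l (G t) n = of_real (at_freq (Asym U \<gamma> l) n) * fc l (\<phi> t) n"
      by (rule fc_eq_multiplier[OF c\<phi>[OF t] cG Asym_freq at_freq_uminus fcoef_of_multiplier[OF c\<phi>[OF t] cG eq(1)[OF t]]])
    moreover have "fc l (H t) n = of_real (at_freq (Msym U \<gamma> l) n) * fc l (\<lambda>y. (D 1 t y)\<^sup>2) n"
      by (rule fc_eq_multiplier[OF cD1 cH Msym_freq at_freq_uminus fcoef_of_multiplier[OF cD1 cH eq(2)[OF t]]])
    moreover have "fc l (\<phi>t t) n = fc l (G t) n + fc l (H t) n"
      unfolding fc_add[OF cG cH, symmetric] by (intro fc_cong eq t)
    ultimately show "((\<lambda>t. fc l (\<phi> t) n) has_vector_derivative
        of_real (at_freq (Asym U \<gamma> l) n) * fc l (\<phi> t) n +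
        of_real (at_freq (Msym U \<gamma> l) n) * Q kap (\<lambda>k. fc l (\<phi> t) k) (\<lambda>k. fc l (\<phi> t) k) n) (at t within {0..T})"
      using classical_ode[OF c t, of n] by simp
  qed
qed

text \<open>Order five is spent completely: the first symbol takes three orders, while the quadratic
  term takes one for the derivatives and two for its symbol. The two that remain make every term a
  uniformly convergent series and so continuous.\<close>

lemma front_of_modes:
  assumes ode: "modes_solve kap T (at_freq (Asym U \<gamma> l)) (at_freq (Msym U \<gamma> l)) x"
    and sym: "\<And>t. t \<in> {0..T} \<Longrightarrow> csym (\<lambda>n. x n t)"
    and dec: "\<And>t. t \<in> {0..T} \<Longrightarrow> dec 5 r (\<lambda>n. x n t)"
    and A: "\<And>n. \<bar>at_freq (Asym U \<gamma> l) n\<bar> \<le> cA * nu n ^ 3"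
    and M: "\<And>n. \<bar>at_freq (Msym U \<gamma> l) n\<bar> \<le> cM * nu n ^ 2"
    and init: "\<And>y. \<bar>y\<bar> \<le> l / 2 \<Longrightarrow> fser l (\<lambda>n. x n 0) y = \<phi>0 y"
  shows "front_solution l w U \<gamma> T \<phi>0 (\<lambda>t. fser l (\<lambda>n. x n t))"
proof -
  define a m where "a = at_freq (Asym U \<gamma> l)" and "m = at_freq (Msym U \<gamma> l)"
  define q where "q t = Q kap (\<lambda>k. x k t) (\<lambda>k. x k t)" for t
  define x' where "x' n t = of_real (a n) * x n t + of_real (m n) * q t n" for n t
  define Dc where "Dc j t n = (\<i> * of_real (kap * real_of_int n)) ^ j * x n t" for j t n
  define D where "D j t = fser l (Dc j t)" for j t
  define G where "G t = fser l (\<lambda>n. of_real (a n) * x n t)" for t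
  define H where "H t = fser l (\<lambda>n. of_real (m n) * q t n)" for t
  have x': "(x n has_vector_derivative x' n t) (at t within {0..T})" if "t \<in> {0..T}" for n t
    using ode that unfolding modes_solve_def x'_def a_def m_def q_def by blast
  have cx: "continuous_on {0..T} (x n)" for n
    using x' by (rule continuous_on_vector_derivative)
  have cq: "continuous_on {0..T} (\<lambda>t. q t n)" for n
    unfolding q_def using dec by (intro continuous_on_Q[where q=4] cx) auto
  have dq: "dec 4 (kap\<^sup>2 * cconv 4 * r * r) (q t)" if "t \<in> {0..T}" for t
    unfolding q_def using dec[OF that] by (intro Q_bound) auto
  have dG: "dec 2 (cA * r) (\<lambda>n. of_real (a n) * x n t)" if "t \<in> {0..T}" for t
    using dec[OF that] A by (intro dec_mult_growth[where q=3]) (auto simp: a_def)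
  have dH: "dec 2 (cM * (kap\<^sup>2 * cconv 4 * r * r)) (\<lambda>n. of_real (m n) * q t n)" if "t \<in> {0..T}" for t
    using dq[OF that] M by (intro dec_mult_growth[where q=2]) (auto simp: m_def)
  have dD: "dec (5 - j) (kap ^ j * r) (Dc j t)" if "t \<in> {0..T}" "j \<le> 5" for t j
    unfolding Dc_def
  proof (rule dec_mult_growth[where q=j])
    show "norm ((\<i> * of_real (kap * real_of_int n) :: complex) ^ j) \<le> kap ^ j * nu n ^ j" for n
      using kap_pos by (auto simp: norm_power norm_mult abs_mult power_mult_distrib
          intro!: mult_left_mono power_mono abs_le_nu)
  qed (use dec[OF that(1)] that(2) in auto)
  have sG: "cont_strip T G" unfolding G_def
    by (rule cont_strip_fser[OF _ dG]) (intro continuous_intros cx)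
  have sH: "cont_strip T H" unfolding H_def
    by (rule cont_strip_fser[OF _ dH]) (intro continuous_intros cq)
  have sD: "cont_strip T (D j)" if "j \<le> 3" for j
    unfolding D_def
  proof (rule cont_strip_fser[where c="\<lambda>n t. Dc j t n"])
    show "continuous_on {0..T} (\<lambda>t. Dc j t n)" for n
      unfolding Dc_def by (intro continuous_intros cx)
    show "dec 2 (kap ^ j * r) (\<lambda>n. Dc j t n)" if "t \<in> {0..T}" for t
      by (rule dec_mono[OF dD[OF that]]) (use \<open>j \<le> 3\<close> in auto)
  qed
  have D0: "D 0 = (\<lambda>t. fser l (\<lambda>n. x n t))" by (rule ext) (simp add: D_def Dc_def[abs_def])
  have dsp: "(D j t has_real_derivative D (Suc j) t y) (at y)" if "t \<in> {0..T}" "j < 3" for t j y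
  proof -
    have "dec 3 (kap ^ j * r) (Dc j t)"
      by (rule dec_mono[OF dD[OF that(1)]]) (use that in auto)
    from fser_deriv_space[OF this, of l y] show ?thesis
      unfolding D_def by (simp add: Dc_def[abs_def] kap_def mult.assoc)
  qed
  have GH: "fser l (\<lambda>n. x' n t) y = G t y + H t y" if "t \<in> {0..T}" for t y
    unfolding x'_def G_def H_def by (rule fser_add[OF dG[OF that] dH[OF that]])
  have sx: "cont_strip T (\<lambda>t. fser l (\<lambda>n. x' n t))"
  proof (rule cont_strip_fser)
    show "continuous_on {0..T} (x' n)" for n unfolding x'_def by (intro continuous_intros cx cq)
    show "dec 2 (cA * r + cM * (kap\<^sup>2 * cconv 4 * r * r)) (\<lambda>n. x' n t)" if "t \<in> {0..T}" for t
      unfolding x'_def by (intro dec_add dG dH that)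
  qed
  have dt: "((\<lambda>s. fser l (\<lambda>n. x n s) y) has_real_derivative fser l (\<lambda>n. x' n t) y) (at t within {0..T})"
    if "t \<in> {0..T}" for t y
  proof (rule fser_deriv_time[OF that x'])
    show "dec 2 r (\<lambda>n. x n t)" if "t \<in> {0..T}" for t
      by (rule dec_mono[OF dec[OF that]]) auto
    show "dec 2 (cA * r + cM * (kap\<^sup>2 * cconv 4 * r * r)) (\<lambda>n. x' n t)" if "t \<in> {0..T}" for t
      unfolding x'_def by (intro dec_add dG dH that)
  qed auto
  have classical: "classical_derivs 3 T (\<lambda>t. fser l (\<lambda>n. x n t)) (\<lambda>t. fser l (\<lambda>n. x' n t)) D"
    unfolding classical_derivs_def using D0 sx sD dt dsp by auto
  have per: "periodic l (fser l c)" for c by (rule fser_periodic[OF l])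
  have fcx: "fc l (fser l (\<lambda>n. x n t)) = (\<lambda>n. x n t)" if "t \<in> {0..T}" for t
    by (rule ext, rule fc_fser[OF l dec_mono[OF dec[OF that]] sym[OF that]]) auto
  have mA: "maps_multiplier l w (Asym U \<gamma> l) (fser l (\<lambda>n. x n t)) (G t)" if t: "t \<in> {0..T}" for t
  proof -
    have cf: "continuous_on UNIV (fser l (\<lambda>n. x n t))"
      by (rule continuous_fser[OF dec_mono[OF dec[OF t]]]) auto
    have cG: "continuous_on UNIV (G t)" by (rule cont_strip_space[OF sG t])
    have fG: "fc l (G t) n = of_real (a n) * x n t" for n
      unfolding G_def by (rule fc_fser[OF l dG[OF t]])
        (use sym[OF t] in \<open>simp add: csym_def a_def at_freq_uminus\<close>)
    show ?thesis
    proof (rule multiplier_of_fcoef[OF cf cG])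
      show "periodic l (G t)" unfolding G_def by (rule per)
      show "dec 2 (cA * r) (fc l (G t))" using dG[OF t] by (simp add: fG[abs_def])
      show "fcoef l w (G t) k = Asym U \<gamma> l k * fcoef l w (fser l (\<lambda>n. x n t)) k" for k
        by (rule fcoef_eq_multiplier[OF cf cG, where P="at_freq (Asym U \<gamma> l)"], rule Asym_freq) (simp add: fG fcx[OF t] a_def)
    qed
  qed
  have mM: "maps_multiplier l w (Msym U \<gamma> l) (\<lambda>y. (D 1 t y)\<^sup>2) (H t)" if t: "t \<in> {0..T}" for t
  proof -
    have cD1: "continuous_on UNIV (D 1 t)" by (rule cont_strip_space[OF sD t]) simp
    then have cf: "continuous_on UNIV (\<lambda>y. (D 1 t y)\<^sup>2)" by (intro continuous_intros)
    have cH: "continuous_on UNIV (H t)" by (rule cont_strip_space[OF sH t])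
    have fD: "fc l (\<lambda>y. (D 1 t y)\<^sup>2) n = q t n" for n
    proof -
      have "fc l (\<lambda>y. (D 1 t y)\<^sup>2) n = Q kap (fc l (D 0 t)) (fc l (D 0 t)) n"
      proof (rule fc_square_deriv[OF _ _ cD1])
        show "periodic l (D 0 t)" unfolding D_def by (rule per)
        show "(D 0 t has_real_derivative D 1 t y) (at y)" for y using dsp[OF t, of 0] by simp
        show "dec 3 r (fc l (D 0 t))" unfolding D0 fcx[OF t] by (rule dec_mono[OF dec[OF t]]) auto
      qed
      then show ?thesis unfolding D0 fcx[OF t] by (simp add: q_def)
    qed
    have sq: "csym (q t)"
      unfolding csym_def q_def
    proof
      fix n
      have "(\<lambda>k. cnj (x (- k) t)) = (\<lambda>k. x k t)" using sym[OF t] by (simp add: csym_def)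
      then show "Q kap (\<lambda>k. x k t) (\<lambda>k. x k t) (- n) = cnj (Q kap (\<lambda>k. x k t) (\<lambda>k. x k t) n)"
        using Q_cnj[of kap "\<lambda>k. x k t" "\<lambda>k. x k t" "- n"] by simp
    qed
    have fH: "fc l (H t) n = of_real (m n) * q t n" for n
      unfolding H_def by (rule fc_fser[OF l dH[OF t]])
        (use sq in \<open>simp add: csym_def m_def at_freq_uminus\<close>)
    show ?thesis
    proof (rule multiplier_of_fcoef[OF cf cH])
      show "periodic l (H t)" unfolding H_def by (rule per)
      show "dec 2 (cM * (kap\<^sup>2 * cconv 4 * r * r)) (fc l (H t))" using dH[OF t] by (simp add: fH[abs_def])
      show "fcoef l w (H t) k = Msym U \<gamma> l k * fcoef l w (\<lambda>y. (D 1 t y)\<^sup>2) k" for k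
        by (rule fcoef_eq_multiplier[OF cf cH, where P="at_freq (Msym U \<gamma> l)"], rule Msym_freq) (simp only: fH fD m_def)
    qed
  qed
  have perG: "periodic l (G t)" "periodic l (H t)" for t unfolding G_def H_def by (rule per)+
  show ?thesis
    unfolding front_solution_def
    using classical sG sH mA mM per perG GH init
    by (intro conjI ballI allI impI exI[of _ "\<lambda>t. fser l (\<lambda>n. x' n t)"] exI[of _ D] exI[of _ G] exI[of _ H]) auto
qed

end

section \<open>Smooth cut-off functions and periodic Sobolev data\<close>

definition smooth :: "(real \<Rightarrow> real) \<Rightarrow> bool" where
  "smooth f \<longleftrightarrow> (\<forall>n x. (deriv ^^ n) f field_differentiable at x)"

text \<open>A class of functions closed under differentiation consists of smooth functions; no
  formula for the \<open>n\<close>-th derivative has to be found.\<close>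

lemma smooth_coinduct:
  assumes f: "f \<in> S" and S: "\<And>g. g \<in> S \<Longrightarrow> \<exists>g'\<in>S. \<forall>x. (g has_real_derivative g' x) (at x)"
  shows "smooth f"
proof -
  have "(deriv ^^ n) f \<in> S" for n
  proof (induction n)
    case 0 then show ?case using f by simp
  next
    case (Suc n)
    from S[OF Suc] obtain g' where g': "g' \<in> S" "\<And>x. ((deriv ^^ n) f has_real_derivative g' x) (at x)"
      by blast
    then have "deriv ((deriv ^^ n) f) = g'" by (intro ext DERIV_imp_deriv)
    then show ?case using g'(1) by simp
  qed
  then show ?thesis
    unfolding smooth_def field_differentiable_def using S by blast
qed

lemma smooth_deriv:
  assumes "smooth f"
  shows "(f has_real_derivative deriv f x) (at x)" and "smooth (deriv f)"
proof -
  have "(deriv ^^ 0) f field_differentiable at x" using assms unfolding smooth_def by blast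
  then show "(f has_real_derivative deriv f x) (at x)"
    by (simp add: DERIV_deriv_iff_field_differentiable)
  have "(deriv ^^ n) (deriv f) field_differentiable at x" for n x
  proof -
    have "(deriv ^^ Suc n) f field_differentiable at x" using assms unfolding smooth_def by blast
    then show ?thesis by (simp only: funpow_Suc_right o_apply)
  qed
  then show "smooth (deriv f)" by (simp add: smooth_def)
qed

lemma smooth_continuous: "smooth f \<Longrightarrow> continuous_on S f"
  by (meson DERIV_isCont continuous_at_imp_continuous_on smooth_deriv(1))

lemma smooth_higher: "smooth f \<Longrightarrow> smooth ((deriv ^^ n) f)"
  by (induction n) (auto intro: smooth_deriv)

text \<open>Differentiating a product of smooth functions gives a sum of products, so the coinduction for
  products runs over the algebra that the smooth functions generate.\<close>

inductive_set smooth_alg :: "(real \<Rightarrow> real) set" where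
  base: "smooth f \<Longrightarrow> f \<in> smooth_alg"
| add: "f \<in> smooth_alg \<Longrightarrow> g \<in> smooth_alg \<Longrightarrow> (\<lambda>x. f x + g x) \<in> smooth_alg"
| mult: "f \<in> smooth_alg \<Longrightarrow> g \<in> smooth_alg \<Longrightarrow> (\<lambda>x. f x * g x) \<in> smooth_alg"

lemma smooth_alg: "f \<in> smooth_alg \<Longrightarrow> smooth f"
proof (erule smooth_coinduct)
  fix g assume "g \<in> smooth_alg"
  then show "\<exists>g'\<in>smooth_alg. \<forall>x. (g has_real_derivative g' x) (at x)"
  proof induction
    case (base f)
    then show ?case using smooth_deriv by (blast intro: smooth_alg.base)
  next
    case (add f g)
    then obtain f' g' where "f' \<in> smooth_alg" "g' \<in> smooth_alg"
      "\<And>x. (f has_real_derivative f' x) (at x)" "\<And>x. (g has_real_derivative g' x) (at x)" by blast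
    then show ?case
      by (intro bexI[of _ "\<lambda>x. f' x + g' x"]) (auto intro: smooth_alg.add DERIV_add)
  next
    case (mult f g)
    then obtain f' g' where "f' \<in> smooth_alg" "g' \<in> smooth_alg"
      "\<And>x. (f has_real_derivative f' x) (at x)" "\<And>x. (g has_real_derivative g' x) (at x)" by blast
    then show ?case using mult.hyps
      by (intro bexI[of _ "\<lambda>x. f' x * g x + g' x * f x"])
        (auto intro!: smooth_alg.add smooth_alg.mult DERIV_mult)
  qed
qed

lemma smooth_mult: "smooth f \<Longrightarrow> smooth g \<Longrightarrow> smooth (\<lambda>x. f x * g x)"
  and smooth_add: "smooth f \<Longrightarrow> smooth g \<Longrightarrow> smooth (\<lambda>x. f x + g x)"
  by (auto intro: smooth_alg smooth_alg.intros)

lemma smooth_const: "smooth (\<lambda>x. c)"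
  by (rule smooth_coinduct[where S="range (\<lambda>c x. c)"]) (auto intro!: derivative_eq_intros)

lemma smooth_cmult: "smooth f \<Longrightarrow> smooth (\<lambda>x. c * f x)"
  by (rule smooth_mult[OF smooth_const])

lemma smooth_affine:
  assumes "smooth f" shows "smooth (\<lambda>x. f (a * x + b))"
\<comment> \<open>The multiples are included because the chain rule produces a factor
  \<open>a\<close>.\<close>
proof (rule smooth_coinduct[where S="{\<lambda>x. c * g (a * x + b) |c g. smooth g}"])
  show "(\<lambda>x. f (a * x + b)) \<in> {\<lambda>x. c * g (a * x + b) |c g. smooth g}"
    using assms by (intro CollectI exI[of _ 1] exI[of _ f]) auto
next
  fix h assume "h \<in> {\<lambda>x. c * g (a * x + b) |c g. smooth g}"
  then obtain c g where g: "smooth g" and h: "h = (\<lambda>x. c * g (a * x + b))" by blast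
  have "(h has_real_derivative (c * a) * deriv g (a * x + b)) (at x)" for x
  proof -
    have "((\<lambda>x. g (a * x + b)) has_real_derivative deriv g (a * x + b) * a) (at x)"
      by (rule DERIV_chain2[OF smooth_deriv(1)[OF g]]) (auto intro!: derivative_eq_intros)
    from DERIV_cmult[OF this, of c] show ?thesis by (simp add: h mult_ac)
  qed
  then show "\<exists>h'\<in>{\<lambda>x. c * g (a * x + b) |c g. smooth g}. \<forall>x. (h has_real_derivative h' x) (at x)"
    using smooth_deriv(2)[OF g] by (intro bexI[of _ "\<lambda>x. (c * a) * deriv g (a * x + b)"]) auto
qed

lemma smooth_antideriv:
  assumes F: "\<And>x. (F has_real_derivative f x) (at x)" and f: "smooth f"
  shows "smooth F"
proof (rule smooth_coinduct[where S="insert F {f. smooth f}"])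
  fix g assume "g \<in> insert F {f. smooth f}"
  then show "\<exists>g'\<in>insert F {f. smooth f}. \<forall>x. (g has_real_derivative g' x) (at x)"
    using F f smooth_deriv by blast
qed auto

text \<open>Differentiating a sine advances its phase by \<open>pi / 2\<close>, so the phase-shifted
  sines are closed under differentiation.\<close>

lemma smooth_sin: "smooth (\<lambda>x. sin (x + c))"
proof (rule smooth_coinduct[where S="range (\<lambda>c x. sin (x + c))"])
  fix g :: "real \<Rightarrow> real" assume "g \<in> range (\<lambda>c x. sin (x + c))"
  then obtain c where g: "g = (\<lambda>x. sin (x + c))" by blast
  have "(g has_real_derivative sin (x + (c + pi / 2))) (at x)" for x
    unfolding g by (auto intro!: derivative_eq_intros simp: sin_add cos_add)
  then show "\<exists>g'\<in>range (\<lambda>c x. sin (x + c)). \<forall>x. (g has_real_derivative g' x) (at x)"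
    by (intro bexI[of _ "\<lambda>x. sin (x + (c + pi / 2))"]) auto
qed auto

text \<open>All derivatives of \<open>exp (- 1 / x)\<close> are polynomials in \<open>1 / x\<close> times \<open>exp (- 1 / x)\<close>.\<close>

definition flat :: "real poly \<Rightarrow> real \<Rightarrow> real" where
  "flat p x = (if 0 < x then poly p (1 / x) * exp (- (1 / x)) else 0)"

lemma tendsto_flat: "((\<lambda>x::real. poly p (1 / x) * exp (- (1 / x))) \<longlongrightarrow> 0) (at_right 0)"
proof -
  have "((\<lambda>y::real. \<Sum>i\<le>degree p. coeff p i * (y ^ i / exp y)) \<longlongrightarrow> (\<Sum>i\<le>degree p. coeff p i * 0)) at_top"
    by (intro tendsto_sum tendsto_mult tendsto_const tendsto_power_div_exp_0)
  then have "((\<lambda>y::real. poly p y * exp (- y)) \<longlongrightarrow> 0) at_top"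
    by (simp add: poly_altdef exp_minus sum_distrib_right divide_inverse mult.assoc)
  from filterlim_compose[OF this filterlim_inverse_at_top_right] show ?thesis
    by (simp add: inverse_eq_divide)
qed

text \<open>The factor \<open>[:0, 0, 1:]\<close> is the square of \<open>1 / x\<close> contributed
  by the inner derivative. At zero the difference quotient is again of this form, with
  \<open>p\<close> multiplied by the variable, and tends to zero.\<close>

lemma DERIV_flat:
  "(flat p has_real_derivative flat ([:0, 0, 1:] * (p - pderiv p)) x) (at x)"
proof -
  consider "0 < x" | "x < 0" | "x = 0" by linarith
  then show ?thesis
  proof cases
    case 1
    have "((\<lambda>x. poly p (1 / x) * exp (- (1 / x))) has_real_derivative
        flat ([:0, 0, 1:] * (p - pderiv p)) x) (at x)"
      using 1 by (auto intro!: derivative_eq_intros DERIV_chain2[OF poly_DERIV]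
          simp: flat_def power2_eq_square divide_simps algebra_simps)
    then show ?thesis
      by (rule has_field_derivative_transform_within_open[where S="{0<..}"])
        (use 1 in \<open>auto simp: flat_def\<close>)
  next
    case 2
    have "((\<lambda>x. 0) has_real_derivative 0) (at x)" by simp
    then have "(flat p has_real_derivative 0) (at x)"
      by (rule has_field_derivative_transform_within_open[where S="{..<0}"])
        (use 2 in \<open>auto simp: flat_def\<close>)
    then show ?thesis using 2 by (simp add: flat_def)
  next
    case 3
    have "((\<lambda>h. flat p h / h) \<longlongrightarrow> 0) (at_left 0)"
    proof (rule tendsto_eventually)
      show "\<forall>\<^sub>F h in at_left 0. flat p h / h = 0"
        unfolding eventually_at_filter by (auto simp: flat_def intro: always_eventually)
    qed
    moreover have "((\<lambda>h. flat p h / h) \<longlongrightarrow> 0) (at_right 0)"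
    proof (rule Lim_transform_eventually[OF tendsto_flat[of "[:0, 1:] * p"]])
      show "\<forall>\<^sub>F h in at_right 0. poly ([:0, 1:] * p) (1 / h) * exp (- (1 / h)) = flat p h / h"
        unfolding eventually_at_filter by (auto simp: flat_def intro: always_eventually)
    qed
    ultimately have "((\<lambda>h. flat p h / h) \<longlongrightarrow> 0) (at 0)"
      by (rule filterlim_split_at)
    then have "((\<lambda>h. (flat p (0 + h) - flat p 0) / h) \<longlongrightarrow> 0) (at 0)"
      by (simp add: flat_def)
    then have "(flat p has_real_derivative 0) (at 0)" unfolding DERIV_def .
    then show ?thesis using 3 by (simp add: flat_def)
  qed
qed

lemma smooth_flat: "smooth (flat p)"
  by (rule smooth_coinduct[where S="range flat"]) (use DERIV_flat in blast)+

text \<open>The normalised primitive of a bump that vanishes outside the unit interval, itself the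
  product of a flat function and its mirror image.\<close>

lemma smooth_step_exists:
  "\<exists>S. smooth S \<and> (\<forall>x\<le>0. S x = 0) \<and> (\<forall>x\<ge>1. S x = 1)"
proof -
  define b where "b x = flat 1 x * flat 1 (- 1 * x + 1)" for x
  \<comment> \<open>Starting at -1 instead of 0 makes every \<open>x \<ge> 0\<close> an interior
    point of the interval on which the primitive is differentiated.\<close>
  define F where "F x = integral {- 1..x} b" for x
  have sb: "smooth b"
    unfolding b_def by (intro smooth_mult smooth_flat smooth_affine)
  have cb: "continuous_on S b" for S by (rule smooth_continuous[OF sb])
  have b0: "b x = 0" if "x \<le> 0 \<or> 1 \<le> x" for x using that by (auto simp: b_def flat_def)
  have F0: "F x = 0" if "x \<le> 0" for x
  proof -
    have "F x = integral {- 1..x} (\<lambda>x. 0)"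
      unfolding F_def by (rule integral_cong) (use b0 that in auto)
    then show ?thesis by simp
  qed
  have dF: "(F has_real_derivative b x) (at x)" for x
  proof (cases "x < 0")
    case True
    have "((\<lambda>x. 0) has_real_derivative 0) (at x)" by simp
    then have "(F has_real_derivative 0) (at x)"
      by (rule has_field_derivative_transform_within_open[where S="{..<0}"])
        (use True F0 in auto)
    then show ?thesis using True b0 by simp
  next
    case False
    have "(F has_real_derivative b x) (at x within {- 1..x + 1})"
      unfolding F_def using False by (intro integral_has_real_derivative cb) auto
    then show ?thesis
      using False by (simp add: at_within_Icc_at)
  qed
  have F1: "F x = F 1" if "1 \<le> x" for x
  proof -
    have "integral {- 1..1} b + integral {1..x} b = F x"
      unfolding F_def using that
      by (intro Henstock_Kurzweil_Integration.integral_combine integrable_continuous_real cb) auto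
    moreover have "integral {1..x} b = integral {1..x} (\<lambda>x. 0)"
      by (rule integral_cong) (use b0 in auto)
    ultimately show ?thesis by (simp add: F_def)
  qed
  have n: "F 1 \<noteq> 0"
  proof
    assume "F 1 = 0"
    then have "\<forall>x\<in>{- 1..1}. b x = 0"
      unfolding F_def by (subst (asm) integral_eq_0_iff[OF cb]) (auto simp: b_def flat_def)
    then have "b (1 / 2) = 0" by auto
    then show False by (simp add: b_def flat_def)
  qed
  show ?thesis
  proof (intro exI conjI allI impI)
    show "smooth (\<lambda>x. inverse (F 1) * F x)"
      by (intro smooth_cmult smooth_antideriv[OF dF sb])
    show "inverse (F 1) * F x = 0" if "x \<le> 0" for x using F0[OF that] by simp
    show "inverse (F 1) * F x = 1" if "1 \<le> x" for x using n unfolding F1[OF that] by simp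
  qed
qed

lemma deriv_n_cong:
  assumes "open U" "\<And>x. x \<in> U \<Longrightarrow> f x = g x"
  shows "x \<in> U \<Longrightarrow> (deriv ^^ n) f x = (deriv ^^ n) g x"
proof (induction n arbitrary: x)
  case 0 then show ?case using assms(2) by simp
next
  case (Suc n)
  have "eventually (\<lambda>y. (deriv ^^ n) f y = (deriv ^^ n) g y) (nhds x)"
    using eventually_nhds_in_open[OF assms(1) Suc.prems] by eventually_elim (rule Suc.IH)
  then show ?case by (simp add: deriv_cong_ev)
qed

lemma deriv_shift: "deriv (\<lambda>x. f (x + l)) x = deriv f (x + l)" for f :: "real \<Rightarrow> real"
  unfolding deriv_def by (simp add: DERIV_shift)

lemma deriv_n_shift: "(deriv ^^ n) (\<lambda>x. f (x + l)) x = (deriv ^^ n) f (x + l)" for f :: "real \<Rightarrow> real"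
proof (induction n arbitrary: x)
  case (Suc n)
  have "(deriv ^^ n) (\<lambda>x. f (x + l)) = (\<lambda>x. (deriv ^^ n) f (x + l))" using Suc by blast
  then show ?case by (simp add: deriv_shift)
qed auto

lemma deriv_n_add:
  assumes "smooth f" "smooth g"
  shows "(deriv ^^ n) (\<lambda>x. f x + g x) x = (deriv ^^ n) f x + (deriv ^^ n) g x"
proof (induction n arbitrary: x)
  case (Suc n)
  have "(deriv ^^ n) (\<lambda>x. f x + g x) = (\<lambda>x. (deriv ^^ n) f x + (deriv ^^ n) g x)" using Suc by blast
  moreover have "deriv (\<lambda>x. (deriv ^^ n) f x + (deriv ^^ n) g x) x = (deriv ^^ Suc n) f x + (deriv ^^ Suc n) g x"
    using smooth_deriv(1)[OF smooth_higher[OF assms(1)], of n x]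
      smooth_deriv(1)[OF smooth_higher[OF assms(2)], of n x]
    by (intro DERIV_imp_deriv) (auto intro: DERIV_add)
  ultimately show ?case by simp
qed auto

lemma deriv_n_sin:
  "(deriv ^^ n) (\<lambda>x. sin (\<mu> * x + c)) x = \<mu> ^ n * sin (\<mu> * x + (c + real n * (pi / 2)))" for \<mu> :: real
proof (induction n arbitrary: x)
  case (Suc n)
  have "(deriv ^^ n) (\<lambda>x. sin (\<mu> * x + c)) = (\<lambda>x. \<mu> ^ n * sin (\<mu> * x + (c + real n * (pi / 2))))"
    using Suc by blast
  moreover have "deriv (\<lambda>x. \<mu> ^ n * sin (\<mu> * x + d)) x = \<mu> ^ Suc n * sin (\<mu> * x + d + pi / 2)" for d
    by (rule DERIV_imp_deriv) (auto intro!: derivative_eq_intros simp: sin_add cos_add algebra_simps)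
  moreover have "\<mu> * x + (c + real n * (pi / 2)) + pi / 2 = \<mu> * x + (c + real (Suc n) * (pi / 2))"
    by (simp add: field_simps)
  ultimately show ?case by (simp only: funpow.simps o_apply)
qed auto

lemma L2_on_integrable_square:
  assumes "L2_on {a<..<b} g" shows "integrable (lebesgue_on {a<..<b}) (\<lambda>x. 1 + (g x)\<^sup>2)"
proof -
  have "integrable (lebesgue_on {a<..<b}) (\<lambda>x. 1::real)"
    by (rule integrable_open_interval) (intro continuous_intros)
  then show ?thesis using assms by (auto simp: L2_on_def)
qed

text \<open>The translates of the cut-off \<open>\<theta>\<close> by \<open>l\<close> add up to \<open>1\<close>, so testing with \<open>\<theta> sin\<close> on a large interval
  amounts to testing with \<open>sin\<close> on one cell.\<close>

lemma sobolev_sin_bound: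
  assumes l: "0 < l" and f: "periodic_sobolev m l f" "continuous_on UNIV f" and q: "q \<le> m"
  shows "\<exists>M. \<forall>n::int. \<forall>d. \<bar>2 * pi / l * real_of_int n\<bar> ^ q *
    \<bar>integral {- l / 2..l / 2} (\<lambda>x. f x * sin (2 * pi / l * real_of_int n * x + d))\<bar> \<le> M"
proof -
  let ?I = "{- 2 * l<..<3 * l}"
  obtain S where S: "smooth S" "\<And>x. x \<le> 0 \<Longrightarrow> S x = 0" "\<And>x. 1 \<le> x \<Longrightarrow> S x = (1::real)"
    using smooth_step_exists by blast
  \<comment> \<open>A step rising across the cell minus the same step one period later. The sum of
    \<theta> and its translate telescopes to 1 on the cell.\<close>
  define \<theta> where "\<theta> x = S (1 / l * x + 1 / 2) + (- 1) * S (1 / l * x + (- 1 / 2))" for x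
  have s\<theta>: "smooth \<theta>" unfolding \<theta>_def by (intro smooth_add smooth_cmult smooth_affine S)
  have \<theta>_out: "\<theta> x = 0" if "x \<notin> {- l / 2..3 * l / 2}" for x
  proof -
    consider "x < - l / 2" | "3 * l / 2 < x" using \<open>x \<notin> _\<close> by fastforce
    then show ?thesis
    proof cases
      case 1
      then have "1 / l * x + 1 / 2 \<le> 0" "1 / l * x + (- 1 / 2) \<le> 0" using l by (auto simp: field_simps)
      then have "S (1 / l * x + 1 / 2) = 0" "S (1 / l * x + (- 1 / 2)) = 0" by (simp_all only: S)
      then show ?thesis unfolding \<theta>_def by linarith
    next
      case 2
      then have "1 \<le> 1 / l * x + 1 / 2" "1 \<le> 1 / l * x + (- 1 / 2)" using l by (auto simp: field_simps)
      then have "S (1 / l * x + 1 / 2) = 1" "S (1 / l * x + (- 1 / 2)) = 1" by (simp_all only: S)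
      then show ?thesis unfolding \<theta>_def by linarith
    qed
  qed
  have \<theta>_sum: "\<theta> x + \<theta> (x + l) = 1" if "x \<in> {- l / 2<..<l / 2}" for x
  proof -
    have "1 / l * x + (- 1 / 2) \<le> 0" "1 \<le> 1 / l * (x + l) + 1 / 2" "1 / l * (x + l) + (- 1 / 2) = 1 / l * x + 1 / 2"
      using that l by (auto simp: field_simps)
    then have "S (1 / l * x + (- 1 / 2)) = 0" "S (1 / l * (x + l) + 1 / 2) = 1"
      "S (1 / l * (x + l) + (- 1 / 2)) = S (1 / l * x + 1 / 2)" by (simp_all only: S)
    then show ?thesis unfolding \<theta>_def by linarith
  qed
  obtain g where g: "L2_on ?I g" "weak_derivative q (- 2 * l) (3 * l) f g"
    using f(1) q l unfolding periodic_sobolev_def sobolev_on_def by (metis less_trans mult_less_cancel_right_pos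
        neg_numeral_less_numeral)
  have "bounded (\<theta> ` {- l / 2..3 * l / 2})"
    by (intro compact_imp_bounded compact_continuous_image smooth_continuous s\<theta>) auto
  then obtain B where B: "B > 0" "\<And>x. x \<in> {- l / 2..3 * l / 2} \<Longrightarrow> \<bar>\<theta> x\<bar> \<le> B"
    unfolding bounded_pos by auto
  have B': "\<bar>\<theta> x\<bar> \<le> B" for x using B \<theta>_out[of x] by (cases "x \<in> {- l / 2..3 * l / 2}") auto
  define M where "M = integral\<^sup>L (lebesgue_on ?I) (\<lambda>x. B * (1 + (g x)\<^sup>2))"
  show ?thesis
  proof (intro exI[of _ M] allI)
    fix n :: int and d :: real
    define \<mu> where "\<mu> = 2 * pi / l * real_of_int n"
    \<comment> \<open>The phase is set back so that \<open>q\<close> derivatives of the sine bring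
      it to \<open>d\<close>.\<close>
    define c where "c = d - real q * (pi / 2)"
    define \<psi> where "\<psi> x = \<theta> x * sin (\<mu> * x + c)" for x
    let ?D = "deriv ^^ q"
    have ssin: "smooth (\<lambda>x. sin (\<mu> * x + c))"
      using smooth_affine[OF smooth_sin[of c], of \<mu> 0] by simp
    have s\<psi>: "smooth \<psi>" unfolding \<psi>_def by (intro smooth_mult s\<theta> ssin)
    have "test_function (- 2 * l) (3 * l) \<psi>"
      unfolding test_function_def
    proof (rule conjI)
      show "\<forall>n x. (deriv ^^ n) \<psi> field_differentiable at x" using s\<psi> by (simp add: smooth_def)
      have out: "\<forall>x. x \<notin> {- l / 2..3 * l / 2} \<longrightarrow> \<psi> x = 0" using \<theta>_out by (simp add: \<psi>_def)
      show "\<exists>c d. - 2 * l < c \<and> d < 3 * l \<and> (\<forall>x. x \<notin> {c..d} \<longrightarrow> \<psi> x = 0)"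
        by (rule exI[of _ "- l / 2"], rule exI[of _ "3 * l / 2"]) (use l out in auto)
    qed
    then have weak: "integral\<^sup>L (lebesgue_on ?I) (\<lambda>x. f x * ?D \<psi> x) =
        (- 1) ^ q * integral\<^sup>L (lebesgue_on ?I) (\<lambda>x. g x * \<psi> x)"
      using g(2) unfolding weak_derivative_def by blast
    have c\<psi>: "continuous_on X \<psi>" and cD: "continuous_on X (?D \<psi>)" for X
      by (intro smooth_continuous smooth_higher s\<psi>)+
    have sq: "integrable (lebesgue_on ?I) (\<lambda>x. B * (1 + (g x)\<^sup>2))"
      using L2_on_integrable_square[OF g(1)] by simp
    \<comment> \<open>The majorant involves neither the frequency nor the phase, which makes the
      final bound uniform in both.\<close>
    have pt: "\<bar>g x * \<psi> x\<bar> \<le> B * (1 + (g x)\<^sup>2)" for x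
    proof -
      have "\<bar>\<psi> x\<bar> \<le> B * 1"
        unfolding \<psi>_def abs_mult using B'[of x] B(1) by (intro mult_mono) auto
      moreover have "\<bar>g x\<bar> \<le> 1 + (g x)\<^sup>2"
        using zero_le_power2[of "\<bar>g x\<bar> - 1"] by (simp add: power2_diff) 
      ultimately have "\<bar>\<psi> x\<bar> * \<bar>g x\<bar> \<le> (B * 1) * (1 + (g x)\<^sup>2)"
        using B(1) by (intro mult_mono) auto
      then show ?thesis by (simp add: abs_mult mult.commute)
    qed
    have "integrable (lebesgue_on ?I) (\<lambda>x. g x * \<psi> x)"
    proof (rule Bochner_Integration.integrable_bound[OF sq])
      have "\<psi> \<in> borel_measurable (lebesgue_on ?I)"
        by (intro continuous_imp_measurable_on_sets_lebesgue c\<psi>) auto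
      then show "(\<lambda>x. g x * \<psi> x) \<in> borel_measurable (lebesgue_on ?I)"
        using g(1) by (auto simp: L2_on_def)
      show "AE x in lebesgue_on ?I. norm (g x * \<psi> x) \<le> norm (B * (1 + (g x)\<^sup>2))"
        using pt B(1) by (intro AE_I2) (simp add: order_trans[OF pt])
    qed
    then have "norm (integral\<^sup>L (lebesgue_on ?I) (\<lambda>x. g x * \<psi> x)) \<le> M"
      unfolding M_def by (rule Bochner_Integration.integral_norm_bound_integral[OF _ sq]) (use pt in simp)
    then have bound: "\<bar>integral\<^sup>L (lebesgue_on ?I) (\<lambda>x. f x * ?D \<psi> x)\<bar> \<le> M"
      unfolding weak by (simp add: abs_mult)
    let ?h = "\<lambda>x. f x * ?D \<psi> x"
    have ch: "continuous_on X ?h" for X by (intro continuous_intros cD continuous_on_subset[OF f(2)]) auto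
    have hint: "?h integrable_on {a..b}" for a b by (intro integrable_continuous_real ch)
    have D0: "?D \<psi> x = 0" if "x \<notin> {- l / 2..3 * l / 2}" for x
    proof -
      have "?D \<psi> x = ?D (\<lambda>x. 0 * x) x"
        by (rule deriv_n_cong[where U="- {- l / 2..3 * l / 2}"])
          (use that \<theta>_out in \<open>auto simp: \<psi>_def\<close>)
      also have "?D (\<lambda>x::real. 0 * x) = (\<lambda>x. 0)" by (induction q) auto
      finally show ?thesis by simp
    qed
    have "integral\<^sup>L (lebesgue_on ?I) ?h = integral {- 2 * l..3 * l} ?h"
      by (rule lebesgue_open_interval_integral[OF ch])
    also have "\<dots> = integral {- l / 2..3 * l / 2} ?h"
    proof (rule integral_unique, rule has_integral_on_superset[OF integrable_integral[OF hint]])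
      show "?h x = 0" if "x \<notin> {- l / 2..3 * l / 2}" for x using D0[OF that] by simp
    qed (use l in auto)
    also have "\<dots> = integral {- l / 2..l / 2} ?h + integral {l / 2..3 * l / 2} ?h"
      by (rule Henstock_Kurzweil_Integration.integral_combine[symmetric, OF _ _ hint]) (use l in auto)
    also have "integral {l / 2..3 * l / 2} ?h = integral {- l / 2..l / 2} (\<lambda>x. ?h (x + l))"
          proof -
      have "- l / 2 + l = l / 2" "l / 2 + l = 3 * l / 2" by simp_all
      then show ?thesis
        using integral_shift_Icc_real[of "- l / 2" "l / 2" ?h l] by (simp only: o_def add.commute[of l])
    qed
    also have "integral {- l / 2..l / 2} ?h + integral {- l / 2..l / 2} (\<lambda>x. ?h (x + l)) =
        integral {- l / 2..l / 2} (\<lambda>x. ?h x + ?h (x + l))"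
    proof (rule Henstock_Kurzweil_Integration.integral_add[symmetric, OF hint])
      show "(\<lambda>x. ?h (x + l)) integrable_on {- l / 2..l / 2}"
        by (intro integrable_continuous_real continuous_on_compose2[OF ch[of UNIV]] continuous_intros) auto
    qed
    also have "\<dots> = integral {- l / 2..l / 2} (\<lambda>x. \<mu> ^ q * (f x * sin (\<mu> * x + d)))"
      unfolding integral_open_interval_real
    proof (rule integral_cong)
      fix x assume x: "x \<in> {- l / 2<..<l / 2}"
      \<comment> \<open>On the open cell \<psi> and its translate add up to the pure sine, which has
        period \<open>l\<close>, so all derivatives of the cut-off cancel.\<close>
      have "?D \<psi> x + ?D \<psi> (x + l) = ?D (\<lambda>x. \<psi> x + \<psi> (x + l)) x"
      proof -
        have "smooth (\<lambda>x. \<psi> (x + l))" using smooth_affine[OF s\<psi>, of 1 l] by simp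
        from deriv_n_add[OF s\<psi> this, of q x] show ?thesis by (simp add: deriv_n_shift)
      qed
      also have "\<dots> = ?D (\<lambda>x. sin (\<mu> * x + c)) x"
      proof (rule deriv_n_cong[OF _ _ x])
        fix x assume x: "x \<in> {- l / 2<..<l / 2}"
        have "\<mu> * (x + l) + c = (\<mu> * x + c) + 2 * pi * real_of_int n"
          using l by (simp add: \<mu>_def field_simps)
        then have "sin (\<mu> * (x + l) + c) = sin (\<mu> * x + c)"
          by (simp only: sin_add sin_int_2pin cos_int_2pin) simp
        then have "\<psi> x + \<psi> (x + l) = (\<theta> x + \<theta> (x + l)) * sin (\<mu> * x + c)"
          by (simp add: \<psi>_def distrib_right)
        then show "\<psi> x + \<psi> (x + l) = sin (\<mu> * x + c)" using \<theta>_sum[OF x] by simp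
      qed auto
      also have "\<dots> = \<mu> ^ q * sin (\<mu> * x + d)" by (simp add: deriv_n_sin c_def)
      finally have "?D \<psi> x + ?D \<psi> (x + l) = \<mu> ^ q * sin (\<mu> * x + d)" .
      moreover have "f (x + l) = f x" using f(1) by (simp add: periodic_sobolev_def periodic_def)
      ultimately show "?h x + ?h (x + l) = \<mu> ^ q * (f x * sin (\<mu> * x + d))"
        by (simp add: algebra_simps flip: distrib_left)
    qed
    finally have "integral\<^sup>L (lebesgue_on ?I) ?h = \<mu> ^ q * integral {- l / 2..l / 2} (\<lambda>x. f x * sin (\<mu> * x + d))"
      by simp
    then show "\<bar>2 * pi / l * real_of_int n\<bar> ^ q *
        \<bar>integral {- l / 2..l / 2} (\<lambda>x. f x * sin (2 * pi / l * real_of_int n * x + d))\<bar> \<le> M"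
      using bound unfolding \<mu>_def[symmetric] by (simp add: abs_mult power_abs)
  qed
qed

text \<open>The phases \<open>pi / 2\<close> and 0 give the real and imaginary parts of the
  coefficient; the supremum of \<open>f\<close> covers the zero frequency.\<close>

lemma sobolev_dec:
  assumes l: "0 < l" and f: "periodic_sobolev m l f" "continuous_on UNIV f" and q: "q \<le> m"
  shows "\<exists>r. dec q r (fc l f)"
proof -
  obtain M where M: "\<And>n d. \<bar>2 * pi / l * real_of_int n\<bar> ^ q *
    \<bar>integral {- l / 2..l / 2} (\<lambda>x. f x * sin (2 * pi / l * real_of_int n * x + d))\<bar> \<le> M"
    using sobolev_sin_bound[OF assms] by blast
  have "bounded (f ` {- l / 2..l / 2})"
    by (intro compact_imp_bounded compact_continuous_image continuous_on_subset[OF f(2)]) auto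
  then obtain M0 where "\<forall>z\<in>f ` {- l / 2..l / 2}. norm z \<le> M0"
    unfolding bounded_iff by blast
  then have M0: "\<bar>f y\<bar> \<le> M0" if "y \<in> {- l / 2..l / 2}" for y using that by auto
  have "norm (fc l f n) \<le> 2 ^ q * (M0 + (M + M) / l / (2 * pi / l) ^ q) / nu n ^ q" for n
  proof (rule dec_of_derivative)
    show "0 < 2 * pi / l" using l by simp
    show "norm (fc l f n) \<le> M0" by (rule fc_bound[OF l f(2) M0])
    define \<mu> where "\<mu> = 2 * pi / l * real_of_int n"
    let ?s = "\<lambda>d. integral {- l / 2..l / 2} (\<lambda>x. f x * sin (\<mu> * x + d))"
    have int: "((\<lambda>x. f x * sin (\<mu> * x + d)) has_integral ?s d) {- l / 2..l / 2}" for d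
      by (intro integrable_integral integrable_continuous_real continuous_intros continuous_on_subset[OF f(2)]) auto
    have e: "of_real (f x) * fe l (- n) x =
        of_real (f x * sin (\<mu> * x + pi / 2)) - \<i> * of_real (f x * sin (\<mu> * x + 0))" for x
      by (simp add: fe_def \<mu>_def complex_eq_iff sin_add)
    have "((\<lambda>x. of_real (f x) * fe l (- n) x) has_integral of_real (?s (pi / 2)) - \<i> * of_real (?s 0)) {- l / 2..l / 2}"
      unfolding e by (intro has_integral_diff has_integral_mult_right has_integral_of_real int)
    then have "fc l f n = (of_real (?s (pi / 2)) - \<i> * of_real (?s 0)) / of_real l"
      by (simp add: fc_def integral_unique)
    then have "norm (fc l f n) \<le> (\<bar>?s (pi / 2)\<bar> + \<bar>?s 0\<bar>) / l"
      using l norm_triangle_ineq4[of "complex_of_real (?s (pi / 2))" "\<i> * of_real (?s 0)"]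
      by (simp add: norm_divide norm_mult divide_right_mono)
    then have "\<bar>\<mu>\<bar> ^ q * norm (fc l f n) \<le> \<bar>\<mu>\<bar> ^ q * ((\<bar>?s (pi / 2)\<bar> + \<bar>?s 0\<bar>) / l)"
      by (intro mult_left_mono) auto
    also have "\<dots> = (\<bar>\<mu>\<bar> ^ q * \<bar>?s (pi / 2)\<bar> + \<bar>\<mu>\<bar> ^ q * \<bar>?s 0\<bar>) / l"
      by (simp add: distrib_left)
    also have "\<dots> \<le> (M + M) / l"
      using M[of n "pi / 2"] M[of n 0] l unfolding \<mu>_def by (intro divide_right_mono add_mono) auto
    finally show "norm ((\<i> * of_real (2 * pi / l * real_of_int n)) ^ q * fc l f n) \<le> (M + M) / l"
      unfolding \<mu>_def[symmetric] by (simp add: norm_mult norm_power)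
  qed
  then show ?thesis unfolding dec_def by blast
qed

section \<open>Regularity of the Kuramoto-Sivashinsky solution\<close>

text \<open>The nonlinearity costs one order of decay, and the linear part of order four gains four.\<close>

lemma KS_bootstrap_step:
  assumes \<kappa>: "0 < \<kappa>"
    and ode: "modes_solve \<kappa> T (scaled_A \<kappa> 0) (\<lambda>n. - 1 / 2) y"
    and init: "dec m r0 (\<lambda>n. y n 0)"
    and dec: "\<And>t. t \<in> {0..T} \<Longrightarrow> dec p r (\<lambda>n. y n t)"
    and p: "3 \<le> p" "s \<le> m" "s \<le> p + 3"
  shows "\<exists>r'. \<forall>t\<in>{0..T}. dec s r' (\<lambda>n. y n t)"
proof (cases "0 \<le> T")
  case T: True
  obtain q where q: "p = q + 1" "2 \<le> q" using p by (metis Suc_eq_plus1 Suc_le_D Suc_le_mono numeral_2_eq_2 numeral_3_eq_3)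
  \<comment> \<open>Chosen such that \<open>c * nu n ^ 4\<close> stays below the gap for growth rate
    2; the 8 is that of \<open>nu_power4_le\<close>.\<close>
  define c where "c = min 1 (3 * \<kappa> ^ 4) / 8"
  have c: "0 < c" using \<kappa> by (simp add: c_def)
  have gap: "c * nu n ^ 4 \<le> 2 - scaled_A \<kappa> 0 n" for n
  proof -
    have "(lam \<kappa> n)\<^sup>2 = \<kappa> ^ 4 * real_of_int n ^ 4"
      by (simp add: lam_def power_mult_distrib flip: power_mult)
    then have "1 + 3 * \<kappa> ^ 4 * real_of_int n ^ 4 \<le> 2 - scaled_A \<kappa> 0 n"
      using scaled_A_gap(1)[of 0 2 \<kappa> n] by (simp add: scaled_X_def)
    moreover have "c * nu n ^ 4 \<le> c * (8 * (1 + real_of_int n ^ 4))"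
      using c by (intro mult_left_mono nu_power4_le) auto
    moreover have "c * (8 * (1 + real_of_int n ^ 4)) \<le> 1 + 3 * \<kappa> ^ 4 * real_of_int n ^ 4"
    proof -
      have "min 1 (3 * \<kappa> ^ 4) * real_of_int n ^ 4 \<le> 3 * \<kappa> ^ 4 * real_of_int n ^ 4"
        by (intro mult_right_mono) auto
      moreover have "min 1 (3 * \<kappa> ^ 4) \<le> 1" by simp
      moreover have "c * (8 * (1 + real_of_int n ^ 4)) = min 1 (3 * \<kappa> ^ 4) + min 1 (3 * \<kappa> ^ 4) * real_of_int n ^ 4"
        by (simp add: c_def distrib_left)
      ultimately show ?thesis by linarith
    qed
    ultimately show ?thesis by linarith
  qed
  let ?B = "\<kappa>\<^sup>2 * cconv q * r * r"
  have r: "0 \<le> r" using dec[of 0] T by (auto dest: dec_nonneg)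
  have B: "0 \<le> ?B" using r cconv_pos[of q] by simp
  have r0: "0 \<le> r0" by (rule dec_nonneg[OF init])
  show ?thesis
  proof (intro exI ballI)
    fix t assume t: "t \<in> {0..T}"
    show "dec s (exp (2 * T) * (r0 + ?B / c)) (\<lambda>n. y n t)"
      unfolding dec_def
    proof
      fix n
      let ?b = "?B / nu n ^ q"
      have gap0: "scaled_A \<kappa> 0 n < 2"
        using gap[of n] c by (smt (verit) mult_pos_pos nu_pos zero_less_power)
      have "norm (y n t) \<le> exp (2 * (t - 0)) * norm (y n 0) + ?b * exp (2 * t) / (2 - scaled_A \<kappa> 0 n)"
      proof (rule ode_bound[where g="\<lambda>t. of_real (- 1 / 2) * Q \<kappa> (\<lambda>k. y k t) (\<lambda>k. y k t) n", OF _ _ gap0 _ t])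
        fix t assume t: "t \<in> {0..T}"
        show "(y n has_vector_derivative of_real (scaled_A \<kappa> 0 n) * y n t +
            of_real (- 1 / 2) * Q \<kappa> (\<lambda>k. y k t) (\<lambda>k. y k t) n) (at t within {0..T})"
          using ode t unfolding modes_solve_def by blast
        have "norm (Q \<kappa> (\<lambda>k. y k t) (\<lambda>k. y k t) n) \<le> ?b"
          using dec[OF t] q by (intro decD[OF Q_bound]) auto
        moreover have "?b * 1 \<le> ?b * exp (2 * t)"
          using B t by (intro mult_left_mono) auto
        moreover have "norm (of_real (- 1 / 2) * Q \<kappa> (\<lambda>k. y k t) (\<lambda>k. y k t) n) =
            norm (Q \<kappa> (\<lambda>k. y k t) (\<lambda>k. y k t) n) / 2"
          by (simp add: norm_mult)
        ultimately show "norm (of_real (- 1 / 2) * Q \<kappa> (\<lambda>k. y k t) (\<lambda>k. y k t) n) \<le> ?b * exp (2 * t)"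
          using norm_ge_zero[of "Q \<kappa> (\<lambda>k. y k t) (\<lambda>k. y k t) n"] by linarith
      qed (use B in auto)
      also have "\<dots> \<le> exp (2 * T) * (r0 / nu n ^ s) + exp (2 * T) * (?B / c / nu n ^ s)"
      proof (rule add_mono)
        show "exp (2 * (t - 0)) * norm (y n 0) \<le> exp (2 * T) * (r0 / nu n ^ s)"
          using t decD[OF dec_mono[OF init p(2) order_refl], of n] by (intro mult_mono) auto
        have "?b * exp (2 * t) / (2 - scaled_A \<kappa> 0 n) \<le> ?b * exp (2 * T) / (c * nu n ^ 4)"
          using t B gap[of n] c by (intro frac_le mult_left_mono) auto
        also have "\<dots> = exp (2 * T) * (?B / c / nu n ^ (q + 4))"
          by (simp add: power_add mult_ac)
        also have "\<dots> \<le> exp (2 * T) * (?B / c / nu n ^ s)"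
          using p q B c by (intro mult_left_mono divide_nu_power_mono) auto
        finally show "?b * exp (2 * t) / (2 - scaled_A \<kappa> 0 n) \<le> exp (2 * T) * (?B / c / nu n ^ s)" .
      qed
      also have "\<dots> = exp (2 * T) * (r0 + ?B / c) / nu n ^ s"
        by (simp add: distrib_left add_divide_distrib)
      finally show "norm (y n t) \<le> exp (2 * T) * (r0 + ?B / c) / nu n ^ s" .
    qed
  qed
qed auto

text \<open>Each round gains three orders net, and the initial datum caps the last one: 4, 7, 10,
  11.\<close>

lemma KS_regular:
  assumes "0 < \<kappa>" "modes_solve \<kappa> T (scaled_A \<kappa> 0) (\<lambda>n. - 1 / 2) y" "dec 11 r0 (\<lambda>n. y n 0)"
    and "\<exists>r. \<forall>t\<in>{0..T}. dec 4 r (\<lambda>n. y n t)"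
  shows "\<exists>r. \<forall>t\<in>{0..T}. dec 11 r (\<lambda>n. y n t)"
proof -
  have step: "\<exists>r'. \<forall>t\<in>{0..T}. dec s r' (\<lambda>n. y n t)"
    if "\<exists>r. \<forall>t\<in>{0..T}. dec p r (\<lambda>n. y n t)" "3 \<le> p" "s \<le> 11" "s \<le> p + 3" for p s
    using that KS_bootstrap_step[OF assms(1-3)] by blast
  have "\<exists>r'. \<forall>t\<in>{0..T}. dec 7 r' (\<lambda>n. y n t)" by (rule step[OF assms(4)]) auto
  then have "\<exists>r'. \<forall>t\<in>{0..T}. dec 10 r' (\<lambda>n. y n t)" by (rule step) auto
  then show ?thesis by (rule step) auto
qed

section \<open>The rescaled front equation\<close>

text \<open>The conjugate reflection of a solution solves the same equation with the same data. Both
  obey the bound \<open>B\<close> on the whole interval, so their difference vanishes at once,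
  without subdividing time.\<close>

lemma modes_csym:
  assumes ode: "modes_solve \<kappa> T a m x"
    and a: "\<And>n. a (- n) = a n" "\<And>n. m (- n) = m n" and init: "csym (\<lambda>n. x n 0)"
    and dec: "\<And>t. t \<in> {0..T} \<Longrightarrow> dec 3 B (\<lambda>n. x n t)"
    and gap: "\<And>n. a n < K" and K: "0 \<le> K"
    and small: "\<And>n. nu n * \<bar>m n\<bar> * (\<kappa>\<^sup>2 * cconv 2 * (3 * B)) \<le> (K - a n) / 2"
    and t: "t \<in> {0..T}"
  shows "csym (\<lambda>n. x n t)"
proof -
  define z where "z n t = cnj (x (- n) t)" for n t
  have B: "0 \<le> B" by (rule dec_nonneg[OF dec[OF t]])
  have ode_z: "modes_solve \<kappa> T a m z"
    unfolding modes_solve_def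
  proof (intro allI ballI)
    fix n t assume "t \<in> {0..T}"
    then have "(x (- n) has_vector_derivative of_real (a (- n)) * x (- n) t +
        of_real (m (- n)) * Q \<kappa> (\<lambda>k. x k t) (\<lambda>k. x k t) (- n)) (at t within {0..T})"
      using ode unfolding modes_solve_def by blast
    from bounded_linear.has_vector_derivative[OF bounded_linear_cnj this]
    show "(z n has_vector_derivative of_real (a n) * z n t +
        of_real (m n) * Q \<kappa> (\<lambda>k. z k t) (\<lambda>k. z k t) n) (at t within {0..T})"
      using Q_cnj[of \<kappa> "\<lambda>k. x k t" "\<lambda>k. x k t" n] by (simp add: z_def[abs_def] a)
  qed
  have dec_z: "dec 3 B (\<lambda>n. z n t)" if "t \<in> {0..T}" for t
    unfolding dec_def z_def using decD[OF dec[OF that]] by (metis complex_mod_cnj nu_uminus)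
  have "x n t - z n t = 0" for n
  proof (rule linear_modes_zero[where c="\<lambda>n t. x n t + z n t" and B="2 * B" and S="2 * B" and m=m
        and d="\<lambda>n t. x n t - z n t" and ta=0 and tb=T and \<kappa>=\<kappa>, OF _ _ _ _ gap _ K order_refl t])
    fix n t assume t: "t \<in> {0..T}"
    show "((\<lambda>t. x n t - z n t) has_vector_derivative of_real (a n) * (x n t - z n t) +
        of_real (m n) * Q \<kappa> (\<lambda>k. x k t + z k t) (\<lambda>k. x k t - z k t) n) (at t within {0..T})"
      by (rule modes_solve_diff[OF ode ode_z dec[OF t] dec_z[OF t] t order_refl])
  next
    show "x n 0 - z n 0 = 0" for n using init by (simp add: z_def csym_def)
    show "dec 3 (2 * B) (\<lambda>n. x n t + z n t)" "dec 3 (2 * B) (\<lambda>n. x n t - z n t)" if "t \<in> {0..T}" for t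
      using dec_add[OF dec[OF that] dec_z[OF that]] dec_diff[OF dec[OF that] dec_z[OF that]] by simp_all
    fix n
    have "nu n * \<bar>m n\<bar> * (\<kappa>\<^sup>2 * cconv 2 * (2 * B)) \<le> nu n * \<bar>m n\<bar> * (\<kappa>\<^sup>2 * cconv 2 * (3 * B))"
      using B cconv_pos[of 2] by (intro mult_left_mono) auto
    then show "nu n * \<bar>m n\<bar> * (\<kappa>\<^sup>2 * cconv 2 * (2 * B)) \<le> (K - a n) / 2"
      using small[of n] by linarith
  qed
  then have e: "x n t = z n t" for n by simp
  show ?thesis
    unfolding csym_def
  proof
    fix n show "x (- n) t = cnj (x n t)" using e[of "- n"] by (simp only: z_def minus_minus)
  qed
qed

text \<open>With time factor \<sigma>, frequency factor \<mu>, amplitude \<open>c\<close> and second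
  symbol scaled by \<rho>, the quadratic term acquires
  \<open>\<rho> * \<mu>\<^sup>2 * c\<^sup>2\<close> and has to match \<open>\<sigma> * c\<close>.
  Later \<rho> is \<open>U\<close>, \<mu> is \<open>sqrt \<epsilon> * U\<close>, \<open>c\<close> is
  \<open>\<epsilon> / U\<close> and \<sigma> is
  \<open>\<epsilon>\<^sup>2 * U\<^sup>2\<close>.\<close>

lemma modes_rescale:
  assumes ode: "modes_solve \<kappa> T a m x" and \<sigma>: "0 < \<sigma>" and c: "\<rho> * \<mu>\<^sup>2 * c = \<sigma>"
  shows "modes_solve (\<mu> * \<kappa>) (T / \<sigma>) (\<lambda>n. \<sigma> * a n) (\<lambda>n. \<rho> * m n) (\<lambda>n t. of_real c * x n (\<sigma> * t))"
  unfolding modes_solve_def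
proof (intro allI ballI)
  fix n t assume t: "t \<in> {0..T / \<sigma>}"
  then have st: "\<sigma> * t \<in> {0..T}" using \<sigma> by (auto simp: field_simps)
  have im: "(\<lambda>t. \<sigma> * t) ` {0..T / \<sigma>} \<subseteq> {0..T}" using \<sigma> by (auto simp: field_simps)
  let ?x' = "of_real (a n) * x n (\<sigma> * t) + of_real (m n) * Q \<kappa> (\<lambda>k. x k (\<sigma> * t)) (\<lambda>k. x k (\<sigma> * t)) n"
  have "(x n has_vector_derivative ?x') (at (\<sigma> * t) within (\<lambda>t. \<sigma> * t) ` {0..T / \<sigma>})"
    by (rule has_vector_derivative_within_subset[OF _ im])
      (use ode st in \<open>simp add: modes_solve_def\<close>)
  then have "(x n \<circ> (\<lambda>t. \<sigma> * t) has_vector_derivative \<sigma> *\<^sub>R ?x') (at t within {0..T / \<sigma>})"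
    by (intro vector_diff_chain_within) (auto intro!: derivative_eq_intros simp: has_vector_derivative_def)
  then have "((\<lambda>t. of_real c * x n (\<sigma> * t)) has_vector_derivative of_real c * (\<sigma> *\<^sub>R ?x')) (at t within {0..T / \<sigma>})"
    by (intro has_vector_derivative_mult_right) (simp add: o_def)
  moreover have "of_real c * (\<sigma> *\<^sub>R ?x') = of_real (\<sigma> * a n) * (of_real c * x n (\<sigma> * t)) +
      of_real (\<rho> * m n) * Q (\<mu> * \<kappa>) (\<lambda>k. of_real c * x k (\<sigma> * t)) (\<lambda>k. of_real c * x k (\<sigma> * t)) n"
  proof -
    have "complex_of_real \<sigma> = of_real \<rho> * of_real \<mu> ^ 2 * of_real c"
      by (simp flip: c)
    then show ?thesis
      unfolding Q_cmult Q_scale by (simp add: scaleR_conv_of_real power2_eq_square algebra_simps)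
  qed
  ultimately show "((\<lambda>t. of_real c * x n (\<sigma> * t)) has_vector_derivative
      of_real (\<sigma> * a n) * (of_real c * x n (\<sigma> * t)) +
      of_real (\<rho> * m n) * Q (\<mu> * \<kappa>) (\<lambda>k. of_real c * x k (\<sigma> * t)) (\<lambda>k. of_real c * x k (\<sigma> * t)) n)
      (at t within {0..T / \<sigma>})" by simp
qed

lemma scaled_uminus: "scaled_A \<kappa> \<epsilon> (- n) = scaled_A \<kappa> \<epsilon> n" "scaled_M \<kappa> \<epsilon> (- n) = scaled_M \<kappa> \<epsilon> n"
  by (simp_all add: scaled_A_def scaled_M_def scaled_X_def lam_def)

lemma scaled_front_solution:
  assumes \<kappa>: "0 < \<kappa>" and T: "0 < T"
    and ode: "modes_solve \<kappa> T (scaled_A \<kappa> 0) (\<lambda>n. - 1 / 2) P"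
    and dec_ball: "\<forall>t\<in>{0..T}. dec 11 B (\<lambda>n. P n t)" and sym: "csym (\<lambda>n. P n 0)"
  shows "\<exists>K \<epsilon>0 B' C. 0 \<le> K \<and> 0 < \<epsilon>0 \<and> \<epsilon>0 < 1 \<and> 0 < B' \<and> 0 \<le> C \<and> (\<forall>\<epsilon>. 0 < \<epsilon> \<and> \<epsilon> \<le> \<epsilon>0 \<longrightarrow>
    (\<forall>n. scaled_A \<kappa> \<epsilon> n < K) \<and>
    (\<forall>n. nu n * \<bar>scaled_M \<kappa> \<epsilon> n\<bar> * (\<kappa>\<^sup>2 * cconv 2 * (3 * B')) \<le> (K - scaled_A \<kappa> \<epsilon> n) / 2) \<and>
    (\<exists>x. modes_solve \<kappa> T (scaled_A \<kappa> \<epsilon>) (scaled_M \<kappa> \<epsilon>) x \<and> (\<forall>n. x n 0 = P n 0) \<and>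
      (\<forall>t\<in>{0..T}. csym (\<lambda>n. x n t) \<and> dec 5 B' (\<lambda>n. x n t) \<and> dec 5 (C * \<epsilon>) (\<lambda>n. x n t - P n t))))"
proof -
  \<comment> \<open>The remainder will have size at most 1, so the bound for the solution is fixed
    before \<epsilon> and may enter the choice of \<open>K\<close>.\<close>
  define B' where "B' = B + 1"
  define A where "A = \<kappa>\<^sup>2 * (cconv 4 + cconv 2) * B'"
  \<comment> \<open>With one eighth, uniqueness needs 3/8, below one half, and each contraction
    condition at most 2/8.\<close>
  define \<delta> where "\<delta> = 1 / (8 * A)"
  note dec = dec_ball[rule_format]
  \<comment> \<open>The residual per unit of \<epsilon>: six orders of decay of \<open>P\<close> pay
    for the linear symbol, two orders of its quadratic term for the other.\<close>
  define CE where "CE = (8 * \<kappa> ^ 6 + 2 * \<kappa> ^ 4) * B + 12 * \<kappa>\<^sup>2 * (\<kappa>\<^sup>2 * cconv 10 * B * B)"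
  have B: "0 \<le> B" using dec[of 0] T by (auto dest: dec_nonneg)
  then have B': "0 < B'" "B \<le> B'" "1 \<le> B'" by (auto simp: B'_def)
  have A: "0 < A" using \<kappa> B' cconv_pos[of 4] cconv_pos[of 2] by (simp add: A_def add_pos_pos)
  have A4: "\<kappa>\<^sup>2 * cconv 4 * B' \<le> A" and A2: "\<kappa>\<^sup>2 * cconv 2 * B' \<le> A"
    using B' cconv_pos[of 4] cconv_pos[of 2] by (auto simp: A_def intro!: mult_right_mono mult_left_mono)
  have \<delta>: "0 < \<delta>" "\<delta> * A = 1 / 8" using A by (auto simp: \<delta>_def)
  have CE: "0 \<le> CE" using B \<kappa> cconv_pos[of 10] by (simp add: CE_def)
  from multiplier_small[OF \<kappa> \<delta>(1)] obtain K \<epsilon>1 where K: "2 \<le> K" and \<epsilon>1: "0 < \<epsilon>1" "\<epsilon>1 \<le> 1"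
    and small: "\<And>\<epsilon> n. 0 < \<epsilon> \<Longrightarrow> \<epsilon> \<le> \<epsilon>1 \<Longrightarrow> nu n * \<bar>scaled_M \<kappa> \<epsilon> n\<bar> \<le> \<delta> * (K - scaled_A \<kappa> \<epsilon> n)"
    by blast
  \<comment> \<open>The last term keeps the remainder on the whole time interval below one half;
    adding 1 to \<open>CE\<close> avoids a division by zero.\<close>
  define \<epsilon>0 where "\<epsilon>0 = min (min \<epsilon>1 (1 / 2)) (1 / (8 * (CE + 1) * exp (K * T)))"
  define C where "C = 4 * CE * exp (K * T)"
  have \<epsilon>0: "0 < \<epsilon>0" "\<epsilon>0 < 1" using \<epsilon>1 CE by (auto simp: \<epsilon>0_def)
  have C: "0 \<le> C" using CE by (simp add: C_def)
  have dP: "dec 5 B (\<lambda>n. P n t)" if "t \<in> {0..T}" for t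
    by (rule dec_mono[OF dec[OF that]]) auto
  have P': "(P n has_vector_derivative of_real (scaled_A \<kappa> 0 n) * P n t + of_real (- 1 / 2) * Q \<kappa> (\<lambda>k. P k t) (\<lambda>k. P k t) n)
      (at t within {0..T})" if "t \<in> {0..T}" for n t
    using ode that unfolding modes_solve_def by blast
  have cP: "continuous_on {0..T} (P n)" for n
    using P' by (rule continuous_on_vector_derivative)
  have main: "(\<forall>n. scaled_A \<kappa> \<epsilon> n < K) \<and>
    (\<forall>n. nu n * \<bar>scaled_M \<kappa> \<epsilon> n\<bar> * (\<kappa>\<^sup>2 * cconv 2 * (3 * B')) \<le> (K - scaled_A \<kappa> \<epsilon> n) / 2) \<and>
    (\<exists>x. modes_solve \<kappa> T (scaled_A \<kappa> \<epsilon>) (scaled_M \<kappa> \<epsilon>) x \<and> (\<forall>n. x n 0 = P n 0) \<and>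
      (\<forall>t\<in>{0..T}. csym (\<lambda>n. x n t) \<and> dec 5 B' (\<lambda>n. x n t) \<and> dec 5 (C * \<epsilon>) (\<lambda>n. x n t - P n t)))"
    if e: "0 < \<epsilon>" "\<epsilon> \<le> \<epsilon>0" for \<epsilon>
  proof -
    let ?a = "scaled_A \<kappa> \<epsilon>" and ?m = "scaled_M \<kappa> \<epsilon>"
    have e1: "\<epsilon> \<le> \<epsilon>1" "\<epsilon> \<le> 1" using e \<epsilon>0 by (auto simp: \<epsilon>0_def)
    have gap: "1 \<le> K - ?a n" for n using scaled_A_gap(2)[of \<epsilon> \<kappa> n] K e by simp
    then have gap': "?a n < K" for n using gap[of n] by linarith
    note sm = small[OF e(1) e1(1)]
    have sm2: "nu n * \<bar>?m n\<bar> * (\<kappa>\<^sup>2 * cconv 2 * (3 * B')) \<le> (K - ?a n) / 2" for n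
    proof -
      have "nu n * \<bar>?m n\<bar> * (\<kappa>\<^sup>2 * cconv 2 * (3 * B')) \<le> \<delta> * (K - ?a n) * (3 * A)"
        using sm[of n] A2 B' cconv_pos[of 2] \<delta> gap[of n] by (intro mult_mono[OF sm]) auto
      also have "\<dots> = 3 * (\<delta> * A) * (K - ?a n)" by simp
      also have "\<dots> \<le> (K - ?a n) / 2" unfolding \<delta>(2) using gap[of n] by simp
      finally show ?thesis .
    qed
    define E where "E n t = of_real (?a n - scaled_A \<kappa> 0 n) * P n t +
      of_real (?m n + 1 / 2) * Q \<kappa> (\<lambda>k. P k t) (\<lambda>k. P k t) n" for n t
    have small_e: "8 * (\<epsilon> * CE) * exp (K * T) \<le> 1"
    proof -
      have "\<epsilon> \<le> 1 / (8 * (CE + 1) * exp (K * T))" using e by (simp add: \<epsilon>0_def)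
      moreover have "0 < 8 * (CE + 1) * exp (K * T)" using CE by simp
      ultimately have "\<epsilon> * (8 * (CE + 1) * exp (K * T)) \<le> 1" by (simp only: pos_le_divide_eq)
      moreover have "\<epsilon> * (8 * CE * exp (K * T)) \<le> \<epsilon> * (8 * (CE + 1) * exp (K * T))"
        using e by (intro mult_left_mono mult_right_mono) auto
      ultimately show ?thesis by (simp add: mult_ac)
    qed
    have "\<exists>R. (\<forall>n. R n 0 = 0) \<and>
      (\<forall>n. \<forall>t\<in>{0..T}. (R n has_vector_derivative of_real (?a n) * R n t +
         (of_real (?m n) * (2 * Q \<kappa> (\<lambda>k. P k t) (\<lambda>k. R k t) n + Q \<kappa> (\<lambda>k. R k t) (\<lambda>k. R k t) n) + E n t))
         (at t within {0..T})) \<and>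
      (\<forall>t\<in>{0..T}. dec 5 (4 * (\<epsilon> * CE) * exp (K * t)) (\<lambda>n. R n t))"
    proof (rule modes_exist[OF T _ cP _ dP _ gap sm])
      show "0 \<le> K" using K by simp
      show "continuous_on {0..T} (E n)" for n
        unfolding E_def
        by (intro continuous_intros cP continuous_on_Q[where q=4 and r=B and s=B]) (use dP in auto)
      show "dec 5 (\<epsilon> * CE) (\<lambda>n. E n t)" if t: "t \<in> {0..T}" for t
      proof -
        have "dec 5 (\<epsilon> * (8 * \<kappa> ^ 6 + 2 * \<kappa> ^ 4) * B) (\<lambda>n. of_real (?a n - scaled_A \<kappa> 0 n) * P n t)"
          using dec[OF t] scaled_A_consistent[of \<epsilon> \<kappa>] e
          by (intro dec_mult_growth[where q=6]) (auto simp del: of_real_diff)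
        moreover have "dec 5 (\<epsilon> * (12 * \<kappa>\<^sup>2) * (\<kappa>\<^sup>2 * cconv 10 * B * B))
            (\<lambda>n. of_real (?m n + 1 / 2) * Q \<kappa> (\<lambda>k. P k t) (\<lambda>k. P k t) n)"
        proof -
          have "dec 10 (\<kappa>\<^sup>2 * cconv 10 * B * B) (Q \<kappa> (\<lambda>k. P k t) (\<lambda>k. P k t))"
            using dec[OF t] by (intro Q_bound) auto
          then have "dec (5 + 2) (\<kappa>\<^sup>2 * cconv 10 * B * B) (Q \<kappa> (\<lambda>k. P k t) (\<lambda>k. P k t))"
            by (rule dec_mono) auto
          then show ?thesis
            using scaled_M_consistent[of \<epsilon> \<kappa>] e e1 by (intro dec_mult_growth[where q=2]) (auto simp del: of_real_add)
        qed
        ultimately have "dec 5 (\<epsilon> * (8 * \<kappa> ^ 6 + 2 * \<kappa> ^ 4) * B + \<epsilon> * (12 * \<kappa>\<^sup>2) * (\<kappa>\<^sup>2 * cconv 10 * B * B)) (\<lambda>n. E n t)"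
          unfolding E_def by (rule dec_add)
        then show ?thesis by (simp add: CE_def algebra_simps)
      qed
      have "\<delta> * (\<kappa>\<^sup>2 * cconv 4 * (2 * B)) \<le> \<delta> * (2 * A)"
      proof (rule mult_left_mono)
        have "\<kappa>\<^sup>2 * cconv 4 * B \<le> \<kappa>\<^sup>2 * cconv 4 * B'" using B' cconv_pos[of 4] by (intro mult_left_mono) auto
        then show "\<kappa>\<^sup>2 * cconv 4 * (2 * B) \<le> 2 * A" using A4 by linarith
      qed (use \<delta> in auto)
      then show "\<delta> * (\<kappa>\<^sup>2 * cconv 4 * (2 * B)) \<le> 1 / 4" using \<delta>(2) by linarith
      have "\<delta> * (\<kappa>\<^sup>2 * cconv 4 * (2 * (4 * (\<epsilon> * CE) * exp (K * T)))) \<le> \<delta> * (\<kappa>\<^sup>2 * cconv 4 * B')"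
        using small_e B' cconv_pos[of 4] \<delta> by (intro mult_left_mono) auto
      also have "\<dots> \<le> \<delta> * A" using A4 \<delta> by (intro mult_left_mono) auto
      finally show "\<delta> * (\<kappa>\<^sup>2 * cconv 4 * (2 * (4 * (\<epsilon> * CE) * exp (K * T)))) \<le> 1 / 4"
        using \<delta>(2) by simp
    qed
    then obtain R where R0: "\<And>n. R n 0 = 0"
      and R': "\<And>n t. t \<in> {0..T} \<Longrightarrow> (R n has_vector_derivative of_real (?a n) * R n t +
         (of_real (?m n) * (2 * Q \<kappa> (\<lambda>k. P k t) (\<lambda>k. R k t) n + Q \<kappa> (\<lambda>k. R k t) (\<lambda>k. R k t) n) + E n t))
         (at t within {0..T})"
      and dR: "\<And>t. t \<in> {0..T} \<Longrightarrow> dec 5 (4 * (\<epsilon> * CE) * exp (K * t)) (\<lambda>n. R n t)"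
      by blast
    have dR': "dec 5 (C * \<epsilon>) (\<lambda>n. R n t)" if t: "t \<in> {0..T}" for t
    proof (rule dec_mono[OF dR[OF t] order_refl])
      have "4 * (\<epsilon> * CE) * exp (K * t) \<le> 4 * (\<epsilon> * CE) * exp (K * T)"
        using e CE K t by (intro mult_left_mono) auto
      then show "4 * (\<epsilon> * CE) * exp (K * t) \<le> C * \<epsilon>" by (simp add: C_def mult_ac)
    qed
    define x where "x n t = P n t + R n t" for n t
    have Ce: "C * \<epsilon> \<le> 1" using small_e by (simp add: C_def mult_ac)
    have dx: "dec 5 B' (\<lambda>n. x n t)" if "t \<in> {0..T}" for t
      unfolding x_def by (rule dec_mono[OF dec_add[OF dP[OF that] dR'[OF that]]]) (use Ce in \<open>auto simp: B'_def\<close>)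
    have x_ode: "modes_solve \<kappa> T ?a ?m x"
      unfolding modes_solve_def
    proof (intro allI ballI)
      fix n t assume t: "t \<in> {0..T}"
      let ?P = "\<lambda>k. P k t" and ?R = "\<lambda>k. R k t"
      have dPR: "dec (4 + 1) B ?P" "dec (4 + 1) (C * \<epsilon>) ?R" "dec (4 + 1) (B + C * \<epsilon>) (\<lambda>k. P k t + R k t)"
        using dP[OF t] dR'[OF t] dec_add[OF dP[OF t] dR'[OF t]] by simp_all
      have "Q \<kappa> (\<lambda>k. x k t) (\<lambda>k. x k t) n = Q \<kappa> ?P (\<lambda>k. P k t + R k t) n + Q \<kappa> ?R (\<lambda>k. P k t + R k t) n"
        unfolding x_def by (rule Q_add_left[OF dPR]) simp
      also have "\<dots> = (Q \<kappa> ?P ?P n + Q \<kappa> ?P ?R n) + (Q \<kappa> ?R ?P n + Q \<kappa> ?R ?R n)"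
        using Q_add_right[OF dPR(1,2,1)] Q_add_right[OF dPR(1,2,2)] by simp
      also have "\<dots> = Q \<kappa> ?P ?P n + (2 * Q \<kappa> ?P ?R n + Q \<kappa> ?R ?R n)"
        by (simp add: Q_commute[of \<kappa> ?R ?P])
      finally have Qx: "Q \<kappa> (\<lambda>k. x k t) (\<lambda>k. x k t) n = Q \<kappa> ?P ?P n + (2 * Q \<kappa> ?P ?R n + Q \<kappa> ?R ?R n)" .
      have "(x n has_vector_derivative (of_real (scaled_A \<kappa> 0 n) * P n t + of_real (- 1 / 2) * Q \<kappa> ?P ?P n) +
          (of_real (?a n) * R n t + (of_real (?m n) * (2 * Q \<kappa> ?P ?R n + Q \<kappa> ?R ?R n) + E n t))) (at t within {0..T})"
        unfolding x_def[abs_def] by (rule has_vector_derivative_add[OF P'[OF t] R'[OF t]])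
      moreover have "(of_real (scaled_A \<kappa> 0 n) * P n t + of_real (- 1 / 2) * Q \<kappa> ?P ?P n) +
          (of_real (?a n) * R n t + (of_real (?m n) * (2 * Q \<kappa> ?P ?R n + Q \<kappa> ?R ?R n) + E n t)) =
          of_real (?a n) * x n t + of_real (?m n) * Q \<kappa> (\<lambda>k. x k t) (\<lambda>k. x k t) n"
        unfolding Qx unfolding x_def E_def by (simp add: algebra_simps)
      ultimately show "(x n has_vector_derivative of_real (?a n) * x n t +
          of_real (?m n) * Q \<kappa> (\<lambda>k. x k t) (\<lambda>k. x k t) n) (at t within {0..T})" by simp
    qed
    have x0: "x n 0 = P n 0" for n by (simp add: x_def R0)
    have "csym (\<lambda>n. x n t)" if "t \<in> {0..T}" for t
    proof (rule modes_csym[OF x_ode scaled_uminus _ _ gap' _ sm2 that])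
      show "csym (\<lambda>n. x n 0)" using sym by (simp add: x0)
      show "dec 3 B' (\<lambda>n. x n t)" if "t \<in> {0..T}" for t by (rule dec_mono[OF dx[OF that]]) auto
    qed (use K in auto)
    moreover have "dec 5 (C * \<epsilon>) (\<lambda>n. x n t - P n t)" if "t \<in> {0..T}" for t
      using dR'[OF that] by (simp add: x_def)
    ultimately show ?thesis using gap' sm2 x_ode x0 dx by blast
  qed
  show ?thesis
    by (rule exI[of _ K], rule exI[of _ \<epsilon>0], rule exI[of _ B'], rule exI[of _ C])
      (use K \<epsilon>0 B' C main in auto)
qed

section \<open>Back to the original variables\<close>

context
  fixes U \<epsilon> l0 l :: real
  assumes U: "0 < U" and \<epsilon>: "0 < \<epsilon>" and l0: "0 < l0" and l: "l = l0 / (sqrt \<epsilon> * U)"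
begin

lemma frequency_scale: "2 * pi / l * real_of_int n = sqrt \<epsilon> * U * (2 * pi / l0 * real_of_int n)"
  by (simp add: l)

lemma eigval_scale: "eigval l (2 * nat \<bar>n\<bar>) = \<epsilon> * U\<^sup>2 * lam (2 * pi / l0) n"
  unfolding at_freq_eigval frequency_scale lam_def using \<epsilon> by (simp only: power_mult_distrib) simp

lemma Xsym_scale: "Xsym U l (2 * nat \<bar>n\<bar>) = U * scaled_X (2 * pi / l0) \<epsilon> n"
proof -
  have "U\<^sup>2 + 4 * (\<epsilon> * U\<^sup>2 * lam (2 * pi / l0) n) = U\<^sup>2 * (1 + 4 * \<epsilon> * lam (2 * pi / l0) n)"
    by (simp add: algebra_simps)
  then show ?thesis
    unfolding Xsym_def eigval_scale scaled_X_def using U by (simp only: real_sqrt_mult) simp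
qed

lemma Asym_scale: "at_freq (Asym U (1 + \<epsilon>) l) n = \<epsilon>\<^sup>2 * U\<^sup>2 * scaled_A (2 * pi / l0) \<epsilon> n"
proof -
  define s L where "s = scaled_X (2 * pi / l0) \<epsilon> n" and "L = lam (2 * pi / l0) n"
  have s: "s \<noteq> 0" "s\<^sup>2 = 1 + 4 * \<epsilon> * L"
    using scaled_X_ge1[of \<epsilon> "2 * pi / l0" n] scaled_X_sq[of \<epsilon> "2 * pi / l0" n] \<epsilon> by (auto simp: s_def L_def)
  have "at_freq (Asym U (1 + \<epsilon>) l) n = (U\<^sup>2 - U\<^sup>2 * s\<^sup>2) * (U\<^sup>2 * s\<^sup>2 - (1 + \<epsilon>) * U\<^sup>2) / (4 * U * (U * s))"
    unfolding at_freq_def Asym_def Xsym_scale s_def by (simp add: power_mult_distrib)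
  also have "\<dots> = (U\<^sup>2 * U\<^sup>2) * ((1 - s\<^sup>2) * (s\<^sup>2 - (1 + \<epsilon>))) / (4 * U * (U * s))"
    by (simp add: algebra_simps)
  \<comment> \<open>The choice \<gamma> = 1 + \<epsilon> enters here: both factors are proportional
    to \<epsilon>, which yields the time scale \<open>\<epsilon>\<^sup>2\<close>.\<close>
  also have "(1 - s\<^sup>2) * (s\<^sup>2 - (1 + \<epsilon>)) = - (4 * \<epsilon>\<^sup>2 * (4 * L\<^sup>2 - L))"
    unfolding s(2) by (simp add: power2_eq_square algebra_simps)
  also have "(U\<^sup>2 * U\<^sup>2) * - (4 * \<epsilon>\<^sup>2 * (4 * L\<^sup>2 - L)) / (4 * U * (U * s)) = \<epsilon>\<^sup>2 * U\<^sup>2 * (- (4 * L\<^sup>2 - L) / s)"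
    using U s(1) by (simp add: power2_eq_square field_simps)
  finally show ?thesis by (simp add: scaled_A_def s_def L_def)
qed

lemma Msym_scale: "at_freq (Msym U (1 + \<epsilon>) l) n = U * scaled_M (2 * pi / l0) \<epsilon> n"
proof -
  define s where "s = scaled_X (2 * pi / l0) \<epsilon> n"
  have s: "s \<noteq> 0" using scaled_X_ge1[of \<epsilon> "2 * pi / l0" n] \<epsilon> by (auto simp: s_def)
  have "at_freq (Msym U (1 + \<epsilon>) l) n =
      ((U * s) ^ 3 - 3 * U * (U * s)\<^sup>2 - 4 * (1 + \<epsilon>) * U\<^sup>2 * (U * s) + 4 * (1 + \<epsilon>) * U ^ 3) / (4 * U * (U * s))"
    unfolding at_freq_def Msym_def Xsym_scale s_def ..
  also have "\<dots> = U * (s\<^sup>2 / 4 - 3 * s / 4 - (1 + \<epsilon>) + (1 + \<epsilon>) / s)"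
    using U s by (simp add: field_simps power2_eq_square power3_eq_cube)
  finally show ?thesis by (simp add: scaled_M_def s_def)
qed

lemma fe_scale: "fe l n y = fe l0 n (y * sqrt \<epsilon> * U)"
  unfolding fe_def frequency_scale by (simp add: mult_ac)

lemma fser_scale: "fser l c y = fser l0 c (y * sqrt \<epsilon> * U)"
  unfolding fser_def fe_scale ..

end

lemma front_solution_exists:
  assumes basis: "periodic_eigenbasis l w" and U: "0 < U" and \<epsilon>: "0 < \<epsilon>" "\<epsilon> < 1" and l0: "0 < l0"
    and leq: "l = l0 / (sqrt \<epsilon> * U)" and T: "0 < T"
    and x: "modes_solve (2 * pi / l0) T (scaled_A (2 * pi / l0) \<epsilon>) (scaled_M (2 * pi / l0) \<epsilon>) x"
    and sym: "\<And>t. t \<in> {0..T} \<Longrightarrow> csym (\<lambda>n. x n t)" and dec: "\<And>t. t \<in> {0..T} \<Longrightarrow> dec 5 B (\<lambda>n. x n t)"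
    and B: "0 < B" and K: "0 \<le> K" and gap: "\<And>n. scaled_A (2 * pi / l0) \<epsilon> n < K"
    and small: "\<And>n. nu n * \<bar>scaled_M (2 * pi / l0) \<epsilon> n\<bar> * ((2 * pi / l0)\<^sup>2 * cconv 2 * (3 * B)) \<le>
      (K - scaled_A (2 * pi / l0) \<epsilon> n) / 2"
    and init: "\<And>\<eta>. fser l0 (\<lambda>n. x n 0) \<eta> = \<Phi>0 \<eta>"
  defines "sol \<equiv> front_solution l w U (1 + \<epsilon>) (T / (\<epsilon>\<^sup>2 * U\<^sup>2)) (\<lambda>y. \<epsilon> / U * \<Phi>0 (y * sqrt \<epsilon> * U))"
    and "\<phi> \<equiv> \<lambda>t y. \<epsilon> / U * fser l0 (\<lambda>n. x n (t * \<epsilon>\<^sup>2 * U\<^sup>2)) (y * sqrt \<epsilon> * U)"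
  shows "sol \<phi>" and "\<And>\<psi> t y. sol \<psi> \<Longrightarrow> t \<in> {0..T / (\<epsilon>\<^sup>2 * U\<^sup>2)} \<Longrightarrow> \<psi> t y = \<phi> t y"
proof -
  let ?\<kappa> = "2 * pi / l0"
  define \<sigma> where "\<sigma> = \<epsilon>\<^sup>2 * U\<^sup>2"
  define c where "c = \<epsilon> / U"
  define T' where "T' = T / \<sigma>"
  define z where "z n t = of_real c * x n (\<sigma> * t)" for n t
  have lpos: "0 < l" using U \<epsilon> l0 by (simp add: leq)
  obtain \<alpha> where "eigenbasis l w \<alpha>" using eigenbasis_exists[OF lpos basis] by blast
  then interpret eigenbasis l w \<alpha> .
  note scale = U \<epsilon>(1) l0 leq
  have \<sigma>: "0 < \<sigma>" and c: "0 < c" and \<kappa>: "0 < ?\<kappa>" using U \<epsilon> l0 by (auto simp: \<sigma>_def c_def)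
  have kap: "kap = (sqrt \<epsilon> * U) * ?\<kappa>" using frequency_scale[OF scale, of 1] by (simp add: kap_def)
  have rel: "U * (sqrt \<epsilon> * U)\<^sup>2 * c = \<sigma>"
    using U \<epsilon> by (simp add: \<sigma>_def c_def power_mult_distrib power2_eq_square)
  have A: "at_freq (Asym U (1 + \<epsilon>) l) = (\<lambda>n. \<sigma> * scaled_A ?\<kappa> \<epsilon> n)"
    by (rule ext) (simp add: Asym_scale[OF scale] \<sigma>_def)
  have M: "at_freq (Msym U (1 + \<epsilon>) l) = (\<lambda>n. U * scaled_M ?\<kappa> \<epsilon> n)"
    by (rule ext) (rule Msym_scale[OF scale])
  have st: "\<sigma> * t \<in> {0..T}" if "t \<in> {0..T'}" for t
    using that \<sigma> by (auto simp: T'_def field_simps)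
  have z_ode: "modes_solve kap T' (at_freq (Asym U (1 + \<epsilon>) l)) (at_freq (Msym U (1 + \<epsilon>) l)) z"
    unfolding A M kap T'_def z_def[abs_def] by (rule modes_rescale[OF x \<sigma> rel])
  have z_dec: "dec 5 (c * B) (\<lambda>n. z n t)" if "t \<in> {0..T'}" for t
    using dec_cmult[OF dec[OF st[OF that]], of "of_real c"] c by (simp add: z_def)
  have z_sym: "csym (\<lambda>n. z n t)" if "t \<in> {0..T'}" for t
    using sym[OF st[OF that]] by (simp add: csym_def z_def)
  have \<phi>: "\<phi> = (\<lambda>t. fser l (\<lambda>n. z n t))"
    unfolding \<phi>_def z_def fser_cmult fser_scale[OF scale] c_def \<sigma>_def by (simp add: mult_ac)
  have z0: "fser l (\<lambda>n. z n 0) y = \<epsilon> / U * \<Phi>0 (y * sqrt \<epsilon> * U)" for y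
    unfolding z_def fser_cmult fser_scale[OF scale] using init by (simp add: c_def)
  have front: "front_solution l w U (1 + \<epsilon>) T' (\<lambda>y. \<epsilon> / U * \<Phi>0 (y * sqrt \<epsilon> * U)) (\<lambda>t. fser l (\<lambda>n. z n t))"
  proof (rule front_of_modes[OF z_ode z_sym z_dec _ _ z0])
    show "\<bar>at_freq (Asym U (1 + \<epsilon>) l) n\<bar> \<le> \<sigma> * (2 * ?\<kappa> ^ 3 / sqrt \<epsilon> + ?\<kappa>\<^sup>2) * nu n ^ 3" for n
      unfolding A abs_mult using scaled_A_growth[OF \<epsilon>(1) \<kappa>, of n] \<sigma>
      by (simp only: abs_of_pos mult.assoc) (rule mult_left_mono, simp_all)
    show "\<bar>at_freq (Msym U (1 + \<epsilon>) l) n\<bar> \<le> U * (5 * (1 + 4 * ?\<kappa>\<^sup>2)) * nu n ^ 2" for n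
      unfolding M abs_mult using scaled_M_growth[of \<epsilon> ?\<kappa> n] \<epsilon> U
      by (simp only: abs_of_pos mult.assoc) (rule mult_left_mono, simp_all)
  qed
  then show sol: "sol \<phi>" unfolding sol_def \<phi> T'_def \<sigma>_def .
  fix \<psi> t y assume \<psi>: "sol \<psi>" and t: "t \<in> {0..T / (\<epsilon>\<^sup>2 * U\<^sup>2)}"
  have \<psi>': "front_solution l w U (1 + \<epsilon>) T' (\<lambda>y. \<epsilon> / U * \<Phi>0 (y * sqrt \<epsilon> * U)) \<psi>"
    using \<psi> by (simp add: sol_def T'_def \<sigma>_def)
  have \<phi>': "front_solution l w U (1 + \<epsilon>) T' (\<lambda>y. \<epsilon> / U * \<Phi>0 (y * sqrt \<epsilon> * U)) \<phi>"
    using front by (simp add: \<phi>)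
  have t': "t \<in> {0..T'}" using t by (simp add: T'_def \<sigma>_def)
  obtain r where r: "\<And>t. t \<in> {0..T'} \<Longrightarrow> dec 3 r (fc l (\<psi> t))"
    using front_modes(3)[OF \<psi>'] by blast
  have fc_\<phi>: "fc l (\<phi> t) n = z n t" if "t \<in> {0..T'}" for n t
    unfolding \<phi> by (rule fc_fser[OF lpos dec_mono[OF z_dec[OF that]] z_sym[OF that]]) auto
  have "fc l (\<phi> t) n = fc l (\<psi> t) n" for n
  proof (rule modes_unique[OF front_modes(1)[OF \<phi>'] front_modes(1)[OF \<psi>'] _ _ r front_modes(2)[OF \<phi>']
        front_modes(2)[OF \<psi>'] _ _ _ _ t'])
    show "fc l (\<phi> 0) n = fc l (\<psi> 0) n" for n
      by (simp add: front_modes(4)[OF \<phi>'] front_modes(4)[OF \<psi>'])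
    show "dec 3 (c * B) (\<lambda>n. fc l (\<phi> t) n)" if "t \<in> {0..T'}" for t
      using dec_mono[OF z_dec[OF that], of 3] by (simp add: fc_\<phi>[OF that])
    show "0 < c * B" "0 \<le> \<sigma> * K" using c B \<sigma> K by auto
    fix n
    show "at_freq (Asym U (1 + \<epsilon>) l) n < \<sigma> * K" unfolding A using gap \<sigma> by simp
    \<comment> \<open>The smallness condition scales like the equation: symbol, squared frequency
      and amplitude together contribute \<sigma>, which is also the factor of the gap.\<close>
    have "nu n * \<bar>at_freq (Msym U (1 + \<epsilon>) l) n\<bar> * (kap\<^sup>2 * cconv 2 * (3 * (c * B))) =
        (U * (sqrt \<epsilon> * U)\<^sup>2 * c) * (nu n * \<bar>scaled_M ?\<kappa> \<epsilon> n\<bar> * (?\<kappa>\<^sup>2 * cconv 2 * (3 * B)))"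
      unfolding M kap power_mult_distrib abs_mult using U by (simp add: mult_ac)
    also have "\<dots> \<le> \<sigma> * ((K - scaled_A ?\<kappa> \<epsilon> n) / 2)"
      unfolding rel using \<sigma> by (intro mult_left_mono small) auto
    finally show "nu n * \<bar>at_freq (Msym U (1 + \<epsilon>) l) n\<bar> * (kap\<^sup>2 * cconv 2 * (3 * (c * B))) \<le>
        (\<sigma> * K - at_freq (Asym U (1 + \<epsilon>) l) n) / 2"
      unfolding A by (simp add: right_diff_distrib)
  qed
  then show "\<psi> t y = \<phi> t y"
    using fc_complete[OF front_modes(5,6)[OF \<psi>' t'] front_modes(5,6)[OF \<phi>' t']] by simp
qed

text \<open>One Sobolev order is worth one order of Fourier decay, hence the threshold 11. In the
  error one factor \<epsilon> is the amplitude of the front and the other is the size of the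
  remainder, summed over all modes through \<open>nusum\<close>.\<close>

theorem mainTheorem1:
  fixes w :: "real \<Rightarrow> nat \<Rightarrow> real \<Rightarrow> real"
  assumes "\<And>l. l > 0 \<Longrightarrow> periodic_eigenbasis l (w l)"
  shows "\<exists>m0::nat. \<forall>m\<ge>m0. \<forall>(U::real) (l0::real) (T::real) (\<Phi>0::real \<Rightarrow> real) (\<Phi>::real \<Rightarrow> real \<Rightarrow> real).
    0 < U \<and> U < 1 \<and> 0 < l0 \<and> 0 < T \<and> periodic_sobolev m l0 \<Phi>0 \<and> KS_solution l0 T \<Phi>0 \<Phi> \<longrightarrow>
    (\<exists>\<epsilon>0::real. 0 < \<epsilon>0 \<and> \<epsilon>0 < 1 \<and> (\<exists>C::real. 0 < C \<and>
      (\<forall>\<epsilon>::real. 0 < \<epsilon> \<and> \<epsilon> \<le> \<epsilon>0 \<longrightarrow>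
        (let l = l0 / (sqrt \<epsilon> * U);
             T' = T / (\<epsilon>\<^sup>2 * U\<^sup>2);
             sol = front_solution l (w l) U (1 + \<epsilon>) T' (\<lambda>y. \<epsilon> / U * \<Phi>0 (y * sqrt \<epsilon> * U))
         in \<exists>\<phi>. sol \<phi> \<and>
              (\<forall>\<psi>. sol \<psi> \<longrightarrow> (\<forall>t\<in>{0..T'}. \<forall>y. \<psi> t y = \<phi> t y)) \<and>
              (\<forall>t\<in>{0..T'}. \<forall>y. \<bar>y\<bar> \<le> l / 2 \<longrightarrow>
                 \<bar>\<phi> t y - \<epsilon> / U * \<Phi> (t * \<epsilon>\<^sup>2 * U\<^sup>2) (y * sqrt \<epsilon> * U)\<bar> \<le> C * \<epsilon>\<^sup>2)))))"
proof (rule exI[of _ 11], intro allI impI)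
  fix m :: nat and U l0 T :: real and \<Phi>0 :: "real \<Rightarrow> real" and \<Phi> :: "real \<Rightarrow> real \<Rightarrow> real"
  assume m: "11 \<le> m" and "0 < U \<and> U < 1 \<and> 0 < l0 \<and> 0 < T \<and> periodic_sobolev m l0 \<Phi>0 \<and> KS_solution l0 T \<Phi>0 \<Phi>"
  then have U: "0 < U" and l0: "0 < l0" and T: "0 < T" and sob: "periodic_sobolev m l0 \<Phi>0"
    and KS: "KS_solution l0 T \<Phi>0 \<Phi>" by auto
  define \<kappa> where "\<kappa> = 2 * pi / l0"
  define P where "P n t = fc l0 (\<Phi> t) n" for n t
  have \<kappa>: "0 < \<kappa>" using l0 by (simp add: \<kappa>_def)
  obtain \<alpha> where "eigenbasis l0 (w l0) \<alpha>" using eigenbasis_exists[OF l0 assms[OF l0]] by blast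
  then interpret E: eigenbasis l0 "w l0" \<alpha> .
  have P_ode: "modes_solve \<kappa> T (scaled_A \<kappa> 0) (\<lambda>n. - 1 / 2) P"
    using E.KS_modes(1)[OF KS] by (simp add: E.kap_def \<kappa>_def P_def[abs_def])
  have \<Phi>_cont: "continuous_on UNIV (\<Phi> t)" and \<Phi>_per: "periodic l0 (\<Phi> t)" if "t \<in> {0..T}" for t
    using E.KS_modes(3,4)[OF KS that] by auto
  have \<Phi>0: "\<Phi> 0 = \<Phi>0" using KS by (auto simp: KS_solution_def)
  \<comment> \<open>Continuity of the datum is inherited from the classical solution that starts
    from it.\<close>
  have "continuous_on UNIV \<Phi>0" using \<Phi>_cont[of 0] T \<Phi>0 by simp
  then obtain r0 where "dec 11 r0 (fc l0 \<Phi>0)" using sobolev_dec[OF l0 sob _ m] by blast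
  then have "dec 11 r0 (\<lambda>n. P n 0)" by (simp add: P_def \<Phi>0)
  moreover have "\<exists>r. \<forall>t\<in>{0..T}. dec 4 r (\<lambda>n. P n t)"
    using E.KS_modes(2)[OF KS] by (simp add: P_def)
  ultimately obtain B where B_ball: "\<forall>t\<in>{0..T}. dec 11 B (\<lambda>n. P n t)"
    using KS_regular[OF \<kappa> P_ode] by blast
  note B = B_ball[rule_format]
  have P_sym: "csym (\<lambda>n. P n t)" for t by (simp add: csym_def P_def fc_cnj)
  have P_ser: "fser l0 (\<lambda>n. P n t) \<eta> = \<Phi> t \<eta>" if "t \<in> {0..T}" for t \<eta>
    using E.fser_fc[OF \<Phi>_cont[OF that] \<Phi>_per[OF that], of B \<eta>] dec_mono[OF B[OF that], of 2]
    by (simp add: P_def)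
  obtain K \<epsilon>0 B' C where *: "0 \<le> K \<and> 0 < \<epsilon>0 \<and> \<epsilon>0 < 1 \<and> 0 < B' \<and> 0 \<le> C \<and> (\<forall>\<epsilon>. 0 < \<epsilon> \<and> \<epsilon> \<le> \<epsilon>0 \<longrightarrow>
      (\<forall>n. scaled_A \<kappa> \<epsilon> n < K) \<and>
      (\<forall>n. nu n * \<bar>scaled_M \<kappa> \<epsilon> n\<bar> * (\<kappa>\<^sup>2 * cconv 2 * (3 * B')) \<le> (K - scaled_A \<kappa> \<epsilon> n) / 2) \<and>
      (\<exists>x. modes_solve \<kappa> T (scaled_A \<kappa> \<epsilon>) (scaled_M \<kappa> \<epsilon>) x \<and> (\<forall>n. x n 0 = P n 0) \<and>
        (\<forall>t\<in>{0..T}. csym (\<lambda>n. x n t) \<and> dec 5 B' (\<lambda>n. x n t) \<and> dec 5 (C * \<epsilon>) (\<lambda>n. x n t - P n t))))"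
    using scaled_front_solution[OF \<kappa> T P_ode B_ball P_sym] by (elim exE) (rule that)
  then have K: "0 \<le> K" and \<epsilon>0: "0 < \<epsilon>0" "\<epsilon>0 < 1" and B': "0 < B'" and C: "0 \<le> C"
    by - ((elim conjE, assumption)+)
  note sol = *[THEN conjunct2, THEN conjunct2, THEN conjunct2, THEN conjunct2, THEN conjunct2, THEN spec, THEN mp]
  \<comment> \<open>Adding 1 makes the constant strictly positive, as \<open>C\<close> may be
    zero.\<close>
  define C' where "C' = C * nusum / U + 1"
  have C': "0 < C'" using C U nusum_nonneg by (simp add: C'_def add_nonneg_pos)
  show "\<exists>\<epsilon>0::real. 0 < \<epsilon>0 \<and> \<epsilon>0 < 1 \<and> (\<exists>C::real. 0 < C \<and>
      (\<forall>\<epsilon>::real. 0 < \<epsilon> \<and> \<epsilon> \<le> \<epsilon>0 \<longrightarrow>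
        (let l = l0 / (sqrt \<epsilon> * U);
             T' = T / (\<epsilon>\<^sup>2 * U\<^sup>2);
             sol = front_solution l (w l) U (1 + \<epsilon>) T' (\<lambda>y. \<epsilon> / U * \<Phi>0 (y * sqrt \<epsilon> * U))
         in \<exists>\<phi>. sol \<phi> \<and>
              (\<forall>\<psi>. sol \<psi> \<longrightarrow> (\<forall>t\<in>{0..T'}. \<forall>y. \<psi> t y = \<phi> t y)) \<and>
              (\<forall>t\<in>{0..T'}. \<forall>y. \<bar>y\<bar> \<le> l / 2 \<longrightarrow>
                 \<bar>\<phi> t y - \<epsilon> / U * \<Phi> (t * \<epsilon>\<^sup>2 * U\<^sup>2) (y * sqrt \<epsilon> * U)\<bar> \<le> C * \<epsilon>\<^sup>2))))"
    unfolding Let_def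
  proof (rule exI[of _ \<epsilon>0], intro conjI \<epsilon>0, rule exI[of _ C'], intro conjI C' allI impI)
    fix \<epsilon> :: real assume "0 < \<epsilon> \<and> \<epsilon> \<le> \<epsilon>0"
    then have e: "0 < \<epsilon>" "\<epsilon> \<le> \<epsilon>0" "\<epsilon> < 1" using \<epsilon>0 by auto
    note sol_e = sol[OF conjI[OF e(1,2)]]
    have gap: "scaled_A \<kappa> \<epsilon> n < K" for n
      by (rule sol_e[THEN conjunct1, THEN spec])
    have small: "nu n * \<bar>scaled_M \<kappa> \<epsilon> n\<bar> * (\<kappa>\<^sup>2 * cconv 2 * (3 * B')) \<le> (K - scaled_A \<kappa> \<epsilon> n) / 2" for n
      by (rule sol_e[THEN conjunct2, THEN conjunct1, THEN spec])
    obtain x where x: "modes_solve \<kappa> T (scaled_A \<kappa> \<epsilon>) (scaled_M \<kappa> \<epsilon>) x" "\<And>n. x n 0 = P n 0"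
      and x_dec: "\<And>t. t \<in> {0..T} \<Longrightarrow> csym (\<lambda>n. x n t)" "\<And>t. t \<in> {0..T} \<Longrightarrow> dec 5 B' (\<lambda>n. x n t)"
      and diff: "\<And>t. t \<in> {0..T} \<Longrightarrow> dec 5 (C * \<epsilon>) (\<lambda>n. x n t - P n t)"
      using sol_e[THEN conjunct2, THEN conjunct2] by metis
    let ?l = "l0 / (sqrt \<epsilon> * U)" and ?T = "T / (\<epsilon>\<^sup>2 * U\<^sup>2)"
    have lpos: "0 < ?l" using l0 U e by simp
    have init: "fser l0 (\<lambda>n. x n 0) \<eta> = \<Phi>0 \<eta>" for \<eta>
      using P_ser[of 0 \<eta>] T by (simp add: x(2) \<Phi>0)
    define \<phi> where "\<phi> t y = \<epsilon> / U * fser l0 (\<lambda>n. x n (t * \<epsilon>\<^sup>2 * U\<^sup>2)) (y * sqrt \<epsilon> * U)" for t y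
    note ex = front_solution_exists[OF assms[OF lpos] U e(1,3) l0 refl T x(1)[unfolded \<kappa>_def] x_dec B' K
        gap[unfolded \<kappa>_def] small[unfolded \<kappa>_def] init, folded \<phi>_def]
    have err: "\<bar>\<phi> t y - \<epsilon> / U * \<Phi> (t * \<epsilon>\<^sup>2 * U\<^sup>2) (y * sqrt \<epsilon> * U)\<bar> \<le> C' * \<epsilon>\<^sup>2" if t: "t \<in> {0..?T}" for t y
    proof -
      define \<tau> \<eta> where "\<tau> = t * \<epsilon>\<^sup>2 * U\<^sup>2" and "\<eta> = y * sqrt \<epsilon> * U"
      have \<tau>: "\<tau> \<in> {0..T}" using t e U by (auto simp: \<tau>_def field_simps)
      have "dec 2 B' (\<lambda>n. x n \<tau>)" "dec 2 B (\<lambda>n. P n \<tau>)"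
        by (rule dec_mono[OF x_dec(2)[OF \<tau>]]; simp) (rule dec_mono[OF B[OF \<tau>]]; simp)
      from fser_diff[OF this] have "\<phi> t y - \<epsilon> / U * \<Phi> \<tau> \<eta> = \<epsilon> / U * fser l0 (\<lambda>n. x n \<tau> - P n \<tau>) \<eta>"
        by (simp add: \<phi>_def P_ser[OF \<tau>] right_diff_distrib flip: \<tau>_def \<eta>_def)
      moreover have "\<bar>fser l0 (\<lambda>n. x n \<tau> - P n \<tau>) \<eta>\<bar> \<le> C * \<epsilon> * nusum"
        by (rule fser_bound[OF dec_mono[OF diff[OF \<tau>]]]) auto
      ultimately have "\<bar>\<phi> t y - \<epsilon> / U * \<Phi> \<tau> \<eta>\<bar> \<le> \<epsilon> / U * (C * \<epsilon> * nusum)"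
        using e U by (simp only: abs_mult) (intro mult_mono, auto)
      also have "\<dots> = C * nusum / U * \<epsilon>\<^sup>2" by (simp add: power2_eq_square)
      also have "\<dots> \<le> C' * \<epsilon>\<^sup>2" by (intro mult_right_mono) (auto simp: C'_def)
      finally show ?thesis by (simp add: \<tau>_def \<eta>_def)
    qed
    show "\<exists>\<phi>. front_solution ?l (w ?l) U (1 + \<epsilon>) ?T (\<lambda>y. \<epsilon> / U * \<Phi>0 (y * sqrt \<epsilon> * U)) \<phi> \<and>
        (\<forall>\<psi>. front_solution ?l (w ?l) U (1 + \<epsilon>) ?T (\<lambda>y. \<epsilon> / U * \<Phi>0 (y * sqrt \<epsilon> * U)) \<psi> \<longrightarrow>
          (\<forall>t\<in>{0..?T}. \<forall>y. \<psi> t y = \<phi> t y)) \<and>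
        (\<forall>t\<in>{0..?T}. \<forall>y. \<bar>y\<bar> \<le> ?l / 2 \<longrightarrow>
          \<bar>\<phi> t y - \<epsilon> / U * \<Phi> (t * \<epsilon>\<^sup>2 * U\<^sup>2) (y * sqrt \<epsilon> * U)\<bar> \<le> C' * \<epsilon>\<^sup>2)"
    proof (rule exI[of _ \<phi>], intro conjI allI impI ballI)
      show "front_solution ?l (w ?l) U (1 + \<epsilon>) ?T (\<lambda>y. \<epsilon> / U * \<Phi>0 (y * sqrt \<epsilon> * U)) \<phi>"
        by (rule ex(1))
    next
      fix \<psi> t y assume \<psi>: "front_solution ?l (w ?l) U (1 + \<epsilon>) ?T (\<lambda>y. \<epsilon> / U * \<Phi>0 (y * sqrt \<epsilon> * U)) \<psi>"
        and t: "t \<in> {0..?T}"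
      show "\<psi> t y = \<phi> t y" by (rule ex(2)[OF _ _ \<psi> t])
    next
      fix t y assume t: "t \<in> {0..?T}"
      show "\<bar>\<phi> t y - \<epsilon> / U * \<Phi> (t * \<epsilon>\<^sup>2 * U\<^sup>2) (y * sqrt \<epsilon> * U)\<bar> \<le> C' * \<epsilon>\<^sup>2"
        by (rule err[OF t])
    qed
  qed
qed

end
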